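(* Assume (A1)–(A5). Then $$W_*:=\sup_{\zeta\in\mathcal A(\mathcal F^2_t)}\inf_{\xi\in\mathcal A_{ac}(\mathcal F^1_t)}N(\xi,\zeta)=\inf_{\xi\in\mathcal A_{ac}(\mathcal F^1_t)}\sup_{\zeta\in\mathcal A(\mathcal F^2_t)}N(\xi,\zeta)=:W^*,$$ and, writing $W$ for this common value, there exists $\zeta^*\in\mathcal A(\mathcal F^2_t)$ with $\inf_{\xi\in\mathcal A_{ac}(\mathcal F^1_t)}N(\xi,\zeta^* )=W$.
   Context: $(\Omega,\mathcal F,\mathbb P)$ complete probability space, filtration $(\mathcal F_t)_{t\in[0,T]}$, $T\in(0,\infty]$, and filtrations $\mathcal F^i_t\subseteq\mathcal F_t$, $i=1,2$. $\mathcal L_b$ = càdlàg $\mathcal B([0,T])\otimes\mathcal F$-measurable processes $X$ with $\mathbb E[\sup_t|X_t|]<\infty$; $X\in\mathcal L_b$ is regular if $\mathbb E[X_\eta-X_{\eta-}\mid\mathcal F_{\eta-}]=0$ a.s. for all predictable $(\mathcal F_t)$-stopping times $\eta$ (for $T=\infty$ also at $\infty$ with $\mathcal F_{\infty-}=\sigma(\cup_t\mathcal F_t)$). For $(\mathcal G_t)\subseteq(\mathcal F_t)$: $\mathcal A^\circ(\mathcal G_t)$ = $(\mathcal G_t)$-adapted processes $\rho$ with, for all $\omega$, $t\mapsto\rho_t(\omega)$ càdlàg non-decreasing, $\rho_{0-}=0$, $\rho_T=1$; $\mathcal A^\circ_{ac}(\mathcal G_t)$ = those $\rho\in\mathcal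 A^\circ(\mathcal G_t)$ with $t\mapsto\rho_t(\omega)$ absolutely continuous on $[0,T)$ for all $\omega$ (a jump at $T$ is allowed). Let $\mathcal S=L^2([0,T]\times\Omega,\mathcal B([0,T])\otimes\mathcal F,\lambda\times\mathbb P)$, $\lambda$ Lebesgue measure. $\mathcal A(\mathcal G_t)$ (resp. $\mathcal A_{ac}(\mathcal G_t)$) is the set of $\rho\in\mathcal S$ equal $(\lambda\times\mathbb P)$-a.e. to some $\hat\rho\in\mathcal A^\circ(\mathcal G_t)$ (resp. $\mathcal A^\circ_{ac}(\mathcal G_t)$), called a càdlàg representative; Lebesgue–Stieltjes integrals with respect to elements of $\mathcal A(\cdot)$ (and expressions involving $\rho_t,\rho_{t-},\Delta\rho_t=\rho_t-\rho_{t-}$) are defined via any càdlàg representative (well defined up to indistinguishability). For $\xi\in\mathcal A(\mathcal F^1_t)$, $\zeta\in\mathcal A(\mathcal F^2_t)$, $$N(\xi,\zeta)=\mathbb E\Big[\int_{[0,T)}f_t(1-\zeta_t)d\xi_t+\int_{[0,T)}g_t(1-\xi_t)d\zeta_t+\sum_{t\in[0,T]}h_t\Delta\xi_t\Delta\zeta_t\Big].$$ Assumptions: (A1) $f,g\in\mathcal L_b$; (A2) $f,g$ are $(\mathcal F_t)$-adapted regular; (A3) $f_t\ge h_t\ge g_t$ for all $t$ a.s.; (A4) $h$ $(\mathcal F_t)$-adapted measurable; (A5) $(\mathcal F_t),(\mathcal F^i_t)$ right-continuous and $\mathcal F^i_0$ contain all $\mathbb P$-null sets. *)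

theory Defs
  imports "HOL-Probability.Probability"
begin

text \<open>Time is indexed by extended reals so that the horizon T may be +infinity;
  the time set is I = {0..T}.  Processes have type ereal => 'a => real.\<close>

definition tset :: "ereal \<Rightarrow> ereal set" where
  "tset T = {0..T}"

text \<open>Lebesgue measure on [0,T] (the point +infinity, if present, is a null set).\<close>
definition lam :: "ereal \<Rightarrow> ereal measure" where
  "lam T = restrict_space (distr lborel borel ereal) (tset T)"

definition is_filtration :: "'a measure \<Rightarrow> ereal \<Rightarrow> (ereal \<Rightarrow> 'a measure) \<Rightarrow> bool" where
  "is_filtration M T F \<longleftrightarrow>
     (\<forall>t\<in>tset T. space (F t) = space M \<and> sets (F t) \<subseteq> sets M) \<and>
     (\<forall>s\<in>tset T. \<forall>t\<in>tset T. s \<le> t \<longrightarrow> sets (F s) \<subseteq> sets (F t))"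

definition sub_filtration :: "ereal \<Rightarrow> (ereal \<Rightarrow> 'a measure) \<Rightarrow> (ereal \<Rightarrow> 'a measure) \<Rightarrow> bool" where
  "sub_filtration T G F \<longleftrightarrow> (\<forall>t\<in>tset T. sets (G t) \<subseteq> sets (F t))"

definition right_continuous_filtration :: "ereal \<Rightarrow> (ereal \<Rightarrow> 'a measure) \<Rightarrow> bool" where
  "right_continuous_filtration T F \<longleftrightarrow>
     (\<forall>t\<in>tset T. t < T \<longrightarrow> sets (F t) = (\<Inter>s\<in>{t<..T}. sets (F s)))"

definition adapted :: "ereal \<Rightarrow> (ereal \<Rightarrow> 'a measure) \<Rightarrow> (ereal \<Rightarrow> 'a \<Rightarrow> real) \<Rightarrow> bool" where
  "adapted T F X \<longleftrightarrow> (\<forall>t\<in>tset T. X t \<in> borel_measurable (F t))"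

definition prog_meas :: "'a measure \<Rightarrow> ereal \<Rightarrow> (ereal \<Rightarrow> 'a \<Rightarrow> real) \<Rightarrow> bool" where
  "prog_meas M T X \<longleftrightarrow> (\<lambda>p. X (fst p) (snd p)) \<in> borel_measurable (lam T \<Otimes>\<^sub>M M)"

definition llim :: "(ereal \<Rightarrow> 'a \<Rightarrow> real) \<Rightarrow> ereal \<Rightarrow> 'a \<Rightarrow> real" where
  "llim X t \<omega> = Lim (at_left t) (\<lambda>s. X s \<omega>)"

definition cadlag_path :: "ereal \<Rightarrow> (ereal \<Rightarrow> real) \<Rightarrow> bool" where
  "cadlag_path T x \<longleftrightarrow>
     (\<forall>t\<in>tset T. t < T \<longrightarrow> (x \<longlongrightarrow> x t) (at_right t)) \<and>
     (\<forall>t\<in>tset T. 0 < t \<longrightarrow> (\<exists>l. (x \<longlongrightarrow> l) (at_left t)))"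

definition Lb :: "'a measure \<Rightarrow> ereal \<Rightarrow> (ereal \<Rightarrow> 'a \<Rightarrow> real) set" where
  "Lb M T = {X. (\<forall>\<omega>\<in>space M. cadlag_path T (\<lambda>t. X t \<omega>)) \<and> prog_meas M T X \<and>
               (\<integral>\<^sup>+\<omega>. (SUP t\<in>tset T. ennreal \<bar>X t \<omega>\<bar>) \<partial>M) < \<infinity>}"

definition stopping_time_on :: "'a measure \<Rightarrow> ereal \<Rightarrow> (ereal \<Rightarrow> 'a measure) \<Rightarrow> ('a \<Rightarrow> ereal) \<Rightarrow> bool" where
  "stopping_time_on M T F \<eta> \<longleftrightarrow> (\<forall>\<omega>\<in>space M. \<eta> \<omega> \<in> tset T) \<and>
     (\<forall>t\<in>tset T. {\<omega>\<in>space M. \<eta> \<omega> \<le> t} \<in> sets (F t))"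

definition predictable_sigma :: "'a measure \<Rightarrow> ereal \<Rightarrow> (ereal \<Rightarrow> 'a measure) \<Rightarrow> (ereal \<times> 'a) measure" where
  "predictable_sigma M T F = sigma (tset T \<times> space M)
     ({{0} \<times> A | A. A \<in> sets (F 0)} \<union>
      {{s<..t} \<times> A | s t A. s \<in> tset T \<and> t \<in> tset T \<and> s \<le> t \<and> A \<in> sets (F s)})"

definition predictable_time :: "'a measure \<Rightarrow> ereal \<Rightarrow> (ereal \<Rightarrow> 'a measure) \<Rightarrow> ('a \<Rightarrow> ereal) \<Rightarrow> bool" where
  "predictable_time M T F \<eta> \<longleftrightarrow> stopping_time_on M T F \<eta> \<and>
     {(t, \<omega>) \<in> tset T \<times> space M. \<eta> \<omega> \<le> t} \<in> sets (predictable_sigma M T F)"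

definition F_minus :: "'a measure \<Rightarrow> ereal \<Rightarrow> (ereal \<Rightarrow> 'a measure) \<Rightarrow> ('a \<Rightarrow> ereal) \<Rightarrow> 'a measure" where
  "F_minus M T F \<eta> = sigma (space M)
     (sets (F 0) \<union> {A \<inter> {\<omega>\<in>space M. t < \<eta> \<omega>} | A t. t \<in> tset T \<and> A \<in> sets (F t)})"

definition lminus_reg :: "(ereal \<Rightarrow> 'a \<Rightarrow> real) \<Rightarrow> ereal \<Rightarrow> 'a \<Rightarrow> real" where
  "lminus_reg X t \<omega> = (if t = 0 then X 0 \<omega> else llim X t \<omega>)"

definition regular :: "'a measure \<Rightarrow> ereal \<Rightarrow> (ereal \<Rightarrow> 'a measure) \<Rightarrow> (ereal \<Rightarrow> 'a \<Rightarrow> real) \<Rightarrow> bool" where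
  "regular M T F X \<longleftrightarrow> X \<in> Lb M T \<and>
     (\<forall>\<eta>. predictable_time M T F \<eta> \<longrightarrow>
        (AE \<omega> in M. real_cond_exp M (F_minus M T F \<eta>)
            (\<lambda>\<omega>. X (\<eta> \<omega>) \<omega> - lminus_reg X (\<eta> \<omega>) \<omega>) \<omega> = 0))"

definition abs_cont_on :: "real set \<Rightarrow> (real \<Rightarrow> real) \<Rightarrow> bool" where
  "abs_cont_on S u \<longleftrightarrow> (\<forall>e>0. \<exists>d>0. \<forall>n::nat. \<forall>a b.
      (\<forall>i<n. a i \<in> S \<and> b i \<in> S \<and> a i \<le> b i) \<and>
      (\<forall>i<n. \<forall>j<n. i \<noteq> j \<longrightarrow> b i \<le> a j \<or> b j \<le> a i) \<and>
      (\<Sum>i<n. b i - a i) < d \<longrightarrow> (\<Sum>i<n. \<bar>u (b i) - u (a i)\<bar>) < e)"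

definition below_T :: "ereal \<Rightarrow> real set" where
  "below_T T = {x. 0 \<le> x \<and> ereal x < T}"

definition Acirc :: "'a measure \<Rightarrow> ereal \<Rightarrow> (ereal \<Rightarrow> 'a measure) \<Rightarrow> (ereal \<Rightarrow> 'a \<Rightarrow> real) set" where
  "Acirc M T G = {\<rho>. adapted T G \<rho> \<and>
     (\<forall>\<omega>\<in>space M. cadlag_path T (\<lambda>t. \<rho> t \<omega>) \<and>
        mono_on (tset T) (\<lambda>t. \<rho> t \<omega>) \<and> 0 \<le> \<rho> 0 \<omega> \<and> \<rho> T \<omega> = 1)}"

definition Acirc_ac :: "'a measure \<Rightarrow> ereal \<Rightarrow> (ereal \<Rightarrow> 'a measure) \<Rightarrow> (ereal \<Rightarrow> 'a \<Rightarrow> real) set" where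
  "Acirc_ac M T G = {\<rho>\<in>Acirc M T G.
     \<forall>\<omega>\<in>space M. abs_cont_on (below_T T) (\<lambda>x. \<rho> (ereal x) \<omega>)}"

definition ae_equal :: "'a measure \<Rightarrow> ereal \<Rightarrow> (ereal \<Rightarrow> 'a \<Rightarrow> real) \<Rightarrow> (ereal \<Rightarrow> 'a \<Rightarrow> real) \<Rightarrow> bool" where
  "ae_equal M T \<rho> \<sigma> \<longleftrightarrow> (AE p in lam T \<Otimes>\<^sub>M M. \<rho> (fst p) (snd p) = \<sigma> (fst p) (snd p))"

definition Acls :: "'a measure \<Rightarrow> ereal \<Rightarrow> (ereal \<Rightarrow> 'a measure) \<Rightarrow> (ereal \<Rightarrow> 'a \<Rightarrow> real) set" where
  "Acls M T G = {\<rho>. prog_meas M T \<rho> \<and> (\<exists>\<sigma>\<in>Acirc M T G. ae_equal M T \<rho> \<sigma>)}"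

definition Acls_ac :: "'a measure \<Rightarrow> ereal \<Rightarrow> (ereal \<Rightarrow> 'a measure) \<Rightarrow> (ereal \<Rightarrow> 'a \<Rightarrow> real) set" where
  "Acls_ac M T G = {\<rho>. prog_meas M T \<rho> \<and> (\<exists>\<sigma>\<in>Acirc_ac M T G. ae_equal M T \<rho> \<sigma>)}"

definition repr :: "'a measure \<Rightarrow> ereal \<Rightarrow> (ereal \<Rightarrow> 'a measure) \<Rightarrow> (ereal \<Rightarrow> 'a \<Rightarrow> real) \<Rightarrow> (ereal \<Rightarrow> 'a \<Rightarrow> real)" where
  "repr M T G \<rho> = (SOME \<sigma>. \<sigma> \<in> Acirc M T G \<and> ae_equal M T \<rho> \<sigma>)"

definition lminus :: "(ereal \<Rightarrow> 'a \<Rightarrow> real) \<Rightarrow> ereal \<Rightarrow> 'a \<Rightarrow> real" where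
  "lminus \<rho> t \<omega> = (if t = 0 then 0 else llim \<rho> t \<omega>)"

definition jump :: "(ereal \<Rightarrow> 'a \<Rightarrow> real) \<Rightarrow> ereal \<Rightarrow> 'a \<Rightarrow> real" where
  "jump \<rho> t \<omega> = \<rho> t \<omega> - lminus \<rho> t \<omega>"

text \<open>Lebesgue--Stieltjes measure d rho(omega) on the real line: the distribution function is
  0 on (-inf,0) (rho_{0-}=0) and rho_{min(x,T)} for x >= 0.\<close>
definition LS :: "ereal \<Rightarrow> (ereal \<Rightarrow> 'a \<Rightarrow> real) \<Rightarrow> 'a \<Rightarrow> real measure" where
  "LS T \<rho> \<omega> = interval_measure (\<lambda>x. if x < 0 then 0 else \<rho> (min (ereal x) T) \<omega>)"

definition Ncirc :: "'a measure \<Rightarrow> ereal \<Rightarrow> (ereal \<Rightarrow> 'a \<Rightarrow> real) \<Rightarrow> (ereal \<Rightarrow> 'a \<Rightarrow> real) \<Rightarrow>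
    (ereal \<Rightarrow> 'a \<Rightarrow> real) \<Rightarrow> (ereal \<Rightarrow> 'a \<Rightarrow> real) \<Rightarrow> (ereal \<Rightarrow> 'a \<Rightarrow> real) \<Rightarrow> real" where
  "Ncirc M T f g h \<xi> \<zeta> = (\<integral>\<omega>.
      (\<integral>x\<in>below_T T. f (ereal x) \<omega> * (1 - \<zeta> (ereal x) \<omega>) \<partial>LS T \<xi> \<omega>)
    + (\<integral>x\<in>below_T T. g (ereal x) \<omega> * (1 - \<xi> (ereal x) \<omega>) \<partial>LS T \<zeta> \<omega>)
    + (\<Sum>\<^sub>\<infinity>t\<in>tset T. h t \<omega> * jump \<xi> t \<omega> * jump \<zeta> t \<omega>) \<partial>M)"

definition Npay :: "'a measure \<Rightarrow> ereal \<Rightarrow> (ereal \<Rightarrow> 'a measure) \<Rightarrow> (ereal \<Rightarrow> 'a measure) \<Rightarrow>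
    (ereal \<Rightarrow> 'a \<Rightarrow> real) \<Rightarrow> (ereal \<Rightarrow> 'a \<Rightarrow> real) \<Rightarrow> (ereal \<Rightarrow> 'a \<Rightarrow> real) \<Rightarrow>
    (ereal \<Rightarrow> 'a \<Rightarrow> real) \<Rightarrow> (ereal \<Rightarrow> 'a \<Rightarrow> real) \<Rightarrow> real" where
  "Npay M T F1 F2 f g h \<xi> \<zeta> = Ncirc M T f g h (repr M T F1 \<xi>) (repr M T F2 \<zeta>)"

end

theory Submission
  imports Defs
begin

text \<open>
  The payoff is biaffine. Writing a control as the mixture over \<open>u \<in> (0,1)\<close> of its quantile times,
  which are stopping times, turns every Stieltjes integral into an integral over \<open>(0,1) \<times> \<Omega>\<close>.

  Weak compactness is replaced by convexity: in a directed family of convex sets of \<open>[0,1]\<close>-valued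
  functions, near-minimisers of the \<open>L\<^sup>2\<close> norm converge almost everywhere by the parallelogram law.
  Applied to the superlevel sets of the payoff, whose finite intersections are nonempty by separation
  in the plane, this yields the optimal \<open>\<zeta>\<close>, provided \<open>\<zeta> \<mapsto> N(\<xi>,\<zeta>)\<close> is upper semicontinuous along
  almost everywhere convergent sequences \<open>\<zeta>\<^sup>n\<close>.

  For that, pass to convex combinations so that also the left limits of \<open>\<zeta>\<^sup>n\<close> converge at the quantile
  times \<open>\<tau>\<^sub>u\<close> of \<open>\<zeta>\<close>. The quantile times of \<open>\<zeta>\<^sup>n\<close> then converge to \<open>\<tau>\<^sub>u\<close>, and they do so strictly from
  the left exactly where the predictable process \<open>limsup \<zeta>\<^sup>n\<^sub>-\<close> exceeds \<open>u\<close> at \<open>\<tau>\<^sub>u\<close>. The restriction of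
  \<open>\<tau>\<^sub>u\<close> to this event is a predictable time, so regularity of \<open>g\<close> shows that nothing is lost in the limit.

  A jump of \<open>\<xi>\<close> at time \<open>0\<close> is not excluded by absolute continuity on \<open>[0,T)\<close> and would destroy
  semicontinuity; spreading it over a short interval changes the payoff in favour of the minimiser.
\<close>

section \<open>Paths and their quantiles\<close>

text \<open>A limit of controls is reached only at its continuity times, and there a Stieltjes
  integral need not converge when integrand and integrator jump together. After the quantile
  substitution the measure is fixed and only the evaluation time moves, so dominated convergence
  applies and the question is from which side a quantile time is approached. The side matters only
  at \<open>T\<close> and at jump times of \<open>g\<close>, and there it is determined except for
  countably many levels \<open>v\<close> for each outcome. There are uncountably many superlevel
  sets, so no sequence of them need be cofinal. The limit of near-minimisers of the norm belongs to
  the whole directed family and can be reached from inside every member, so one \<zeta> serves every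
  \<xi>. The later convex combinations do depend on \<xi>; this is harmless because they keep the
  limit \<zeta> and the lower bound on the payoff. Regularity is applied at a fixed level, where the
  quantile time is a stopping time; the level is integrated last.\<close>

definition dpath :: "ereal \<Rightarrow> (ereal \<Rightarrow> real) \<Rightarrow> bool" where
  "dpath T x \<longleftrightarrow> cadlag_path T x \<and> mono_on (tset T) x \<and> 0 \<le> x 0 \<and> x T = 1"

text \<open>The value at 0 encodes the convention that a control is 0 before time 0, so starting
  above 0 is a jump.\<close>

definition lft :: "(ereal \<Rightarrow> real) \<Rightarrow> ereal \<Rightarrow> real" where
  "lft x t = (if t = 0 then 0 else Lim (at_left t) x)"

text \<open>The generalised inverse: for a level uniform on (0,1), this time has distribution
  function \<open>x\<close>.\<close>

definition qtl :: "ereal \<Rightarrow> (ereal \<Rightarrow> real) \<Rightarrow> real \<Rightarrow> ereal" where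
  "qtl T x u = Inf {t \<in> tset T. u \<le> x t}"

lemma lminus_eq_lft: "lminus \<rho> t \<omega> = lft (\<lambda>s. \<rho> s \<omega>) t"
  by (simp add: lminus_def lft_def llim_def)

lemma tset_iff: "t \<in> tset T \<longleftrightarrow> 0 \<le> t \<and> t \<le> T"
  by (simp add: tset_def)

lemma at_left_ereal_neq_bot: "(0::ereal) < t \<Longrightarrow> at_left t \<noteq> bot"
  by (auto simp: trivial_limit_def eventually_at_left[of 0] dest: dense)

lemma at_right_ereal_neq_bot: "(t::ereal) < T \<Longrightarrow> at_right t \<noteq> bot"
  by (auto simp: trivial_limit_def eventually_at_right[of t T] dest: dense)

lemma cadlag_path_right:
  "cadlag_path T x \<Longrightarrow> 0 \<le> t \<Longrightarrow> t < T \<Longrightarrow> (x \<longlongrightarrow> x t) (at_right t)"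
  by (simp add: cadlag_path_def tset_iff)

lemma cadlag_path_left:
  assumes "cadlag_path T x" "0 < t" "t \<le> T"
  shows "(x \<longlongrightarrow> Lim (at_left t) x) (at_left t)"
proof -
  obtain l where "(x \<longlongrightarrow> l) (at_left t)"
    using assms by (auto simp: cadlag_path_def tset_iff)
  with tendsto_Lim[OF at_left_ereal_neq_bot[OF assms(2)] this] show ?thesis by simp
qed

lemma dpath_mono: "dpath T x \<Longrightarrow> 0 \<le> s \<Longrightarrow> s \<le> t \<Longrightarrow> t \<le> T \<Longrightarrow> x s \<le> x t"
  by (auto simp: dpath_def tset_iff intro: mono_onD)

lemma dpath_nonneg: "dpath T x \<Longrightarrow> 0 \<le> t \<Longrightarrow> t \<le> T \<Longrightarrow> 0 \<le> x t"
  using dpath_mono[of T x 0 t] by (auto simp: dpath_def)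

lemma dpath_le_1: "dpath T x \<Longrightarrow> 0 \<le> t \<Longrightarrow> t \<le> T \<Longrightarrow> x t \<le> 1"
  using dpath_mono[of T x t T] by (auto simp: dpath_def)

lemma dpath_left_tendsto:
  "dpath T x \<Longrightarrow> 0 < t \<Longrightarrow> t \<le> T \<Longrightarrow> (x \<longlongrightarrow> lft x t) (at_left t)"
  using cadlag_path_left[of T x t] by (auto simp: dpath_def lft_def)

lemma le_lft:
  assumes x: "dpath T x" and "0 \<le> s" "s < t" "t \<le> T"
  shows "x s \<le> lft x t"
proof (rule tendsto_lowerbound[OF dpath_left_tendsto[OF x]])
  show "\<forall>\<^sub>F r in at_left t. x s \<le> x r"
    unfolding eventually_at_left[OF assms(3)] using assms
    by (intro exI[of _ s]) (auto intro!: dpath_mono[OF x])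
qed (use assms at_left_ereal_neq_bot[of t] in auto)

lemma lft_le:
  assumes x: "dpath T x" and "0 \<le> t" "t \<le> T"
  shows "lft x t \<le> x t"
proof (cases "t = 0")
  case True then show ?thesis using x by (simp add: lft_def dpath_def)
next
  case False
  then have t: "0 < t" using assms by auto
  show ?thesis
  proof (rule tendsto_upperbound[OF dpath_left_tendsto[OF x t assms(3)]])
    show "\<forall>\<^sub>F r in at_left t. x r \<le> x t"
      unfolding eventually_at_left[OF t] using assms t
      by (intro exI[of _ 0]) (auto intro!: dpath_mono[OF x])
  qed (use t at_left_ereal_neq_bot[of t] in auto)
qed

lemma lft_nonneg: "dpath T x \<Longrightarrow> 0 \<le> t \<Longrightarrow> t \<le> T \<Longrightarrow> 0 \<le> lft x t"
  using le_lft[of T x 0 t] dpath_nonneg[of T x 0]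
  by (cases "t = 0") (force simp: lft_def)+

lemma lft_le_1: "dpath T x \<Longrightarrow> 0 \<le> t \<Longrightarrow> t \<le> T \<Longrightarrow> lft x t \<le> 1"
  using lft_le dpath_le_1 by (meson order_trans)

text \<open>The form in which left limits are used: a strict lower bound on the limit is already
  witnessed by the path at an earlier time. The condition \<open>0 \<le> u\<close> covers
  \<open>t = 0\<close>, where both sides fail.\<close>

lemma less_lft_iff:
  assumes x: "dpath T x" and t: "0 \<le> t" "t \<le> T" and u: "0 \<le> u"
  shows "u < lft x t \<longleftrightarrow> (\<exists>s. 0 \<le> s \<and> s < t \<and> u < x s)"
proof
  assume a: "u < lft x t"
  then have "t \<noteq> 0" using u by (auto simp: lft_def)
  with t have t': "0 < t" by auto
  have "\<forall>\<^sub>F r in at_left t. u < x r"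
    using order_tendstoD(1)[OF dpath_left_tendsto[OF x t' t(2)] a] .
  then obtain b where b: "b < t" "\<And>y. b < y \<Longrightarrow> y < t \<Longrightarrow> u < x y"
    unfolding eventually_at_left[OF t'] by auto
  obtain s where "max 0 b < s" "s < t" using dense[of "max 0 b" t] b t' by auto
  then show "\<exists>s. 0 \<le> s \<and> s < t \<and> u < x s" using b by (intro exI[of _ s]) auto
next
  assume "\<exists>s. 0 \<le> s \<and> s < t \<and> u < x s"
  then show "u < lft x t" using le_lft[OF x] t by (meson less_le_trans)
qed

lemma lft_cong:
  assumes "\<And>s. 0 \<le> s \<Longrightarrow> s < t \<Longrightarrow> x s = y s" "0 \<le> t"
  shows "lft x t = lft y t"
proof (cases "t = 0")
  case False
  then have "0 < t" using assms by auto
  have "\<forall>\<^sub>F r in at_left t. x r = y r"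
    unfolding eventually_at_left[OF \<open>0 < t\<close>] using assms \<open>0 < t\<close> by (intro exI[of _ 0]) auto
  then have "(x \<longlongrightarrow> l) (at_left t) \<longleftrightarrow> (y \<longlongrightarrow> l) (at_left t)" for l
    by (rule tendsto_cong)
  then show ?thesis by (simp add: lft_def Topological_Spaces.Lim_def)
qed (simp add: lft_def)

context
  fixes T :: ereal and x :: "ereal \<Rightarrow> real"
  assumes T: "0 < T" and x: "dpath T x"
begin

lemma qtl_in_tset: "u \<le> 1 \<Longrightarrow> 0 \<le> qtl T x u \<and> qtl T x u \<le> T"
  unfolding qtl_def using T x
  by (auto intro!: Inf_lower Inf_greatest simp: tset_iff dpath_def)

text \<open>Right continuity makes the infimum in \<open>qtl\<close> attained, which turns path and
  quantile into a Galois connection.\<close>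

lemma qtl_le_iff:
  assumes u: "u \<le> 1" and t: "0 \<le> t" "t \<le> T"
  shows "qtl T x u \<le> t \<longleftrightarrow> u \<le> x t"
proof
  assume "u \<le> x t" then show "qtl T x u \<le> t"
    unfolding qtl_def using t by (auto intro!: Inf_lower simp: tset_iff)
next
  define m where "m = qtl T x u"
  have m: "0 \<le> m" "m \<le> T" using qtl_in_tset[OF u] by (auto simp: m_def)
  have "u \<le> x m"
  proof (rule ccontr)
    assume a: "\<not> u \<le> x m"
    then have "m < T" using u x m by (cases "m = T") (auto simp: dpath_def)
    have "\<forall>\<^sub>F r in at_right m. x r < u"
      using order_tendstoD(2)[OF cadlag_path_right[of T x m]] m x \<open>m < T\<close> a by (auto simp: dpath_def)
    then obtain b where b: "b > m" "\<And>y. m < y \<Longrightarrow> y < b \<Longrightarrow> x y < u"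
      unfolding eventually_at_right[OF \<open>m < T\<close>] by auto
    have "Inf {t \<in> tset T. u \<le> x t} < b" using b by (simp add: m_def qtl_def)
    then obtain s where s: "s \<in> tset T" "u \<le> x s" "s < b" by (auto simp: Inf_less_iff)
    have "m \<le> s" using s by (auto simp: m_def qtl_def intro: Inf_lower)
    then consider "m = s" | "m < s" by fastforce
    then show False using s b(2)[of s] a by cases auto
  qed
  moreover assume "qtl T x u \<le> t"
  ultimately show "u \<le> x t" using dpath_mono[OF x m(1), of t] t by (auto simp: m_def)
qed

lemma less_qtl_iff: "u \<le> 1 \<Longrightarrow> 0 \<le> t \<Longrightarrow> t \<le> T \<Longrightarrow> t < qtl T x u \<longleftrightarrow> x t < u"
  using qtl_le_iff[of u t] by (auto simp: not_le[symmetric])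

lemma le_at_qtl: "u \<le> 1 \<Longrightarrow> u \<le> x (qtl T x u)"
  using qtl_le_iff[of u "qtl T x u"] qtl_in_tset[of u] by auto

text \<open>With \<open>le_at_qtl\<close> this locates the level in the jump interval of the path at
  its own quantile time; where the path is continuous the level is the value itself.\<close>

lemma lft_at_qtl_le:
  assumes "0 \<le> u" "u \<le> 1" shows "lft x (qtl T x u) \<le> u"
proof (rule ccontr)
  assume "\<not> lft x (qtl T x u) \<le> u"
  then obtain s where "0 \<le> s" "s < qtl T x u" "u < x s"
    using less_lft_iff[OF x, of "qtl T x u" u] qtl_in_tset[of u] assms by auto
  moreover then have "s \<le> T" using qtl_in_tset[of u] assms by auto
  ultimately show False using less_qtl_iff[of u s] assms by auto
qed

text \<open>This fact and the next decide on which side of \<open>t\<close> the quantile time lies.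
  The level \<open>u = lft x t\<close> is left undecided, which is why such levels are excluded
  later.\<close>

lemma qtl_less_if_less_lft:
  assumes "0 \<le> u" "u \<le> 1" "0 \<le> t" "t \<le> T" "u < lft x t" shows "qtl T x u < t"
proof -
  obtain s where s: "0 \<le> s" "s < t" "u < x s"
    using less_lft_iff[OF x] assms by auto
  then have "qtl T x u \<le> s" using qtl_le_iff[of u s] assms by auto
  with s show ?thesis by auto
qed

lemma le_qtl_if_lft_less:
  assumes "0 \<le> u" "u \<le> 1" "0 \<le> t" "t \<le> T" "lft x t < u" shows "t \<le> qtl T x u"
proof (rule ccontr)
  assume a: "\<not> t \<le> qtl T x u"
  then have "x (qtl T x u) \<le> lft x t"
    using le_lft[OF x] qtl_in_tset[of u] assms by auto
  with le_at_qtl[of u] assms show False by auto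
qed

end

text \<open>The gaps to the left of distinct points of \<open>A\<close> are disjoint, so rationals
  chosen in them are distinct.\<close>

lemma countable_isolated_left:
  fixes A :: "ereal set"
  assumes "\<And>s. s \<in> A \<Longrightarrow> \<exists>r<s. \<forall>y. r < y \<longrightarrow> y < s \<longrightarrow> y \<notin> A"
  shows "countable A"
proof -
  have "\<exists>q::rat. \<exists>r<s. r < ereal (of_rat q) \<and> ereal (of_rat q) < s \<and> (\<forall>y. r < y \<longrightarrow> y < s \<longrightarrow> y \<notin> A)"
    if "s \<in> A" for s
  proof -
    obtain r where r: "r < s" "\<forall>y. r < y \<longrightarrow> y < s \<longrightarrow> y \<notin> A" using assms \<open>s \<in> A\<close> by blast
    obtain q where "r < ereal (real_of_rat q)" "ereal (real_of_rat q) < s"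
      using ereal_dense3[OF r(1)] by auto
    with r show ?thesis by auto
  qed
  then obtain q :: "ereal \<Rightarrow> rat" where q: "\<And>s. s \<in> A \<Longrightarrow> \<exists>r<s. r < ereal (of_rat (q s)) \<and>
      ereal (of_rat (q s)) < s \<and> (\<forall>y. r < y \<longrightarrow> y < s \<longrightarrow> y \<notin> A)"
    by metis
  have lt: "q s < q t" if st: "s \<in> A" "t \<in> A" "s < t" for s t
  proof -
    obtain r where r: "r < ereal (of_rat (q t))" "\<forall>y. r < y \<longrightarrow> y < t \<longrightarrow> y \<notin> A" using q[OF st(2)] by auto
    then have "s \<le> r" using st by (metis not_le)
    moreover have "ereal (of_rat (q s)) < s" using q[OF st(1)] by auto
    ultimately have "ereal (of_rat (q s)) < ereal (of_rat (q t))" using r(1)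
      by (meson le_less_trans less_trans)
    then show ?thesis by (simp add: of_rat_less)
  qed
  have "inj_on q A"
  proof (rule inj_onI)
    fix s t assume "s \<in> A" "t \<in> A" "q s = q t"
    then show "s = t" using lt[of s t] lt[of t s] by (cases s t rule: linorder_cases) auto
  qed
  then show ?thesis by (rule countableI')
qed

lemma countable_cadlag_jumps:
  assumes x: "cadlag_path T x"
  shows "countable {t. 0 < t \<and> t \<le> T \<and> Lim (at_left t) x \<noteq> x t}"
proof -
  have half: "countable {t. 0 < t \<and> t \<le> T \<and> Lim (at_left t) y < y t}" if y: "cadlag_path T y" for y
  proof -
    \<comment> \<open>An upward jump over a fixed rational is isolated on its left: just before it
      the path is below the rational, whereas it lies above at every member of the set.\<close>
    have "countable {t. 0 < t \<and> t \<le> T \<and> Lim (at_left t) y < of_rat p \<and> of_rat p < y t}" (is "countable ?A") for p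
    proof (rule countable_isolated_left)
      fix s assume s: "s \<in> ?A"
      then have "\<forall>\<^sub>F r in at_left s. y r < of_rat p"
        using order_tendstoD(2)[OF cadlag_path_left[OF y]] by auto
      then obtain b where "b < s" "\<And>r. b < r \<Longrightarrow> r < s \<Longrightarrow> y r < of_rat p"
        using s eventually_at_left[of 0 s] by auto
      then show "\<exists>r<s. \<forall>y. r < y \<longrightarrow> y < s \<longrightarrow> y \<notin> ?A" by (intro exI[of _ b]) force
    qed
    then have "countable (\<Union>p. {t. 0 < t \<and> t \<le> T \<and> Lim (at_left t) y < of_rat p \<and> of_rat p < y t})" by simp
    then show ?thesis
      by (rule countable_subset[rotated]) (auto dest: of_rat_dense)
  qed
  \<comment> \<open>Downward jumps are upward jumps of the negated path.\<close>
  have "cadlag_path T (\<lambda>t. - x t)"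
    using x unfolding cadlag_path_def by (auto intro!: tendsto_minus) (metis tendsto_minus)
  from half[OF this] have "countable {t. 0 < t \<and> t \<le> T \<and> Lim (at_left t) (\<lambda>t. - x t) < - x t}" .
  moreover have "Lim (at_left t) (\<lambda>t. - x t) = - Lim (at_left t) x" if "0 < t" "t \<le> T" for t
    using tendsto_Lim[OF at_left_ereal_neq_bot[OF that(1)] tendsto_minus[OF cadlag_path_left[OF x that]]] .
  ultimately have "countable ({t. 0 < t \<and> t \<le> T \<and> Lim (at_left t) (\<lambda>t. - x t) < - x t} \<union>
       {t. 0 < t \<and> t \<le> T \<and> Lim (at_left t) x < x t})" using half[OF x] by simp
  then show ?thesis
    by (rule countable_subset[rotated])
      (auto simp: \<open>\<And>t. 0 < t \<Longrightarrow> t \<le> T \<Longrightarrow> Lim (at_left t) (\<lambda>t. - x t) = - Lim (at_left t) x\<close>)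
qed

lemma countable_dpath_jumps:
  assumes "dpath T x"
  shows "countable {t. 0 \<le> t \<and> t \<le> T \<and> lft x t \<noteq> x t}"
proof -
  have "countable (insert 0 {t. 0 < t \<and> t \<le> T \<and> Lim (at_left t) x \<noteq> x t})"
    using countable_cadlag_jumps assms by (auto simp: dpath_def)
  then show ?thesis by (rule countable_subset[rotated]) (auto simp: lft_def)
qed

lemma uncountable_ereal_interval:
  fixes a b :: ereal assumes "a < b" shows "uncountable {a<..<b}"
proof -
  obtain c where c: "a < ereal c" "ereal c < b" using ereal_dense2[OF assms] by auto
  obtain d where d: "ereal c < ereal d" "ereal d < b" using ereal_dense2[OF c(2)] by auto
  have "uncountable {c<..<d}" using d by (simp add: uncountable_open_interval)
  then have "uncountable (ereal ` {c<..<d})" using countable_image_inj_eq[of ereal "{c<..<d}"] by (simp add: inj_on_def)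
  moreover have "ereal ` {c<..<d} \<subseteq> {a<..<b}"
  proof safe
    fix r assume "r \<in> {c<..<d}"
    then have "ereal c < ereal r" "ereal r < ereal d" by auto
    then show "ereal r \<in> {a<..<b}" using c d by (metis greaterThanLessThan_iff less_trans)
  qed
  ultimately show ?thesis using countable_subset by blast
qed

lemma exists_continuity_point:
  assumes x: "dpath T x" and "0 \<le> a" "a < b" "b \<le> T"
  obtains t where "a < t" "t < b" "lft x t = x t"
proof -
  have "\<not> {a<..<b} \<subseteq> {t. 0 \<le> t \<and> t \<le> T \<and> lft x t \<noteq> x t}"
    using countable_dpath_jumps[OF x] uncountable_ereal_interval[OF assms(3)] countable_subset by blast
  then show ?thesis using that assms by (auto simp: subset_iff)
qed

section \<open>The uniform randomisation variable\<close>

text \<open>Levels 0 and 1 are left out: the quantile at level 0 is always time 0, and positivity of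
  the level is used whenever a control starting at 0 must have a positive quantile time.\<close>

definition unif :: "real measure" where
  "unif = restrict_space lborel {0<..<1}"

lemma space_unif: "space unif = {0<..<1}"
  by (simp add: unif_def)

lemma prob_space_unif: "prob_space unif"
  by (simp add: unif_def prob_space_restrict_space)

lemma sets_unif: "sets unif = sets (restrict_space borel {0<..<1})"
  by (simp add: unif_def sets_restrict_space)

lemma id_measurable_unif [measurable]: "(\<lambda>x. x) \<in> borel_measurable unif"
  by (simp add: unif_def measurable_restrict_space1)

lemma AE_unif_not_in_countable: "countable A \<Longrightarrow> AE v in unif. v \<notin> A"
  unfolding unif_def
  by (subst AE_restrict_space_iff) (auto intro!: AE_I'[of A] countable_imp_null_set_lborel)

lemma emeasure_unif_atMost:
  assumes "0 \<le> a" "a \<le> 1"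
  shows "emeasure unif {u \<in> {0<..<1}. u \<le> a} = ennreal a"
proof -
  have "emeasure unif {u \<in> {0<..<1}. u \<le> a} = emeasure lborel {u \<in> {0<..<1}. u \<le> a}"
    unfolding unif_def by (subst emeasure_restrict_space) auto
  \<comment> \<open>For \<open>a = 1\<close> the endpoint 1 is missing from the set, so the
    half-open interval does not describe it.\<close>
  also have "\<dots> = emeasure lborel (if a = 1 then {0<..<1} else {0<..a})"
    using assms by (intro arg_cong[where f="emeasure lborel"]) auto
  also have "\<dots> = ennreal a" using assms by auto
  finally show ?thesis .
qed

text \<open>The level may itself be random, so that the same fact serves a fixed level on the sample
  space and the second coordinate on the product.\<close>

lemma measurable_qtl:
  assumes T: "0 < T" and r: "\<And>t. 0 \<le> t \<Longrightarrow> t \<le> T \<Longrightarrow> r t \<in> borel_measurable N"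
    and v: "v \<in> borel_measurable N" "\<And>p. p \<in> space N \<Longrightarrow> v p \<le> 1"
    and d: "\<And>p. p \<in> space N \<Longrightarrow> dpath T (\<lambda>t. r t p)"
  shows "(\<lambda>p. qtl T (\<lambda>t. r t p) (v p)) \<in> borel_measurable N"
proof (rule borel_measurableI_le)
  fix t :: ereal
  consider "t < 0" | "0 \<le> t" "t \<le> T" | "T < t" by force
  then show "{p \<in> space N. qtl T (\<lambda>t. r t p) (v p) \<le> t} \<in> sets N"
  proof cases
    case 1
    then have "{p \<in> space N. qtl T (\<lambda>t. r t p) (v p) \<le> t} = {}"
      using qtl_in_tset[OF T d v(2)] by fastforce
    then show ?thesis by (metis sets.empty_sets)
  next
    case 2
    then have "{p \<in> space N. qtl T (\<lambda>t. r t p) (v p) \<le> t} = {p \<in> space N. v p \<le> r t p}"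
      using qtl_le_iff[OF T d v(2)] by auto
    then show ?thesis using r[OF 2] v by simp
  next
    case 3
    then have "{p \<in> space N. qtl T (\<lambda>t. r t p) (v p) \<le> t} = space N"
      using qtl_in_tset[OF T d v(2)] by fastforce
    then show ?thesis by simp
  qed
qed

lemma measurable_qtl_unif:
  "0 < T \<Longrightarrow> dpath T x \<Longrightarrow> qtl T x \<in> borel_measurable unif"
  using measurable_qtl[of T "\<lambda>t _. x t" unif "\<lambda>v. v"] by (simp add: space_unif)

section \<open>Stieltjes integrals as integrals over quantile levels\<close>

abbreviation tborel :: "ereal \<Rightarrow> ereal measure" where
  "tborel T \<equiv> restrict_space borel (tset T)"

lemma emeasure_qtl_atMost:
  assumes "0 < T" "dpath T x" "0 \<le> t" "t \<le> T"
  shows "emeasure unif {u \<in> {0<..<1}. qtl T x u \<le> t} = ennreal (x t)"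
proof -
  have "{u \<in> {0<..<1}. qtl T x u \<le> t} = {u \<in> {0<..<1}. u \<le> x t}"
    using qtl_le_iff[OF assms(1,2)] assms by auto
  then show ?thesis
    using emeasure_unif_atMost[of "x t"] dpath_nonneg[OF assms(2-4)] dpath_le_1[OF assms(2-4)] by simp
qed

text \<open>These are the requirements of \<open>interval_measure\<close> for the distribution
  function used in \<open>LS\<close>. The limit at infinity is only claimed to exist: for
  \<open>T = \<infinity>\<close> the jump at \<open>T\<close> is not seen by the real line, and the
  total mass may be below 1.\<close>

lemma cdf_path:
  fixes T :: ereal and x :: "ereal \<Rightarrow> real"
  assumes T: "0 < T" and x: "dpath T x"
  defines "F \<equiv> \<lambda>y. if y < 0 then 0 else x (min (ereal y) T)"
  shows cdf_path_mono: "\<And>a b. a \<le> b \<Longrightarrow> F a \<le> F b"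
    and cdf_path_right_cont: "\<And>a. continuous (at_right a) F"
    and cdf_path_bot: "(F \<longlongrightarrow> 0) at_bot"
    and cdf_path_top: "\<exists>m\<ge>0. (F \<longlongrightarrow> m) at_top"
proof -
  show mono: "F a \<le> F b" if "a \<le> b" for a b
    using that T x by (auto simp: F_def intro!: dpath_nonneg[OF x] dpath_mono[OF x] min.mono)
  show "continuous (at_right a) F" for a
  proof -
    consider "a < 0" | "0 \<le> a" "ereal a < T" | "0 \<le> a" "T \<le> ereal a" by force
    then show ?thesis
    proof cases
      case 1
      have "\<forall>\<^sub>F y in at_right a. 0 = F y"
        unfolding eventually_at_right_field using 1 by (intro exI[of _ 0]) (auto simp: F_def)
      then have "(F \<longlongrightarrow> 0) (at_right a)" by (rule tendsto_eventually[OF eventually_mono]) simp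
      then show ?thesis using 1 by (simp add: continuous_within F_def)
    next
      case 2
      have *: "((\<lambda>y. x (ereal y)) \<longlongrightarrow> x (ereal a)) (at_right a)"
        using cadlag_path_right[of T x "ereal a"] 2 x
        by (simp add: dpath_def at_right_ereal filterlim_filtermap)
      obtain b where b: "a < b" "ereal b < T"
        using ereal_dense2[OF 2(2)] by auto
      have "\<forall>\<^sub>F y in at_right a. x (ereal y) = F y"
        unfolding eventually_at_right_field
      proof (intro exI[of _ b] conjI allI impI)
        fix y assume y: "a < y" "y < b"
        then have "ereal y < T" using b by (meson ereal_less_eq(3) le_less_trans less_imp_le)
        then show "x (ereal y) = F y" using y 2 by (simp add: F_def min_absorb1 less_imp_le)
      qed (use b in auto)
      from Lim_transform_eventually[OF * this]
      show ?thesis using 2 by (simp add: continuous_within F_def min_absorb1 less_imp_le)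
    next
      case 3
      have "\<forall>\<^sub>F y in at_right a. F a = F y"
        unfolding eventually_at_right_field
      proof (intro exI[of _ "a + 1"] conjI allI impI)
        fix y assume y: "a < y" "y < a + 1"
        then have "T \<le> ereal y" using 3 by (meson ereal_less_eq(3) less_imp_le order_trans)
        then show "F a = F y" using y 3 by (simp add: F_def min_def)
      qed auto
      then have "(F \<longlongrightarrow> F a) (at_right a)" by (rule tendsto_eventually[OF eventually_mono]) simp
      then show ?thesis by (simp add: continuous_within)
    qed
  qed
  show "(F \<longlongrightarrow> 0) at_bot"
    by (rule tendsto_eventually, rule eventually_mono[OF eventually_gt_at_bot[of "0::real"]])
      (auto simp: F_def eventually_at_bot_dense)
  show "\<exists>m\<ge>0. (F \<longlongrightarrow> m) at_top"
  proof -
    have b: "F y \<le> 1" "0 \<le> F y" for y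
      using T x by (auto simp: F_def min_def intro!: dpath_nonneg[OF x] dpath_le_1[OF x])
    have "(F \<longlongrightarrow> (SUP y. F y)) at_top"
    proof (rule increasing_tendsto)
      show "\<forall>\<^sub>F n in at_top. F n \<le> (SUP y. F y)"
        using b by (intro always_eventually allI cSUP_upper) (auto intro!: bdd_aboveI[of _ 1])
      fix z assume "z < (SUP y. F y)"
      then obtain y where "z < F y" using b by (subst (asm) less_cSUP_iff) (auto intro!: bdd_aboveI[of _ 1])
      then show "\<forall>\<^sub>F n in at_top. z < F n"
        using mono by (intro eventually_mono[OF eventually_ge_at_top[of y]]) (auto intro: less_le_trans)
    qed
    moreover have "0 \<le> (SUP y. F y)"
      using b by (intro cSUP_upper2[of _ _ 0]) (auto intro!: bdd_aboveI[of _ 1])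
    ultimately show ?thesis by auto
  qed
qed

text \<open>Two finite measures on the line with the same distribution function coincide. Levels
  whose quantile is infinite are cut away, since they carry the mass at time \<infinity> that a
  measure on the reals cannot hold.\<close>

lemma LS_eq_distr_qtl:
  assumes T: "0 < T" and x: "dpath T (\<lambda>t. r t \<omega>)"
  shows "LS T r \<omega> = distr (restrict_space unif {u. qtl T (\<lambda>t. r t \<omega>) u < \<infinity>}) borel
           (\<lambda>u. real_of_ereal (qtl T (\<lambda>t. r t \<omega>) u))"
proof -
  let ?x = "\<lambda>t. r t \<omega>"
  let ?F = "\<lambda>y. if y < 0 then 0 else r (min (ereal y) T) \<omega>"
  let ?G = "{u. qtl T ?x u < \<infinity>}"
  let ?m = "restrict_space unif ?G"
  let ?Q = "distr ?m borel (\<lambda>u. real_of_ereal (qtl T ?x u))"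
  interpret U: prob_space unif by (rule prob_space_unif)
  note [measurable] = measurable_qtl_unif[OF T x]
  have G: "?G \<inter> space unif \<in> sets unif" by (simp add: Int_def conj_commute)
  have qm: "(\<lambda>u. real_of_ereal (qtl T ?x u)) \<in> borel_measurable ?m"
    by (intro measurable_restrict_space1) measurable
  have fm: "finite_measure ?m"
    using G by (intro finite_measureI) (simp add: emeasure_restrict_space space_restrict_space)
  have fQ: "finite_borel_measure ?Q"
    by (intro finite_borel_measure.intro finite_measure.finite_measure_distr[OF fm qm])
       (simp add: finite_borel_measure_axioms_def)
  have fL: "finite_borel_measure (interval_measure ?F)"
    using cdf_path_top[OF T x] finite_borel_measure_interval_measure[OF cdf_path_mono[OF T x]
      cdf_path_right_cont[OF T x] cdf_path_bot[OF T x]] by blast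
  have "cdf (interval_measure ?F) = cdf ?Q"
  proof
    fix y
    have "cdf (interval_measure ?F) y = ?F y"
      using cdf_interval_measure[OF cdf_path_mono[OF T x] cdf_path_right_cont[OF T x] cdf_path_bot[OF T x]]
      by simp
    also have "\<dots> = measure unif {u \<in> {0<..<1}. qtl T ?x u < \<infinity> \<and> real_of_ereal (qtl T ?x u) \<le> y}"
    proof -
      have fin: "real_of_ereal (qtl T ?x u) \<le> y \<longleftrightarrow> qtl T ?x u \<le> ereal y" 
        if "qtl T ?x u < \<infinity>" "u \<in> {0<..<1}" for u
        using that qtl_in_tset[OF T x, of u] by (cases "qtl T ?x u") auto
      show ?thesis
      proof (cases "y < 0")
        case True
        then have "{u \<in> {0<..<1}. qtl T ?x u < \<infinity> \<and> real_of_ereal (qtl T ?x u) \<le> y} = {}"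
          using qtl_in_tset[OF T x] by (auto simp: real_of_ereal_pos dest: order.strict_trans2)
             (smt (verit) real_of_ereal_pos)
        then show ?thesis using True by (simp only: if_True measure_empty)
      next
        case False
        have "{u \<in> {0<..<1}. qtl T ?x u < \<infinity> \<and> real_of_ereal (qtl T ?x u) \<le> y} =
              {u \<in> {0<..<1}. qtl T ?x u \<le> min (ereal y) T}"
        proof safe
          fix u assume u: "u \<in> {0<..<1::real}"
          { assume "qtl T ?x u < \<infinity>" "real_of_ereal (qtl T ?x u) \<le> y"
            then show "qtl T ?x u \<le> min (ereal y) T" using fin[OF _ u] qtl_in_tset[OF T x, of u] u by auto }
          { assume a: "qtl T ?x u \<le> min (ereal y) T"
            then show "qtl T ?x u < \<infinity>" by (auto simp: less_top[symmetric] top_ereal_def)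
            with a show "real_of_ereal (qtl T ?x u) \<le> y" using fin[OF _ u] by auto }
        qed
        then show ?thesis using False T
          emeasure_qtl_atMost[OF T x, of "min (ereal y) T"] dpath_nonneg[OF x, of "min (ereal y) T"]
          by (simp add: measure_def)
      qed
    qed
    also have "\<dots> = measure ?m {u \<in> {0<..<1}. qtl T ?x u < \<infinity> \<and> real_of_ereal (qtl T ?x u) \<le> y}"
      by (subst measure_restrict_space[OF G]) (auto simp: space_unif)
    also have "\<dots> = cdf ?Q y"
      unfolding cdf_def
    proof (subst measure_distr[OF qm])
      show "measure ?m {u \<in> {0<..<1}. qtl T ?x u < \<infinity> \<and> real_of_ereal (qtl T ?x u) \<le> y} =
        measure ?m ((\<lambda>u. real_of_ereal (qtl T ?x u)) -` {..y} \<inter> space ?m)"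
        by (rule arg_cong[where f="measure ?m"]) (auto simp: space_restrict_space space_unif)
    qed simp
    finally show "cdf (interval_measure ?F) y = cdf ?Q y" .
  qed
  from cdf_unique'[OF fL fQ this] show ?thesis by (simp add: LS_def)
qed

text \<open>Change of variables under the quantile map. The restriction to \<open>[0,T)\<close>
  becomes the condition that the quantile time is before \<open>T\<close>, which also discards
  infinite quantile times.\<close>

lemma LS_integral_eq:
  fixes \<phi> :: "ereal \<Rightarrow> real"
  assumes T: "0 < T" and x: "dpath T (\<lambda>t. r t \<omega>)" and \<phi>: "\<phi> \<in> borel_measurable (tborel T)"
  shows "(\<integral>y\<in>below_T T. \<phi> (ereal y) \<partial>LS T r \<omega>) =
    (\<integral>u. (if qtl T (\<lambda>t. r t \<omega>) u < T then \<phi> (qtl T (\<lambda>t. r t \<omega>) u) else 0) \<partial>unif)"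
proof -
  let ?x = "\<lambda>t. r t \<omega>"
  let ?G = "{u. qtl T ?x u < \<infinity>}"
  note [measurable] = measurable_qtl_unif[OF T x]
  have G: "?G \<inter> space unif \<in> sets unif" by (simp add: Int_def conj_commute)
  have qm: "(\<lambda>u. real_of_ereal (qtl T ?x u)) \<in> borel_measurable (restrict_space unif ?G)"
    by (intro measurable_restrict_space1) measurable
  \<comment> \<open>\<open>\<phi>\<close> is measurable on \<open>[0,T]\<close> only; multiplied by
    the indicator it becomes a Borel function on the whole extended line.\<close>
  have [measurable]: "(\<lambda>t. indicator (tset T) t *\<^sub>R \<phi> t) \<in> borel_measurable borel"
    using \<phi> by (subst (asm) borel_measurable_restrict_space_iff) (auto simp: tset_def)
  have bm [measurable]: "below_T T \<in> sets borel"
  proof -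
    have "below_T T = {y. 0 \<le> y} \<inter> {y \<in> space borel. ereal y < T}" by (auto simp: below_T_def)
    also have "\<dots> \<in> sets borel" by measurable
    finally show ?thesis .
  qed
  have eq: "indicator (below_T T) y *\<^sub>R \<phi> (ereal y) =
      indicator (below_T T) y *\<^sub>R (indicator (tset T) (ereal y) *\<^sub>R \<phi> (ereal y))" for y
    by (auto simp: indicator_def below_T_def tset_iff)
  have m: "(\<lambda>y. indicator (below_T T) y *\<^sub>R \<phi> (ereal y)) \<in> borel_measurable borel"
    unfolding eq by measurable
  have "(\<integral>y\<in>below_T T. \<phi> (ereal y) \<partial>LS T r \<omega>) = (\<integral>u. indicator (below_T T) (real_of_ereal (qtl T ?x u)) *\<^sub>R
          \<phi> (ereal (real_of_ereal (qtl T ?x u))) \<partial>restrict_space unif ?G)"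
    unfolding set_lebesgue_integral_def LS_eq_distr_qtl[of T r \<omega>, OF T x]
    by (rule integral_distr[OF qm m])
  also have "\<dots> = (\<integral>u. indicator ?G u *\<^sub>R (indicator (below_T T) (real_of_ereal (qtl T ?x u)) *\<^sub>R
          \<phi> (ereal (real_of_ereal (qtl T ?x u)))) \<partial>unif)"
    by (rule integral_restrict_space[OF G])
  also have "\<dots> = (\<integral>u. (if qtl T ?x u < T then \<phi> (qtl T ?x u) else 0) \<partial>unif)"
  proof (rule Bochner_Integration.integral_cong[OF refl])
    fix u assume "u \<in> space unif"
    then have "0 \<le> qtl T ?x u" "qtl T ?x u \<le> T" using qtl_in_tset[OF T x, of u] by (auto simp: space_unif)
    then show "indicator ?G u *\<^sub>R (indicator (below_T T) (real_of_ereal (qtl T ?x u)) *\<^sub>R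
          \<phi> (ereal (real_of_ereal (qtl T ?x u)))) = (if qtl T ?x u < T then \<phi> (qtl T ?x u) else 0)"
      by (cases "qtl T ?x u") (auto simp: indicator_def below_T_def)
  qed
  finally show ?thesis .
qed

text \<open>Up to the single level \<open>lft x T\<close>, the levels with quantile \<open>T\<close>
  are those above it; their measure is the jump at \<open>T\<close>.\<close>

lemma integral_qtl_eq_T:
  assumes T: "0 < T" and x: "dpath T x"
  shows "(\<integral>u. (if qtl T x u < T then 0 else c) \<partial>unif) = c * (1 - lft x T)"
proof -
  note [measurable] = measurable_qtl_unif[OF T x]
  interpret U: prob_space unif by (rule prob_space_unif)
  let ?l = "lft x T"
  have l: "0 \<le> ?l" "?l \<le> 1" using T lft_nonneg[OF x] lft_le_1[OF x] by auto
  have ae: "AE u in unif. u \<notin> {?l}" by (rule AE_unif_not_in_countable) simp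
  have "AE u in unif. (if qtl T x u < T then 0 else c) = c * (1 - indicator {u \<in> {0<..<1}. u \<le> ?l} u)"
    using ae AE_space
  proof eventually_elim
    case (elim u)
    then have "u < ?l \<or> ?l < u" "0 \<le> u" "u \<le> 1" "0 < u" "u < 1" by (auto simp: space_unif)
    then show ?case
      using qtl_less_if_less_lft[OF T x, of u T] le_qtl_if_lft_less[OF T x, of u T] less_imp_le[OF T]
      by (auto simp: indicator_def)
  qed
  then have "(\<integral>u. (if qtl T x u < T then 0 else c) \<partial>unif) = (\<integral>u. c * (1 - indicator {u \<in> {0<..<1}. u \<le> ?l} u) \<partial>unif)"
    by (intro integral_cong_AE) (auto simp: sets_unif sets_restrict_space)
  also have "\<dots> = c * (1 - ?l)"
  proof -
    have s: "{u \<in> {0<..<1}. u \<le> ?l} \<in> sets unif"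
    proof -
      have "{u \<in> space unif. u \<le> ?l} \<in> sets unif" by measurable
      then show ?thesis by (simp add: space_unif)
    qed
    have "measure unif {u \<in> {0<..<1}. u \<le> ?l} = ?l"
      using emeasure_unif_atMost[OF l] l by (simp add: measure_def)
    then show ?thesis using s U.prob_space by (simp add: U.emeasure_eq_measure)
  qed
  finally show ?thesis .
qed

text \<open>Closed lower half-lines form a generator stable under intersection, and the one ending
  at \<infinity> is the whole space.\<close>

lemma measure_eqI_atMost_ereal:
  fixes M N :: "ereal measure"
  assumes "sets M = sets borel" "sets N = sets borel" "finite_measure M"
    and "\<And>a. emeasure M {..a} = emeasure N {..a}"
  shows "M = N"
proof (rule measure_eqI_generator_eq[where E="range atMost" and \<Omega>=UNIV and A="\<lambda>_. {..\<infinity>}"])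
  have "(borel :: ereal measure) = sigma UNIV (range atMost)"
    unfolding borel_Ioi
  proof (intro sigma_eqI sigma_sets_eqI)
    fix A :: "ereal set" assume "A \<in> range greaterThan"
    then obtain a where "A = {a<..}" by auto
    then have "A = UNIV - {..a}" by auto
    then show "A \<in> sigma_sets UNIV (range atMost)" by (auto intro: sigma_sets.Compl)
  next
    fix A :: "ereal set" assume "A \<in> range atMost"
    then obtain a where "A = {..a}" by auto
    then have "A = UNIV - {a<..}" by auto
    then show "A \<in> sigma_sets UNIV (range greaterThan)" by (auto intro: sigma_sets.Compl)
  qed auto
  then have *: "sets (borel :: ereal measure) = sigma_sets UNIV (range atMost)"
    by (metis sets_measure_of subset_Pow_Union Pow_UNIV top_greatest)
  then show "sets M = sigma_sets UNIV (range atMost)" "sets N = sigma_sets UNIV (range atMost)"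
    using assms by auto
  show "emeasure M {..\<infinity>} \<noteq> \<infinity>" using assms(3) by (simp add: finite_measure.emeasure_finite)
qed (use assms in \<open>auto simp: Int_stable_def\<close>)

text \<open>Quantiles of a mixture are not mixtures of quantiles, but their laws are: toss a coin
  with bias \<open>l\<close>, then draw the quantile of \<open>y\<close> or of \<open>x\<close>.
  This is the source of affinity in the control that acts as integrator.\<close>

lemma integral_qtl_mix:
  fixes \<phi> :: "ereal \<Rightarrow> real"
  assumes T: "0 < T" and x: "dpath T x" and y: "dpath T y" and m: "dpath T (\<lambda>t. (1 - l) * x t + l * y t)"
    and l: "0 \<le> l" "l \<le> 1"
    and \<phi>: "\<phi> \<in> borel_measurable (tborel T)" "\<And>t. 0 \<le> t \<Longrightarrow> t \<le> T \<Longrightarrow> \<bar>\<phi> t\<bar> \<le> B"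
  shows "(\<integral>u. \<phi> (qtl T (\<lambda>t. (1 - l) * x t + l * y t) u) \<partial>unif) =
    (1 - l) * (\<integral>u. \<phi> (qtl T x u) \<partial>unif) + l * (\<integral>u. \<phi> (qtl T y u) \<partial>unif)"
proof -
  interpret U: prob_space unif by (rule prob_space_unif)
  let ?m = "\<lambda>t. (1 - l) * x t + l * y t"
  define Q where "Q z = distr unif borel (qtl T z)" for z
  \<comment> \<open>The coin toss as a bind, so that \<open>emeasure_bind\<close> and
    \<open>nn_integral_bind\<close> compute with it.\<close>
  define N where "N = measure_pmf (bernoulli_pmf l) \<bind> (\<lambda>b. if b then Q y else Q x)"
  have pQ: "prob_space (Q z)" if "dpath T z" for z
    unfolding Q_def by (rule U.prob_space_distr[OF measurable_qtl_unif[OF T that]])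
  have sQ[simp]: "sets (Q z) = sets borel" "space (Q z) = UNIV" for z by (auto simp: Q_def)
  have ker: "(\<lambda>b. if b then Q y else Q x) \<in> measure_pmf (bernoulli_pmf l) \<rightarrow>\<^sub>M subprob_algebra borel"
    using pQ[OF x] pQ[OF y] by (auto simp: space_subprob_algebra prob_space_imp_subprob_space)
  have atM: "emeasure (Q z) {..a} = ennreal (if a < 0 then 0 else z (min a T))" if z: "dpath T z" for z a
  proof -
    have "emeasure (Q z) {..a} = emeasure unif (qtl T z -` {..a} \<inter> space unif)"
      unfolding Q_def by (rule emeasure_distr[OF measurable_qtl_unif[OF T z]]) simp
    also have "qtl T z -` {..a} \<inter> space unif = (if a < 0 then {} else {u \<in> {0<..<1}. qtl T z u \<le> min a T})"
    proof (cases "a < 0")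
      case True
      then have "\<not> qtl T z u \<le> a" if "u \<in> {0<..<1}" for u
        using qtl_in_tset[OF T z, of u] that by auto
      then show ?thesis using True by (auto simp: space_unif)
    next
      case False
      then show ?thesis using qtl_in_tset[OF T z] by (auto simp: space_unif)
    qed
    finally show ?thesis using emeasure_qtl_atMost[OF T z, of "min a T"] less_imp_le[OF T] by auto
  qed
  have QN: "Q ?m = N"
  proof (rule measure_eqI_atMost_ereal)
    show "sets N = sets borel" unfolding N_def by (rule sets_bind) auto
    show "finite_measure (Q ?m)" using pQ[OF m] by (simp add: prob_space_def)
    fix a
    have "emeasure N {..a} = (\<integral>\<^sup>+b. emeasure (if b then Q y else Q x) {..a} \<partial>bernoulli_pmf l)"
      unfolding N_def by (rule emeasure_bind[OF _ ker]) auto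
    also have "\<dots> = emeasure (Q y) {..a} * ennreal l + emeasure (Q x) {..a} * ennreal (1 - l)"
      using l by (subst nn_integral_bernoulli_pmf) auto
    also have "\<dots> = emeasure (Q ?m) {..a}"
      unfolding atM[OF m] atM[OF x] atM[OF y]
    proof (cases "a < 0")
      case False
      then have "0 \<le> x (min a T)" "0 \<le> y (min a T)" "\<not> a < 0"
        using dpath_nonneg[OF x, of "min a T"] dpath_nonneg[OF y, of "min a T"] less_imp_le[OF T] by auto
      then show "ennreal (if a < 0 then 0 else y (min a T)) * ennreal l +
          ennreal (if a < 0 then 0 else x (min a T)) * ennreal (1 - l) =
          ennreal (if a < 0 then 0 else (1 - l) * x (min a T) + l * y (min a T))"
        using l by (simp add: ennreal_plus ennreal_mult mult.commute add.commute)
    qed simp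
    finally show "emeasure (Q ?m) {..a} = emeasure N {..a}" by simp
  qed auto
  \<comment> \<open>The computation against the bind uses nonnegative integrals, hence the shift by
    the bound \<open>B\<close>; it cancels because the weights sum to 1.\<close>
  define \<psi> where "\<psi> t = (if t \<in> tset T then \<phi> t + B else 0)" for t
  have B: "0 \<le> B" using \<phi>(2)[of T] T by force
  have "(\<lambda>t. indicator (tset T) t *\<^sub>R (\<phi> t + B)) \<in> borel_measurable borel"
    using \<phi> by (subst borel_measurable_restrict_space_iff[symmetric]) (auto simp: tset_def)
  then have \<psi>m[measurable]: "\<psi> \<in> borel_measurable borel"
    by (rule measurable_cong[THEN iffD1, rotated]) (simp add: \<psi>_def)
  have \<psi>p: "0 \<le> \<psi> t" "\<psi> t \<le> 2 * B" for t using \<phi>(2)[of t] B by (auto simp: \<psi>_def tset_iff)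
  have eq: "(\<integral>u. \<phi> (qtl T z u) \<partial>unif) = (\<integral>t. \<psi> t \<partial>Q z) - B" "(\<integral>\<^sup>+t. \<psi> t \<partial>Q z) = ennreal (\<integral>t. \<psi> t \<partial>Q z)"
    if z: "dpath T z" for z
  proof -
    note [measurable] = measurable_qtl_unif[OF T z]
    have i: "integrable unif (\<lambda>u. \<psi> (qtl T z u))"
      using \<psi>p by (intro U.integrable_const_bound[where B="2 * B"]) auto
    have "(\<integral>t. \<psi> t \<partial>Q z) - B = (\<integral>u. \<psi> (qtl T z u) \<partial>unif) - B"
      unfolding Q_def by (subst integral_distr) auto
    also have "\<dots> = (\<integral>u. \<psi> (qtl T z u) - B \<partial>unif)" using i U.prob_space by simp
    also have "\<dots> = (\<integral>u. \<phi> (qtl T z u) \<partial>unif)"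
      using qtl_in_tset[OF T z]
      by (intro Bochner_Integration.integral_cong) (auto simp: \<psi>_def tset_iff space_unif)
    finally show "(\<integral>u. \<phi> (qtl T z u) \<partial>unif) = (\<integral>t. \<psi> t \<partial>Q z) - B" by simp
    interpret Qz: prob_space "Q z" by (rule pQ[OF z])
    have "integrable (Q z) \<psi>"
      using \<psi>p by (intro Qz.integrable_const_bound[where B="2 * B"]) (auto simp: Q_def)
    then show "(\<integral>\<^sup>+t. \<psi> t \<partial>Q z) = ennreal (\<integral>t. \<psi> t \<partial>Q z)"
      using \<psi>p by (intro nn_integral_eq_integral) auto
  qed
  have nn: "0 \<le> (\<integral>t. \<psi> t \<partial>Q z)" for z using \<psi>p by (intro integral_nonneg_AE) auto
  have "ennreal (\<integral>t. \<psi> t \<partial>Q ?m) = (\<integral>\<^sup>+t. \<psi> t \<partial>N)" using eq(2)[OF m] QN by simp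
  also have "\<dots> = (\<integral>\<^sup>+b. (\<integral>\<^sup>+t. \<psi> t \<partial>(if b then Q y else Q x)) \<partial>bernoulli_pmf l)"
    unfolding N_def by (rule nn_integral_bind[OF _ ker]) auto
  also have "\<dots> = ennreal (l * (\<integral>t. \<psi> t \<partial>Q y) + (1 - l) * (\<integral>t. \<psi> t \<partial>Q x))"
    using l nn eq(2)[OF x] eq(2)[OF y] by (subst nn_integral_bernoulli_pmf) (auto simp: ennreal_mult ennreal_plus mult.commute)
  finally have "(\<integral>t. \<psi> t \<partial>Q ?m) = l * (\<integral>t. \<psi> t \<partial>Q y) + (1 - l) * (\<integral>t. \<psi> t \<partial>Q x)"
    using nn l by (subst (asm) ennreal_inj) auto
  then show ?thesis unfolding eq(1)[OF m] eq(1)[OF x] eq(1)[OF y] by (simp add: algebra_simps)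
qed

section \<open>Almost sure limits along directed families of convex sets\<close>

text \<open>The sum of the absolute values has finite integral, hence is finite almost
  everywhere.\<close>

lemma AE_summable_if_summable_integrals:
  fixes f :: "nat \<Rightarrow> 'x \<Rightarrow> real"
  assumes i: "\<And>n. integrable N (f n)" and le: "\<And>n. (\<integral>x. \<bar>f n x\<bar> \<partial>N) \<le> a n" and a: "summable a"
  shows "AE x in N. summable (\<lambda>n. \<bar>f n x\<bar>)"
proof -
  note [measurable] = borel_measurable_integrable[OF i]
  have a0: "0 \<le> a n" for n using le[of n] by (rule order_trans[rotated]) simp
  have "(\<integral>\<^sup>+x. (\<Sum>n. ennreal \<bar>f n x\<bar>) \<partial>N) = (\<Sum>n. \<integral>\<^sup>+x. ennreal \<bar>f n x\<bar> \<partial>N)"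
    by (rule nn_integral_suminf) measurable
  also have "\<dots> \<le> (\<Sum>n. ennreal (a n))"
  proof (rule suminf_le)
    fix n
    have "(\<integral>\<^sup>+x. ennreal \<bar>f n x\<bar> \<partial>N) = ennreal (\<integral>x. \<bar>f n x\<bar> \<partial>N)"
      by (rule nn_integral_eq_integral) (use i in auto)
    then show "(\<integral>\<^sup>+x. ennreal \<bar>f n x\<bar> \<partial>N) \<le> ennreal (a n)" using le[of n] by (simp add: ennreal_leI)
  qed auto
  also have "\<dots> = ennreal (\<Sum>n. a n)" by (rule suminf_ennreal2[OF a0 a])
  also have "\<dots> < \<infinity>" by simp
  finally have "(\<integral>\<^sup>+x. (\<Sum>n. ennreal \<bar>f n x\<bar>) \<partial>N) \<noteq> \<infinity>" by simp
  then have "AE x in N. (\<Sum>n. ennreal \<bar>f n x\<bar>) \<noteq> \<infinity>"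
    by (intro nn_integral_PInf_AE) auto
  then show ?thesis
    by eventually_elim (auto intro!: summable_suminf_not_top)
qed

text \<open>Let \<open>D\<close> be the supremum over the family of the infimal squared norms.
  Inside a member whose infimum is almost \<open>D\<close>, two elements of squared norm almost
  \<open>D\<close> are close, because their midpoint cannot be much shorter. The limit
  \<open>w\<close> is fixed before the sequence \<open>B\<close> of members and is reached from
  within any of them; this uniformity replaces weak compactness. The map \<open>u\<close> may
  observe only part of an index, and only the observed values converge.\<close>

lemma directed_convex_AE_limit:
  fixes N :: "'x measure" and u :: "'k \<Rightarrow> 'x \<Rightarrow> real" and mid :: "'k \<Rightarrow> 'k \<Rightarrow> 'k" and CC :: "'k set set"
  assumes fin: "finite_measure N"
    and meas: "\<And>C a. C \<in> CC \<Longrightarrow> a \<in> C \<Longrightarrow> u a \<in> borel_measurable N"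
    and bd: "\<And>C a p. C \<in> CC \<Longrightarrow> a \<in> C \<Longrightarrow> p \<in> space N \<Longrightarrow> \<bar>u a p\<bar> \<le> 1"
    and mid: "\<And>C a b. C \<in> CC \<Longrightarrow> a \<in> C \<Longrightarrow> b \<in> C \<Longrightarrow> mid a b \<in> C"
    and umid: "\<And>C a b p. C \<in> CC \<Longrightarrow> a \<in> C \<Longrightarrow> b \<in> C \<Longrightarrow> p \<in> space N \<Longrightarrow> u (mid a b) p = (u a p + u b p) / 2"
    and ne: "\<And>C. C \<in> CC \<Longrightarrow> C \<noteq> {}" "CC \<noteq> {}"
    and dir: "\<And>A B. A \<in> CC \<Longrightarrow> B \<in> CC \<Longrightarrow> \<exists>C\<in>CC. C \<subseteq> A \<inter> B"
  obtains w where "\<And>B. (\<And>n::nat. B n \<in> CC) \<Longrightarrow> \<exists>y. (\<forall>n. y n \<in> B n) \<and> (AE p in N. (\<lambda>n. u (y n) p) \<longlonglongrightarrow> w p)"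
proof -
  interpret finite_measure N by fact
  define q where "q a = (\<integral>p. (u a p)\<^sup>2 \<partial>N)" for a
  define c where "c = measure N (space N)"
  define d where "d C = (INF a\<in>C. q a)" for C
  define D where "D = (SUP C\<in>CC. d C)"
  \<comment> \<open>With \<open>(1/8) ^ n\<close> the bound \<open>8 * \<delta> n\<close> on squared
    distances, multiplied by the weight \<open>2 ^ n\<close> below, still decays like
    \<open>(1/4) ^ n\<close>.\<close>
  define \<delta> :: "nat \<Rightarrow> real" where "\<delta> n = (1/8) ^ n" for n
  have \<delta>: "0 < \<delta> n" "\<delta> (Suc n) \<le> \<delta> n" for n by (auto simp: \<delta>_def)
  have bd2: "(u a p * u b p) \<le> 1" "\<bar>u a p * u b p\<bar> \<le> 1" if "C \<in> CC" "a \<in> C" "b \<in> C" "p \<in> space N" for C a b p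
    using bd[OF that(1,2,4)] bd[OF that(1,3,4)] mult_mono[of "\<bar>u a p\<bar>" 1 "\<bar>u b p\<bar>" 1]
    by (auto simp: abs_mult[symmetric])
  have int: "integrable N (\<lambda>p. u a p * u b p)" if "C \<in> CC" "a \<in> C" "b \<in> C" for C a b
    using bd2[OF that] meas[OF that(1,2)] meas[OF that(1,3)]
    by (intro integrable_const_bound[where B=1]) auto
  have int1: "integrable N (u a)" if "C \<in> CC" "a \<in> C" for C a
    using bd[OF that] meas[OF that] by (intro integrable_const_bound[where B=1]) auto
  have q0: "0 \<le> q a" for a by (simp add: q_def)
  have q1: "q a \<le> c" if "C \<in> CC" "a \<in> C" for C a
  proof -
    have "q a \<le> (\<integral>p. 1 \<partial>N)" unfolding q_def
      using int[OF that that(2)] bd2(1)[OF that that(2)] by (intro integral_mono) (auto simp: power2_eq_square)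
    then show ?thesis by (simp add: c_def)
  qed
  have bb: "bdd_below (q ` C)" for C using q0 by (auto intro!: bdd_belowI[of _ 0])
  have dc: "d C \<le> c" if C: "C \<in> CC" for C
  proof -
    obtain a where a: "a \<in> C" using ne(1)[OF C] by auto
    then have "d C \<le> q a" unfolding d_def by (intro cINF_lower[OF bb])
    with q1[OF C a] show ?thesis by simp
  qed
  have dD: "d C \<le> D" if "C \<in> CC" for C
    unfolding D_def using that dc by (intro cSUP_upper) (auto intro!: bdd_aboveI[of _ c])
  have danti: "d C \<le> d C'" if "C' \<subseteq> C" "C' \<in> CC" for C C'
    unfolding d_def using that ne bb by (intro cINF_superset_mono) auto
  have ex: "\<exists>C\<in>CC. D - \<delta> n < d C" for n
  proof -
    have "D - \<delta> n < D" using \<delta> by simp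
    then show ?thesis unfolding D_def using ne(2) dc
      by (subst (asm) less_cSUP_iff) (auto intro!: bdd_aboveI[of _ c])
  qed
  \<comment> \<open>Shrinking a member only raises its infimum, so directedness allows the almost
    optimal members to be chosen nested.\<close>
  have "\<exists>C. \<forall>n. (C n \<in> CC \<and> D - \<delta> n < d (C n)) \<and> C (Suc n) \<subseteq> C n"
  proof (rule dependent_nat_choice)
    show "\<exists>x. x \<in> CC \<and> D - \<delta> 0 < d x" using ex by auto
    fix x n assume x: "x \<in> CC \<and> D - \<delta> n < d x"
    obtain E where E: "E \<in> CC" "D - \<delta> (Suc n) < d E" using ex by auto
    obtain F where F: "F \<in> CC" "F \<subseteq> x \<inter> E" using dir x E by blast
    then show "\<exists>y. (y \<in> CC \<and> D - \<delta> (Suc n) < d y) \<and> y \<subseteq> x"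
      using danti[of F E] E by (intro exI[of _ F]) auto
  qed
  then obtain Cs where Cs: "\<And>n. Cs n \<in> CC" "\<And>n. D - \<delta> n < d (Cs n)" "\<And>n. Cs (Suc n) \<subseteq> Cs n"
    by auto
  \<comment> \<open>However small a member is, its infimum does not exceed \<open>D\<close>.\<close>
  have pick: "\<exists>a\<in>C. q a < D + \<delta> n" if C: "C \<in> CC" for C n
  proof -
    have "d C < D + \<delta> n" using dD[OF C] \<delta>[of n] by simp
    then show ?thesis unfolding d_def using ne(1)[OF C] by (subst (asm) cINF_less_iff[OF _ bb]) auto
  qed
  have close: "(\<integral>p. \<bar>u a p - u b p\<bar> \<partial>N) \<le> (c + 8) / 2 * (1/2) ^ n"
    if ab: "a \<in> Cs n" "b \<in> Cs n" "q a < D + \<delta> n" "q b < D + \<delta> n" for a b n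
  proof -
    note C = Cs(1)[of n]
    have ia: "integrable N (\<lambda>p. (u a p)\<^sup>2)" and ib: "integrable N (\<lambda>p. (u b p)\<^sup>2)"
      and iab: "integrable N (\<lambda>p. u a p * u b p)"
      using int[OF C ab(1,1)] int[OF C ab(2,2)] int[OF C ab(1,2)] by (auto simp: power2_eq_square)
    have sq: "(u a p - u b p)\<^sup>2 = (u a p)\<^sup>2 + (u b p)\<^sup>2 - 2 * (u a p * u b p)" for p
      by (simp add: power2_eq_square algebra_simps)
    have isq: "integrable N (\<lambda>p. (u a p - u b p)\<^sup>2)" unfolding sq using ia ib iab by auto
    \<comment> \<open>The parallelogram law, solved for the mixed term.\<close>
    have "q (mid a b) = (\<integral>p. ((u a p)\<^sup>2 + (u b p)\<^sup>2 + 2 * (u a p * u b p)) / 4 \<partial>N)"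
      unfolding q_def
      by (rule Bochner_Integration.integral_cong) (auto simp: umid[OF C ab(1,2)] power2_eq_square field_simps)
    also have "\<dots> = (q a + q b + 2 * (\<integral>p. u a p * u b p \<partial>N)) / 4"
      using ia ib iab by (simp add: q_def)
    finally have m: "2 * (\<integral>p. u a p * u b p \<partial>N) = 4 * q (mid a b) - q a - q b" by simp
    have "D - \<delta> n < q (mid a b)"
      using Cs(2)[of n] cINF_lower[OF bb mid[OF C ab(1,2)]] by (simp add: d_def)
    moreover have "(\<integral>p. (u a p - u b p)\<^sup>2 \<partial>N) = q a + q b - 2 * (\<integral>p. u a p * u b p \<partial>N)"
      unfolding sq using ia ib iab by (simp add: q_def)
    ultimately have le: "(\<integral>p. (u a p - u b p)\<^sup>2 \<partial>N) \<le> 8 * \<delta> n" using m ab(3,4) by linarith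
    \<comment> \<open>From squares to absolute values by \<open>2 * t \<le> e + t^2 / e\<close> with
      \<open>e = (1/2) ^ n\<close>.\<close>
    have "(\<integral>p. \<bar>u a p - u b p\<bar> \<partial>N) \<le> (\<integral>p. ((1/2)^n + 2^n * (u a p - u b p)\<^sup>2) / 2 \<partial>N)"
    proof (rule integral_mono)
      show "integrable N (\<lambda>p. \<bar>u a p - u b p\<bar>)" using int1[OF C ab(1)] int1[OF C ab(2)] by auto
      show "integrable N (\<lambda>p. ((1/2)^n + 2^n * (u a p - u b p)\<^sup>2) / 2)" using isq by auto
      fix p
      let ?t = "\<bar>u a p - u b p\<bar>"
      have "0 \<le> (1 - 2^n * ?t)\<^sup>2 * (1/2)^n" by simp
      also have "\<dots> = (1/2)^n + (2^n * (1/2)^n) * 2^n * ?t\<^sup>2 - 2 * (2^n * (1/2)^n) * ?t"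
        by (simp add: power2_eq_square algebra_simps)
      also have "(2^n * (1/2)^n :: real) = 1" by (simp add: power_mult_distrib[symmetric])
      finally show "?t \<le> ((1/2)^n + 2^n * (u a p - u b p)\<^sup>2) / 2" by simp
    qed
    also have "\<dots> = (c * (1/2)^n + 2^n * (\<integral>p. (u a p - u b p)\<^sup>2 \<partial>N)) / 2"
      using isq by (simp add: c_def)
    also have "\<dots> \<le> (c * (1/2)^n + 2^n * (8 * \<delta> n)) / 2" using le by simp
    also have "2^n * (8 * \<delta> n) = 8 * (1/4)^n"
      by (simp add: \<delta>_def power_mult_distrib[symmetric])
    also have "(c * (1/2)^n + 8 * (1/4)^n) / 2 \<le> (c * (1/2)^n + 8 * (1/2)^n) / 2"
      by (simp add: power_mono)
    finally show ?thesis by (simp add: algebra_simps)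
  qed
  have sm: "summable (\<lambda>n. (c + 8) / 2 * (1/2::real) ^ n)" by (intro summable_mult summable_geometric) simp
  have "\<forall>n. \<exists>a\<in>Cs n. q a < D + \<delta> n" using pick Cs by auto
  then obtain z where z: "\<And>n. z n \<in> Cs n" "\<And>n. q (z n) < D + \<delta> n" by metis
  have "AE p in N. summable (\<lambda>n. \<bar>u (z (Suc n)) p - u (z n) p\<bar>)"
  proof (rule AE_summable_if_summable_integrals[OF _ _ sm])
    fix n
    \<comment> \<open>By nestedness and since \<open>\<delta>\<close> decreases,
      \<open>z (Suc n)\<close> also meets the requirements of stage \<open>n\<close>.\<close>
    have z': "z (Suc n) \<in> Cs n" "q (z (Suc n)) < D + \<delta> n" using z[of "Suc n"] Cs(3)[of n] \<delta>(2)[of n] by auto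
    show "integrable N (\<lambda>p. u (z (Suc n)) p - u (z n) p)" 
      using int1[OF Cs(1) z(1)[of "Suc n"]] int1[OF Cs(1) z(1)[of n]] by (rule Bochner_Integration.integrable_diff)
    show "(\<integral>p. \<bar>u (z (Suc n)) p - u (z n) p\<bar> \<partial>N) \<le> (c + 8) / 2 * (1/2) ^ n"
      using close[OF z'(1) z(1) z'(2) z(2)] .
  qed
  then have conv: "AE p in N. (\<lambda>n. u (z n) p) \<longlonglongrightarrow> lim (\<lambda>n. u (z n) p)"
  proof eventually_elim
    case (elim p)
    then have "summable (\<lambda>n. u (z (Suc n)) p - u (z n) p)" by (rule summable_rabs_cancel)
    then have "convergent (\<lambda>n. \<Sum>i<n. u (z (Suc i)) p - u (z i) p)" by (simp add: summable_iff_convergent)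
    then have "convergent (\<lambda>n. u (z n) p - u (z 0) p)" 
      using sum_lessThan_telescope[of "\<lambda>n. u (z n) p"] by simp
    then have "convergent (\<lambda>n. (u (z n) p - u (z 0) p) + u (z 0) p)" by (intro convergent_add convergent_const)
    then show ?case by (simp add: convergent_LIMSEQ_iff)
  qed
  show thesis
  proof (rule that)
    fix B :: "nat \<Rightarrow> 'k set" assume B: "\<And>n. B n \<in> CC"
    \<comment> \<open>A member inside both \<open>B n\<close> and \<open>Cs n\<close> supplies an
      element of \<open>B n\<close> that is comparable with \<open>z n\<close> at stage
      \<open>n\<close>.\<close>
    have "\<exists>a\<in>B n \<inter> Cs n. q a < D + \<delta> n" for n
    proof -
      obtain F where "F \<in> CC" "F \<subseteq> B n \<inter> Cs n" using dir[OF B Cs(1)] by blast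
      with pick[of F n] show ?thesis by blast
    qed
    then obtain y where y: "\<And>n. y n \<in> B n" "\<And>n. y n \<in> Cs n" "\<And>n. q (y n) < D + \<delta> n" by (metis IntE)
    have "AE p in N. summable (\<lambda>n. \<bar>u (y n) p - u (z n) p\<bar>)"
    proof (rule AE_summable_if_summable_integrals[OF _ _ sm])
      fix n
      show "integrable N (\<lambda>p. u (y n) p - u (z n) p)" 
        using int1[OF Cs(1) y(2)[of n]] int1[OF Cs(1) z(1)[of n]] by (rule Bochner_Integration.integrable_diff)
      show "(\<integral>p. \<bar>u (y n) p - u (z n) p\<bar> \<partial>N) \<le> (c + 8) / 2 * (1/2) ^ n"
        using close[OF y(2) z(1) y(3) z(2)] .
    qed
    with conv have "AE p in N. (\<lambda>n. u (y n) p) \<longlonglongrightarrow> lim (\<lambda>n. u (z n) p)"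
    proof eventually_elim
      case (elim p)
      from summable_rabs_cancel[OF elim(2)] have "(\<lambda>n. u (y n) p - u (z n) p) \<longlonglongrightarrow> 0"
        by (rule summable_LIMSEQ_zero)
      from tendsto_add[OF this elim(1)] show ?case by simp
    qed
    then show "\<exists>y. (\<forall>n. y n \<in> B n) \<and> (AE p in N. (\<lambda>n. u (y n) p) \<longlonglongrightarrow> lim (\<lambda>n. u (z n) p))"
      using y by auto
  qed
qed

text \<open>Minimax for finitely many affine functions, in contrapositive form. Two functions are
  merged into one by separating their joint range in the plane from an open quadrant. The set
  \<open>K'\<close> varies in the induction: the hypothesis is applied to the part of
  \<open>K'\<close> on which the newly added function exceeds \<open>c\<close>, where the remaining
  functions must do all the work.\<close>

lemma finite_minimax:
  fixes N :: "'i \<Rightarrow> 'k \<Rightarrow> real" and mixk :: "real \<Rightarrow> 'k \<Rightarrow> 'k \<Rightarrow> 'k" and mixi :: "real \<Rightarrow> 'i \<Rightarrow> 'i \<Rightarrow> 'i"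
  assumes N1: "\<And>l i j z. 0 \<le> l \<Longrightarrow> l \<le> 1 \<Longrightarrow> i \<in> AA \<Longrightarrow> j \<in> AA \<Longrightarrow> z \<in> K \<Longrightarrow>
      mixi l i j \<in> AA \<and> N (mixi l i j) z = (1 - l) * N i z + l * N j z"
    and N2: "\<And>l i z z'. 0 \<le> l \<Longrightarrow> l \<le> 1 \<Longrightarrow> i \<in> AA \<Longrightarrow> z \<in> K \<Longrightarrow> z' \<in> K \<Longrightarrow>
      N i (mixk l z z') = (1 - l) * N i z + l * N i z'"
    and A: "finite A" "A \<noteq> {}" "A \<subseteq> AA"
    and K': "K' \<subseteq> K" "\<And>l z z'. 0 \<le> l \<Longrightarrow> l \<le> 1 \<Longrightarrow> z \<in> K' \<Longrightarrow> z' \<in> K' \<Longrightarrow> mixk l z z' \<in> K'"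
    and no: "\<And>z. z \<in> K' \<Longrightarrow> \<exists>i\<in>A. N i z \<le> c"
  shows "\<exists>b\<in>AA. \<forall>z\<in>K'. N b z \<le> c"
  using A K' no
proof (induction A arbitrary: K' rule: finite_ne_induct)
  case (singleton i) then show ?case by (intro bexI[of _ i]) auto
next
  case (insert a A)
  define K2 where "K2 = {z \<in> K'. c < N a z}"
  have "\<exists>b\<in>AA. \<forall>z\<in>K2. N b z \<le> c"
  proof (rule insert.IH)
    show "A \<subseteq> AA" "K2 \<subseteq> K" using insert.prems by (auto simp: K2_def)
    fix l :: real and z z' assume l: "0 \<le> l" "l \<le> 1" and z: "z \<in> K2" "z' \<in> K2"
    have "c = (1 - l) * c + l * c" by (simp add: algebra_simps)
    also have "\<dots> < (1 - l) * N a z + l * N a z'"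
    \<comment> \<open>Strictness survives because one of the weights is positive; for
      \<open>l = 0\<close> it is the first one.\<close>
    proof (cases "l = 0")
      case False
      then have "l * c < l * N a z'" "(1 - l) * c \<le> (1 - l) * N a z" using l z
        by (auto simp: K2_def intro!: mult_left_mono)
      then show ?thesis by simp
    qed (use z in \<open>auto simp: K2_def\<close>)
    also have "\<dots> = N a (mixk l z z')"
    proof -
      have "z \<in> K" "z' \<in> K" "a \<in> AA" using z insert.prems(1,2) by (auto simp: K2_def)
      then show ?thesis using N2[of l a z z'] l by simp
    qed
    finally show "mixk l z z' \<in> K2" using insert.prems(3)[OF l] z by (auto simp: K2_def)
  next
    fix z assume "z \<in> K2" then show "\<exists>i\<in>A. N i z \<le> c" using insert.prems(4)[of z] by (force simp: K2_def)
  qed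
  then obtain b where b: "b \<in> AA" "\<And>z. z \<in> K2 \<Longrightarrow> N b z \<le> c" by auto
  have a: "a \<in> AA" using insert.prems by auto
  show ?case
  proof (cases "K' = {}")
    case True then show ?thesis using b by auto
  next
    case False
    define S where "S = (\<lambda>z. (N a z, N b z)) ` K'"
    define Q where "Q = {c<..} \<times> {c<..}"
    have "convex S" unfolding convex_alt
    proof (intro ballI allI impI)
      fix x y and l :: real assume x: "x \<in> S" "y \<in> S" and l: "0 \<le> l \<and> l \<le> 1"
      then obtain z z' where z: "z \<in> K'" "x = (N a z, N b z)" "z' \<in> K'" "y = (N a z', N b z')"
        by (auto simp: S_def)
      have "(1 - l) *\<^sub>R x + l *\<^sub>R y = (N a (mixk l z z'), N b (mixk l z z'))"
      proof -
        have "z \<in> K" "z' \<in> K" using z insert.prems(2) by auto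
        then show ?thesis using N2[of l a z z'] N2[of l b z z'] l z a b by simp
      qed
      then show "(1 - l) *\<^sub>R x + l *\<^sub>R y \<in> S" using insert.prems(3)[of l z z'] l z by (auto simp: S_def)
    qed
    moreover have "convex Q" unfolding Q_def by (intro convex_Times convex_real_interval)
    moreover have "S \<noteq> {}" using False by (simp add: S_def)
    moreover have "Q \<noteq> {}" by (auto simp: Q_def)
    \<comment> \<open>If \<open>N a z\<close> exceeds \<open>c\<close>, then \<open>z\<close> lies
      in \<open>K2\<close>, where \<open>N b z\<close> does not.\<close>
    moreover have "S \<inter> Q = {}" using b(2) by (force simp: S_def Q_def K2_def)
    ultimately obtain w \<beta> where w: "w \<noteq> 0" "\<And>x. x \<in> S \<Longrightarrow> inner w x \<le> \<beta>" "\<And>x. x \<in> Q \<Longrightarrow> \<beta> \<le> inner w x"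
      using separating_hyperplane_sets[of S Q] by metis
    obtain p r where pr: "w = (p, r)" by (cases w)
    have Q: "\<beta> \<le> p * x + r * y" if "c < x" "c < y" for x y using w(3)[of "(x, y)"] that by (simp add: Q_def pr)
    have nonneg: "0 \<le> s" if s: "\<And>x y. c < x \<Longrightarrow> c < y \<Longrightarrow> \<beta> \<le> s * x + s' * y" for s s' :: real
    proof (rule ccontr)
      assume "\<not> 0 \<le> s"
      \<comment> \<open>For negative \<open>s\<close> this point pushes the linear form below
        \<open>\<beta>\<close> by 1: the second entry of the maximum makes \<open>s * x\<close> at
        most \<open>\<beta> - s' * (c + 1) - 1\<close>.\<close>
      define x where "x = max (c + 1) ((\<beta> - s' * (c + 1) - 1) / s)"
      have "\<beta> \<le> s * x + s' * (c + 1)" by (rule s) (auto simp: x_def)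
      moreover have "s * x \<le> \<beta> - s' * (c + 1) - 1"
        using \<open>\<not> 0 \<le> s\<close> by (simp add: x_def mult.commute[of s] neg_divide_le_eq[symmetric] )
      ultimately show False by simp
    qed
    have p: "0 \<le> p" using nonneg[of p r] Q by auto
    have r: "0 \<le> r" using nonneg[of r p] Q by (simp add: add.commute)
    have pos: "0 < p + r" using p r w(1) pr by (auto simp: zero_prod_def add_nonneg_eq_0_iff less_le)
    \<comment> \<open>Approach the corner \<open>(c, c)\<close> of the quadrant along the
      diagonal.\<close>
    have \<beta>: "\<beta> \<le> (p + r) * c"
    proof (rule field_le_epsilon)
      fix e :: real assume e: "0 < e"
      have "\<beta> \<le> p * (c + e / (p + r)) + r * (c + e / (p + r))"
        using Q e pos by simp
      also have "\<dots> = (p + r) * c + (p + r) * (e / (p + r))" by (simp add: algebra_simps add_divide_distrib)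
      finally show "\<beta> \<le> (p + r) * c + e" using pos by simp
    qed
    \<comment> \<open>Normalising the nonnegative normal \<open>(p, r)\<close> gives the mixing
      weight.\<close>
    define l where "l = r / (p + r)"
    have l: "0 \<le> l" "l \<le> 1" using p r pos by (auto simp: l_def)
    have "N (mixi l a b) z \<le> c" if z: "z \<in> K'" for z
    proof -
      have "p * N a z + r * N b z \<le> (p + r) * c"
        using w(2)[of "(N a z, N b z)"] z \<beta> by (auto simp: S_def pr)
      then have "(p * N a z + r * N b z) / (p + r) \<le> c" using pos by (simp add: divide_le_eq mult.commute)
      moreover have "1 - l = p / (p + r)" using pos by (simp add: l_def field_simps)
      then have "(1 - l) * N a z + l * N b z = (p * N a z + r * N b z) / (p + r)"
        by (simp add: l_def add_divide_distrib)
      ultimately show ?thesis using N1[OF l a b(1), of z] z insert.prems(2) by auto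
    qed
    moreover have "mixi l a b \<in> AA" using N1[OF l a b(1)] False insert.prems(2) by blast
    ultimately show ?thesis by auto
  qed
qed

section \<open>Measurability of monotone processes\<close>

text \<open>Left limits are thereby described by countably many quantile times, at rational levels.
  These are measurable, and stopping times for an adapted path, so the formula yields both
  measurability at random times and predictability.\<close>

lemma less_lft_iff_qtl:
  assumes T: "0 < T" and x: "dpath T x" and t: "0 \<le> t" "t \<le> T" and u: "0 \<le> u"
  shows "u < lft x t \<longleftrightarrow> (\<exists>q. u < real_of_rat q \<and> of_rat q \<le> (1::real) \<and> qtl T x (of_rat q) < t)"
proof
  assume "u < lft x t"
  then obtain s where s: "0 \<le> s" "s < t" "u < x s" using less_lft_iff[OF x t u] by auto
  obtain q where q: "u < real_of_rat q" "real_of_rat q < x s" using of_rat_dense[OF s(3)] by auto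
  have "x s \<le> 1" using dpath_le_1[OF x] s t by auto
  then have q1: "real_of_rat q \<le> 1" using q by linarith
  then have "qtl T x (of_rat q) \<le> s" using qtl_le_iff[OF T x q1, of s] q s t by auto
  then show "\<exists>q. u < real_of_rat q \<and> of_rat q \<le> (1::real) \<and> qtl T x (of_rat q) < t"
    using q q1 s by (intro exI[of _ q]) auto
next
  assume "\<exists>q. u < real_of_rat q \<and> of_rat q \<le> (1::real) \<and> qtl T x (of_rat q) < t"
  then obtain q where q: "u < real_of_rat q" "of_rat q \<le> (1::real)" "qtl T x (of_rat q) < t" by auto
  have "real_of_rat q \<le> x (qtl T x (of_rat q))" by (rule le_at_qtl[OF T x q(2)])
  also have "\<dots> \<le> lft x t" using le_lft[OF x] qtl_in_tset[OF T x q(2)] q t by auto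
  finally show "u < lft x t" using q by simp
qed

lemma measurable_lft:
  assumes T: "0 < T" and r: "\<And>t. 0 \<le> t \<Longrightarrow> t \<le> T \<Longrightarrow> r t \<in> borel_measurable N"
    and d: "\<And>p. p \<in> space N \<Longrightarrow> dpath T (\<lambda>t. r t p)"
    and e[measurable]: "e \<in> borel_measurable N" and et: "\<And>p. p \<in> space N \<Longrightarrow> 0 \<le> e p \<and> e p \<le> T"
  shows "(\<lambda>p. lft (\<lambda>t. r t p) (e p)) \<in> borel_measurable N"
proof (rule borel_measurableI_greater)
  fix u :: real
  show "{p \<in> space N. u < lft (\<lambda>t. r t p) (e p)} \<in> sets N"
  proof (cases "0 \<le> u")
    case False
    then have "{p \<in> space N. u < lft (\<lambda>t. r t p) (e p)} = space N"
      using lft_nonneg[OF d] et by (force simp: not_le)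
    then show ?thesis by simp
  next
    case True
    have m: "(\<lambda>p. qtl T (\<lambda>t. r t p) (of_rat q)) \<in> borel_measurable N" if "of_rat q \<le> (1::real)" for q
      using measurable_qtl[OF T r _ _ d, of "\<lambda>_. of_rat q"] that by simp
    have "{p \<in> space N. u < lft (\<lambda>t. r t p) (e p)} =
      (\<Union>q\<in>{q. u < real_of_rat q \<and> of_rat q \<le> (1::real)}. {p \<in> space N. qtl T (\<lambda>t. r t p) (of_rat q) < e p})"
      using less_lft_iff_qtl[OF T d _ _ True] et by auto
    also have "\<dots> \<in> sets N"
      using m by (intro sets.countable_UN') auto
    finally show ?thesis .
  qed
qed

text \<open>The Galois connection turns the event that the value at a random time is at least
  \<open>u\<close> into a comparison of two random times.\<close>

lemma measurable_dpath_eval: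
  assumes T: "0 < T" and r: "\<And>t. 0 \<le> t \<Longrightarrow> t \<le> T \<Longrightarrow> r t \<in> borel_measurable N"
    and d: "\<And>p. p \<in> space N \<Longrightarrow> dpath T (\<lambda>t. r t p)"
    and e[measurable]: "e \<in> borel_measurable N" and et: "\<And>p. p \<in> space N \<Longrightarrow> 0 \<le> e p \<and> e p \<le> T"
  shows "(\<lambda>p. r (e p) p) \<in> borel_measurable N"
proof (rule borel_measurableI_ge)
  fix u :: real
  consider "u \<le> 1" | "1 < u" by linarith
  then show "{p \<in> space N. u \<le> r (e p) p} \<in> sets N"
  proof cases
    case 1
    have "(\<lambda>p. qtl T (\<lambda>t. r t p) u) \<in> borel_measurable N"
      using measurable_qtl[OF T r _ _ d, of "\<lambda>_. u"] 1 by simp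
    moreover have "{p \<in> space N. u \<le> r (e p) p} = {p \<in> space N. qtl T (\<lambda>t. r t p) u \<le> e p}"
      using qtl_le_iff[OF T d 1] et by auto
    ultimately show ?thesis by simp
  next
    case 2
    then have "{p \<in> space N. u \<le> r (e p) p} = {}" using dpath_le_1[OF d] et by (force simp: not_le)
    then show ?thesis by (metis sets.empty_sets)
  qed
qed

lemma sets_lam: "sets (lam T \<Otimes>\<^sub>M M) = sets (tborel T \<Otimes>\<^sub>M M)"
  by (rule sets_pair_measure_cong) (auto simp: lam_def sets_restrict_space)

lemma prog_meas_iff: "prog_meas M T X \<longleftrightarrow> (\<lambda>p. X (fst p) (snd p)) \<in> borel_measurable (tborel T \<Otimes>\<^sub>M M)"
  unfolding prog_meas_def by (rule arg_cong2[where f="(\<in>)", OF refl]) (rule measurable_cong_sets[OF sets_lam refl])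

lemma prog_meas_eval:
  assumes X: "prog_meas M T X" and e: "e \<in> borel_measurable N" "\<And>p. p \<in> space N \<Longrightarrow> 0 \<le> e p \<and> e p \<le> T"
    and k: "k \<in> N \<rightarrow>\<^sub>M M"
  shows "(\<lambda>p. X (e p) (k p)) \<in> borel_measurable N"
proof -
  have "e \<in> N \<rightarrow>\<^sub>M tborel T" using e by (intro measurable_restrict_space2) (auto simp: tset_iff)
  then have "(\<lambda>p. (e p, k p)) \<in> N \<rightarrow>\<^sub>M tborel T \<Otimes>\<^sub>M M" using k by measurable
  from measurable_compose[OF this X[unfolded prog_meas_iff]] show ?thesis by simp
qed

lemma AE_fst_pair:
  assumes "prob_space M" "prob_space N" "AE x in M. P x"
  shows "AE p in M \<Otimes>\<^sub>M N. P (fst p)"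
proof -
  interpret N: prob_space N by fact
  obtain A where A: "A \<in> null_sets M" "{x \<in> space M. \<not> P x} \<subseteq> A"
    using assms(3) by (auto elim!: AE_E3 simp: null_sets_def eventually_ae_filter)
  have "A \<times> space N \<in> null_sets (M \<Otimes>\<^sub>M N)"
    using A N.emeasure_pair_measure_Times[of A M "space N"] by (auto simp: null_sets_def)
  then show ?thesis by (rule AE_I') (use A in \<open>auto simp: space_pair_measure\<close>)
qed

text \<open>Serves for the integrand of \<open>Ncirc\<close>, whose Stieltjes measures vary with the
  outcome: it agrees almost everywhere with a measurable function, and completeness makes it
  measurable.\<close>

lemma measurable_AE_eq_complete:
  fixes X Y :: "'a \<Rightarrow> real"
  assumes M: "complete_measure M" and X: "X \<in> borel_measurable M" and eq: "AE x in M. X x = Y x"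
  shows "Y \<in> borel_measurable M"
proof (rule measurableI)
  fix A :: "real set" assume A: "A \<in> sets borel"
  obtain Z where Z: "Z \<in> null_sets M" "{x \<in> space M. X x \<noteq> Y x} \<subseteq> Z"
    using eq by (auto simp: eventually_ae_filter)
  have "Y -` A \<inter> space M = ((X -` A \<inter> space M) - Z) \<union> (Y -` A \<inter> space M \<inter> Z)"
    using Z by auto
  moreover have "Y -` A \<inter> space M \<inter> Z \<in> sets M"
    by (rule complete_measure.complete[OF M]) (use Z in auto)
  moreover have "X -` A \<inter> space M \<in> sets M" using measurable_sets[OF X A] .
  ultimately show "Y -` A \<inter> space M \<in> sets M" using Z
    by (metis null_setsD2 sets.Diff sets.Un)
qed simp

lemma sets_Collect_tendsto:
  fixes X :: "nat \<Rightarrow> 'x \<Rightarrow> real"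
  assumes [measurable]: "\<And>n. X n \<in> borel_measurable N" "Y \<in> borel_measurable N"
  shows "{p \<in> space N. (\<lambda>n. X n p) \<longlonglongrightarrow> Y p} \<in> sets N"
proof -
  have "((\<lambda>n. X n p) \<longlonglongrightarrow> Y p) \<longleftrightarrow> (\<forall>k. \<exists>m. \<forall>n\<ge>m. \<bar>X n p - Y p\<bar> < 1 / real (Suc k))" for p
  proof
    assume "(\<lambda>n. X n p) \<longlonglongrightarrow> Y p"
    then show "\<forall>k. \<exists>m. \<forall>n\<ge>m. \<bar>X n p - Y p\<bar> < 1 / real (Suc k)"
      by (auto simp: LIMSEQ_def dist_real_def)
  next
    assume a: "\<forall>k. \<exists>m. \<forall>n\<ge>m. \<bar>X n p - Y p\<bar> < 1 / real (Suc k)"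
    show "(\<lambda>n. X n p) \<longlonglongrightarrow> Y p" unfolding LIMSEQ_def dist_real_def
    proof (intro allI impI)
      fix r :: real assume "0 < r"
      then obtain k where "1 / real (Suc k) < r" using nat_approx_posE by auto
      with a show "\<exists>m. \<forall>n\<ge>m. \<bar>X n p - Y p\<bar> < r" by (meson less_trans)
    qed
  qed
  then show ?thesis by simp
qed

text \<open>The set of convergence is measurable, so fibrewise statements combine into one on the
  product.\<close>

lemma AE_pair_tendsto:
  fixes X :: "nat \<Rightarrow> 'x \<times> 'y \<Rightarrow> real"
  assumes "prob_space M" "prob_space N" "\<And>n. X n \<in> borel_measurable (M \<Otimes>\<^sub>M N)" "Y \<in> borel_measurable (M \<Otimes>\<^sub>M N)"
    and ae: "AE x in M. AE y in N. (\<lambda>n. X n (x, y)) \<longlonglongrightarrow> Y (x, y)"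
  shows "AE p in M \<Otimes>\<^sub>M N. (\<lambda>n. X n p) \<longlonglongrightarrow> Y p"
proof -
  interpret M: prob_space M by fact
  interpret N: prob_space N by fact
  interpret P: pair_sigma_finite M N ..
  show ?thesis by (rule P.AE_pair_measure[OF sets_Collect_tendsto[OF assms(3,4)] ae])
qed

section \<open>The game\<close>

lemma Acirc_dpath: "\<rho> \<in> Acirc M T G \<Longrightarrow> \<omega> \<in> space M \<Longrightarrow> dpath T (\<lambda>t. \<rho> t \<omega>)"
  by (auto simp: Acirc_def dpath_def)

lemma filtration_subalgebra: "is_filtration M T G \<Longrightarrow> 0 \<le> t \<Longrightarrow> t \<le> T \<Longrightarrow> subalgebra M (G t)"
  by (auto simp: is_filtration_def subalgebra_def tset_iff)

lemma adapted_measurable: "is_filtration M T G \<Longrightarrow> adapted T G X \<Longrightarrow> 0 \<le> t \<Longrightarrow> t \<le> T \<Longrightarrow> X t \<in> borel_measurable M"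
  using measurable_from_subalg[OF filtration_subalgebra[of M T G t], of "X t"] by (auto simp: adapted_def tset_iff)

lemma Acirc_measurable: "is_filtration M T G \<Longrightarrow> \<rho> \<in> Acirc M T G \<Longrightarrow> 0 \<le> t \<Longrightarrow> t \<le> T \<Longrightarrow> \<rho> t \<in> borel_measurable M"
  using adapted_measurable by (auto simp: Acirc_def)

lemma Acirc_prog_meas:
  assumes "0 < T" "is_filtration M T G" "\<rho> \<in> Acirc M T G"
  shows "prog_meas M T \<rho>"
  unfolding prog_meas_iff
proof (rule measurable_dpath_eval[where r="\<lambda>t p. \<rho> t (snd p)" and e=fst, OF assms(1)])
  show "(\<lambda>p. \<rho> t (snd p)) \<in> borel_measurable (tborel T \<Otimes>\<^sub>M M)" if "0 \<le> t" "t \<le> T" for t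
    using Acirc_measurable[OF assms(2,3) that] by measurable
  show "fst \<in> borel_measurable (tborel T \<Otimes>\<^sub>M M)"
    using measurable_compose[OF measurable_fst measurable_restrict_space1[OF measurable_ident]] by (simp add: id_def)
qed (auto simp: space_pair_measure space_restrict_space tset_iff intro!: Acirc_dpath[OF assms(3)])

text \<open>The supremum over all times may fail to be measurable, but by right continuity it is
  dominated by the one over a countable set, which provides a measurable integrable bound.\<close>

lemma Lb_dominated:
  assumes X: "X \<in> Lb M T" and T: "0 < T" and m: "\<And>t. 0 \<le> t \<Longrightarrow> t \<le> T \<Longrightarrow> X t \<in> borel_measurable M"
  obtains B where "integrable M B" "AE \<omega> in M. \<forall>t\<in>tset T. \<bar>X t \<omega>\<bar> \<le> B \<omega>"
proof -
  \<comment> \<open>\<open>T\<close> is added by hand: right continuity gives no control at the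
    right end.\<close>
  define Q where "Q = insert T {t \<in> tset T. \<exists>q. t = ereal (of_rat q)}"
  have cQ: "countable Q"
  proof -
    have "countable (insert T (range (\<lambda>q. ereal (of_rat q))))" by simp
    then show ?thesis by (rule countable_subset[rotated]) (auto simp: Q_def)
  qed
  have Qt: "Q \<subseteq> tset T" using T by (auto simp: Q_def tset_iff)
  define S where "S \<omega> = (SUP t\<in>Q. ennreal \<bar>X t \<omega>\<bar>)" for \<omega>
  have Sm[measurable]: "S \<in> borel_measurable M"
    unfolding S_def using m Qt by (intro borel_measurable_SUP[OF cQ]) (auto simp: tset_iff)
  have le: "ennreal \<bar>X t \<omega>\<bar> \<le> S \<omega>" if \<omega>: "\<omega> \<in> space M" and t: "t \<in> tset T" for t \<omega>
  proof (cases "t = T")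
    case True then show ?thesis by (auto simp: S_def Q_def intro!: SUP_upper)
  next
    case False
    then have tT: "0 \<le> t" "t < T" using t by (auto simp: tset_iff)
    have "((\<lambda>s. X s \<omega>) \<longlongrightarrow> X t \<omega>) (at_right t)"
      using X \<omega> tT by (intro cadlag_path_right[of T]) (auto simp: Lb_def)
    then have lim: "((\<lambda>s. ennreal \<bar>X s \<omega>\<bar>) \<longlongrightarrow> ennreal \<bar>X t \<omega>\<bar>) (at_right t)"
      by (intro tendsto_ennrealI tendsto_rabs)
    show ?thesis
    proof (rule ccontr)
      assume "\<not> ?thesis"
      then have "\<forall>\<^sub>F s in at_right t. S \<omega> < ennreal \<bar>X s \<omega>\<bar>" using order_tendstoD(1)[OF lim] by auto
      then obtain b where b: "t < b" "\<And>s. t < s \<Longrightarrow> s < b \<Longrightarrow> S \<omega> < ennreal \<bar>X s \<omega>\<bar>"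
        unfolding eventually_at_right[OF tT(2)] by auto
      obtain q where q: "t < ereal (real_of_rat q)" "ereal (real_of_rat q) < min b T"
        using ereal_dense3[of t "min b T"] b tT by auto
      then have "0 \<le> ereal (real_of_rat q)" "ereal (real_of_rat q) \<le> T" using tT by (auto simp del: ereal_less_eq)
      then have "ereal (of_rat q) \<in> Q" unfolding Q_def tset_iff by blast
      then have "ennreal \<bar>X (ereal (of_rat q)) \<omega>\<bar> \<le> S \<omega>" unfolding S_def by (rule SUP_upper)
      with b(2)[of "ereal (of_rat q)"] q show False by auto
    qed
  qed
  have "(\<integral>\<^sup>+\<omega>. S \<omega> \<partial>M) \<le> (\<integral>\<^sup>+\<omega>. (SUP t\<in>tset T. ennreal \<bar>X t \<omega>\<bar>) \<partial>M)"
    by (intro nn_integral_mono) (auto simp: S_def intro!: SUP_subset_mono Qt)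
  also have "\<dots> < \<infinity>" using X by (simp add: Lb_def)
  finally have fin: "(\<integral>\<^sup>+\<omega>. S \<omega> \<partial>M) < \<infinity>" .
  then have ae: "AE \<omega> in M. S \<omega> \<noteq> \<infinity>" by (intro nn_integral_PInf_AE) auto
  show thesis
  proof (rule that[of "\<lambda>\<omega>. enn2real (S \<omega>)"])
    have "(\<integral>\<^sup>+\<omega>. ennreal (enn2real (S \<omega>)) \<partial>M) = (\<integral>\<^sup>+\<omega>. S \<omega> \<partial>M)"
      using ae by (intro nn_integral_cong_AE) (auto simp: less_top)
    then show "integrable M (\<lambda>\<omega>. enn2real (S \<omega>))" using fin by (intro integrableI_nonneg) auto
    show "AE \<omega> in M. \<forall>t\<in>tset T. \<bar>X t \<omega>\<bar> \<le> enn2real (S \<omega>)"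
      using ae AE_space
    proof eventually_elim
      case (elim \<omega>)
      show ?case
      proof
        fix t assume "t \<in> tset T"
        from le[OF elim(2) this] have "ennreal \<bar>X t \<omega>\<bar> \<le> ennreal (enn2real (S \<omega>))"
          using elim(1) by (simp add: less_top)
        then show "\<bar>X t \<omega>\<bar> \<le> enn2real (S \<omega>)" by (subst (asm) ennreal_le_iff) auto
      qed
    qed
  qed
qed

section \<open>Convex combinations of controls\<close>

definition mixp :: "real \<Rightarrow> (ereal \<Rightarrow> 'a \<Rightarrow> real) \<Rightarrow> (ereal \<Rightarrow> 'a \<Rightarrow> real) \<Rightarrow> ereal \<Rightarrow> 'a \<Rightarrow> real" where
  "mixp l a b = (\<lambda>t \<omega>. (1 - l) * a t \<omega> + l * b t \<omega>)"

lemma cadlag_path_lincomb: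
  assumes "cadlag_path T x" "cadlag_path T y"
  shows "cadlag_path T (\<lambda>t. a * x t + b * y t)"
proof -
  have "\<exists>l. ((\<lambda>t. a * x t + b * y t) \<longlongrightarrow> l) (at_left t)" if "0 < t" "t \<le> T" for t
    using cadlag_path_left[OF assms(1) that] cadlag_path_left[OF assms(2) that]
    by (intro exI) (rule tendsto_intros | assumption)+
  then show ?thesis
    using assms unfolding cadlag_path_def by (simp add: tset_iff tendsto_add tendsto_mult_left)
qed

lemma dpath_mix:
  assumes T: "0 < T" and x: "dpath T x" and y: "dpath T y" and l: "0 \<le> l" "l \<le> 1"
  shows "dpath T (\<lambda>t. (1 - l) * x t + l * y t)"
  unfolding dpath_def
proof (intro conjI)
  show "cadlag_path T (\<lambda>t. (1 - l) * x t + l * y t)"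
    using x y by (intro cadlag_path_lincomb) (auto simp: dpath_def)
  show "mono_on (tset T) (\<lambda>t. (1 - l) * x t + l * y t)"
    using l dpath_mono[OF x] dpath_mono[OF y]
    by (intro mono_onI add_mono mult_left_mono) (auto simp: tset_iff)
qed (use x y l in \<open>auto simp: dpath_def\<close>)

lemma lft_lincomb:
  assumes "dpath T x" "dpath T y" "0 \<le> t" "t \<le> T"
  shows "lft (\<lambda>t. a * x t + b * y t) t = a * lft x t + b * lft y t"
proof (cases "t = 0")
  case False
  then have t: "0 < t" using assms by auto
  have "((\<lambda>t. a * x t + b * y t) \<longlongrightarrow> a * lft x t + b * lft y t) (at_left t)"
    using dpath_left_tendsto[OF assms(1) t assms(4)] dpath_left_tendsto[OF assms(2) t assms(4)]
    by (intro tendsto_intros)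
  from tendsto_Lim[OF at_left_ereal_neq_bot[OF t] this] show ?thesis using False by (simp add: lft_def)
qed (simp add: lft_def)

lemma Acirc_mix:
  assumes T: "0 < T" and "a \<in> Acirc M T G" "b \<in> Acirc M T G" "0 \<le> l" "l \<le> 1"
  shows "mixp l a b \<in> Acirc M T G"
proof -
  have "adapted T G (mixp l a b)" 
    using assms(2,3) unfolding Acirc_def adapted_def mixp_def
    by (auto intro!: borel_measurable_add borel_measurable_times)
  moreover have "dpath T (\<lambda>t. mixp l a b t \<omega>)" if "\<omega> \<in> space M" for \<omega>
    unfolding mixp_def using dpath_mix[OF T Acirc_dpath[OF assms(2) that] Acirc_dpath[OF assms(3) that] assms(4,5)] .
  ultimately show ?thesis by (auto simp: Acirc_def dpath_def)
qed

section \<open>The payoff on the product of the sample space and the levels\<close>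

locale dynkin_game = prob_space M for M :: "'a measure" +
  fixes T :: ereal and F F1 F2 :: "ereal \<Rightarrow> 'a measure" and f g h :: "ereal \<Rightarrow> 'a \<Rightarrow> real"
  assumes complete: "complete_measure M" and T: "0 < T"
    and filF: "is_filtration M T F" and filF1: "is_filtration M T F1" and filF2: "is_filtration M T F2"
    and sub1: "sub_filtration T F1 F" and sub2: "sub_filtration T F2 F"
    and f_Lb: "f \<in> Lb M T" and g_Lb: "g \<in> Lb M T"
    and f_adapted: "adapted T F f" and g_adapted: "adapted T F g" and g_regular: "regular M T F g"
    and order: "AE \<omega> in M. \<forall>t\<in>tset T. f t \<omega> \<ge> h t \<omega> \<and> h t \<omega> \<ge> g t \<omega>"
    and h_adapted: "adapted T F h"
    and rcF2: "right_continuous_filtration T F2"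
    and nullF2: "null_sets M \<subseteq> sets (F2 0)"
begin

sublocale U: prob_space unif by (rule prob_space_unif)
sublocale P: pair_sigma_finite M unif ..

lemma T0: "0 \<le> T" using T by simp

text \<open>Controls without jumps in the interior of the horizon; absolute continuity enters only
  through this property.\<close>

definition Kc :: "(ereal \<Rightarrow> 'a \<Rightarrow> real) set" where
  "Kc = {\<xi> \<in> Acirc M T F1. \<forall>\<omega>\<in>space M. \<forall>t. 0 < t \<longrightarrow> t < T \<longrightarrow> lft (\<lambda>s. \<xi> s \<omega>) t = \<xi> t \<omega>}"

abbreviation "K2 \<equiv> Acirc M T F2"

abbreviation q :: "(ereal \<Rightarrow> 'a \<Rightarrow> real) \<Rightarrow> 'a \<Rightarrow> real \<Rightarrow> ereal" where
  "q \<rho> \<omega> v \<equiv> qtl T (\<lambda>t. \<rho> t \<omega>) v"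

definition Yf :: "(ereal \<Rightarrow> 'a \<Rightarrow> real) \<Rightarrow> ereal \<Rightarrow> 'a \<Rightarrow> real" where
  "Yf \<zeta> t \<omega> = (if t < T then f t \<omega> * (1 - \<zeta> t \<omega>) else 0)"

definition Xg :: "(ereal \<Rightarrow> 'a \<Rightarrow> real) \<Rightarrow> ereal \<Rightarrow> 'a \<Rightarrow> real" where
  "Xg \<xi> t \<omega> = (if t < T then g t \<omega> * (1 - \<xi> t \<omega>) else h T \<omega> * (1 - lft (\<lambda>s. \<xi> s \<omega>) T))"

text \<open>A control in \<open>Kc\<close> jumps at \<open>0\<close> and \<open>T\<close> only. The sum over joint jumps in the payoff thus reduces
  to two terms; the one at \<open>T\<close> is absorbed into \<open>Xg\<close>, as the quantile time of \<open>\<zeta>\<close> equals \<open>T\<close> with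
  probability \<open>\<Delta>\<zeta>\<^sub>T\<close>.\<close>

definition pay :: "(ereal \<Rightarrow> 'a \<Rightarrow> real) \<Rightarrow> (ereal \<Rightarrow> 'a \<Rightarrow> real) \<Rightarrow> 'a \<times> real \<Rightarrow> real" where
  "pay \<xi> \<zeta> p = Yf \<zeta> (q \<xi> (fst p) (snd p)) (fst p) + Xg \<xi> (q \<zeta> (fst p) (snd p)) (fst p)
     + h 0 (fst p) * \<xi> 0 (fst p) * \<zeta> 0 (fst p)"

definition J :: "(ereal \<Rightarrow> 'a \<Rightarrow> real) \<Rightarrow> (ereal \<Rightarrow> 'a \<Rightarrow> real) \<Rightarrow> real" where
  "J \<xi> \<zeta> = (\<integral>p. pay \<xi> \<zeta> p \<partial>(M \<Otimes>\<^sub>M unif))"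

lemma Kc_Acirc: "\<xi> \<in> Kc \<Longrightarrow> \<xi> \<in> Acirc M T F1" by (simp add: Kc_def)

lemma f_meas: "0 \<le> t \<Longrightarrow> t \<le> T \<Longrightarrow> f t \<in> borel_measurable M" by (rule adapted_measurable[OF filF f_adapted])
lemma g_meas: "0 \<le> t \<Longrightarrow> t \<le> T \<Longrightarrow> g t \<in> borel_measurable M" by (rule adapted_measurable[OF filF g_adapted])
lemma h_meas: "0 \<le> t \<Longrightarrow> t \<le> T \<Longrightarrow> h t \<in> borel_measurable M" by (rule adapted_measurable[OF filF h_adapted])
lemma f_prog: "prog_meas M T f" and g_prog: "prog_meas M T g"
  using f_Lb g_Lb by (auto simp: Lb_def)

text \<open>Being squeezed between \<open>g\<close> and \<open>f\<close>, the process
  \<open>h\<close> inherits a bound although it has no path regularity of its own.\<close>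

lemma ex_dom: "\<exists>B. integrable M B \<and> (AE \<omega> in M. \<forall>t\<in>tset T. \<bar>f t \<omega>\<bar> \<le> B \<omega> \<and> \<bar>g t \<omega>\<bar> \<le> B \<omega> \<and> \<bar>h t \<omega>\<bar> \<le> B \<omega>)"
proof -
  obtain B1 where B1: "integrable M B1" "AE \<omega> in M. \<forall>t\<in>tset T. \<bar>f t \<omega>\<bar> \<le> B1 \<omega>"
    using Lb_dominated[OF f_Lb T f_meas] by blast
  obtain B2 where B2: "integrable M B2" "AE \<omega> in M. \<forall>t\<in>tset T. \<bar>g t \<omega>\<bar> \<le> B2 \<omega>"
    using Lb_dominated[OF g_Lb T g_meas] by blast
  have "AE \<omega> in M. \<forall>t\<in>tset T. \<bar>f t \<omega>\<bar> \<le> B1 \<omega> + B2 \<omega> \<and> \<bar>g t \<omega>\<bar> \<le> B1 \<omega> + B2 \<omega> \<and> \<bar>h t \<omega>\<bar> \<le> B1 \<omega> + B2 \<omega>"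
    using B1(2) B2(2) order
  proof eventually_elim
    case (elim \<omega>)
    show ?case
    proof
      fix t assume t: "t \<in> tset T"
      show "\<bar>f t \<omega>\<bar> \<le> B1 \<omega> + B2 \<omega> \<and> \<bar>g t \<omega>\<bar> \<le> B1 \<omega> + B2 \<omega> \<and> \<bar>h t \<omega>\<bar> \<le> B1 \<omega> + B2 \<omega>"
        using elim(1)[rule_format, OF t] elim(2)[rule_format, OF t] elim(3)[rule_format, OF t] by linarith
    qed
  qed
  with B1 B2 show ?thesis by (intro exI[of _ "\<lambda>\<omega>. B1 \<omega> + B2 \<omega>"]) auto
qed

definition dom :: "'a \<Rightarrow> real" where
  "dom = (SOME B. integrable M B \<and> (AE \<omega> in M. \<forall>t\<in>tset T. \<bar>f t \<omega>\<bar> \<le> B \<omega> \<and> \<bar>g t \<omega>\<bar> \<le> B \<omega> \<and> \<bar>h t \<omega>\<bar> \<le> B \<omega>))"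

lemma dom_integrable: "integrable M dom"
  and dom_AE: "AE \<omega> in M. \<forall>t\<in>tset T. \<bar>f t \<omega>\<bar> \<le> dom \<omega> \<and> \<bar>g t \<omega>\<bar> \<le> dom \<omega> \<and> \<bar>h t \<omega>\<bar> \<le> dom \<omega>"
  using someI_ex[OF ex_dom] unfolding dom_def[symmetric] by auto

text \<open>One null set outside which all pathwise estimates hold, so that they can be stated for a
  single outcome.\<close>

definition good :: "'a \<Rightarrow> bool" where
  "good \<omega> \<longleftrightarrow> \<omega> \<in> space M \<and>
     (\<forall>t\<in>tset T. \<bar>f t \<omega>\<bar> \<le> dom \<omega> \<and> \<bar>g t \<omega>\<bar> \<le> dom \<omega> \<and> \<bar>h t \<omega>\<bar> \<le> dom \<omega> \<and> g t \<omega> \<le> h t \<omega>)"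

lemma good_AE: "AE \<omega> in M. good \<omega>"
  using dom_AE order AE_space by eventually_elim (auto simp: good_def)

lemma goodD:
  assumes "good \<omega>" "0 \<le> t" "t \<le> T"
  shows "\<bar>f t \<omega>\<bar> \<le> dom \<omega>" "\<bar>g t \<omega>\<bar> \<le> dom \<omega>" "\<bar>h t \<omega>\<bar> \<le> dom \<omega>" "g t \<omega> \<le> h t \<omega>" "\<omega> \<in> space M" "0 \<le> dom \<omega>"
  using assms abs_ge_zero[of "f t \<omega>"] by (auto simp: good_def tset_iff simp del: abs_ge_zero intro: order_trans)

lemma abs_mult_le: "\<bar>a\<bar> \<le> c \<Longrightarrow> 0 \<le> b \<Longrightarrow> b \<le> 1 \<Longrightarrow> \<bar>a * b\<bar> \<le> (c::real)"
  using mult_mono[of "\<bar>a\<bar>" c b 1] by (auto simp: abs_mult)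

lemma Yf_bound: "good \<omega> \<Longrightarrow> \<zeta> \<in> Acirc M T G \<Longrightarrow> 0 \<le> t \<Longrightarrow> t \<le> T \<Longrightarrow> \<bar>Yf \<zeta> t \<omega>\<bar> \<le> dom \<omega>"
  using goodD[of \<omega> t] dpath_nonneg[OF Acirc_dpath, of \<zeta> M T G \<omega> t] dpath_le_1[OF Acirc_dpath, of \<zeta> M T G \<omega> t]
  by (auto simp: Yf_def intro!: abs_mult_le)

lemma Xg_bound: "good \<omega> \<Longrightarrow> \<xi> \<in> Acirc M T G \<Longrightarrow> 0 \<le> t \<Longrightarrow> t \<le> T \<Longrightarrow> \<bar>Xg \<xi> t \<omega>\<bar> \<le> dom \<omega>"
  using goodD[of \<omega> t] goodD[of \<omega> T] T0 dpath_nonneg[OF Acirc_dpath, of \<xi> M T G \<omega> t] dpath_le_1[OF Acirc_dpath, of \<xi> M T G \<omega> t]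
    lft_nonneg[OF Acirc_dpath, of \<xi> M T G \<omega> T] lft_le_1[OF Acirc_dpath, of \<xi> M T G \<omega> T]
  by (auto simp: Xg_def intro!: abs_mult_le)

lemma P3_bound:
  assumes "good \<omega>" "\<xi> \<in> Acirc M T G" "\<zeta> \<in> Acirc M T G'"
  shows "\<bar>h 0 \<omega> * \<xi> 0 \<omega> * \<zeta> 0 \<omega>\<bar> \<le> dom \<omega>"
  using goodD[of \<omega> 0] T0 assms dpath_nonneg[OF Acirc_dpath, of \<xi> M T G \<omega> 0] dpath_le_1[OF Acirc_dpath, of \<xi> M T G \<omega> 0]
    dpath_nonneg[OF Acirc_dpath, of \<zeta> M T G' \<omega> 0] dpath_le_1[OF Acirc_dpath, of \<zeta> M T G' \<omega> 0]
  by (auto intro!: abs_mult_le)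

lemma q_in: "\<rho> \<in> Acirc M T G \<Longrightarrow> \<omega> \<in> space M \<Longrightarrow> 0 < v \<Longrightarrow> v < 1 \<Longrightarrow> 0 \<le> q \<rho> \<omega> v \<and> q \<rho> \<omega> v \<le> T"
  using qtl_in_tset[OF T Acirc_dpath, of \<rho> M G \<omega> v] by simp

lemma pay_bound:
  assumes "good \<omega>" "\<xi> \<in> Acirc M T G" "\<zeta> \<in> Acirc M T G'" "0 < v" "v < 1"
  shows "\<bar>pay \<xi> \<zeta> (\<omega>, v)\<bar> \<le> 3 * dom \<omega>"
proof -
  have \<omega>: "\<omega> \<in> space M" using assms by (simp add: good_def)
  show ?thesis
    using Yf_bound[OF assms(1,3), of "q \<xi> \<omega> v"] Xg_bound[OF assms(1,2), of "q \<zeta> \<omega> v"] P3_bound[OF assms(1-3)]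
      q_in[OF assms(2) \<omega> assms(4,5)] q_in[OF assms(3) \<omega> assms(4,5)] by (simp add: pay_def)
qed

lemma q_meas:
  assumes "is_filtration M T G" "\<rho> \<in> Acirc M T G"
  shows "(\<lambda>p. q \<rho> (fst p) (snd p)) \<in> borel_measurable (M \<Otimes>\<^sub>M unif)"
proof (rule measurable_qtl[where r="\<lambda>t p. \<rho> t (fst p)" and v=snd, OF T])
  show "(\<lambda>p. \<rho> t (fst p)) \<in> borel_measurable (M \<Otimes>\<^sub>M unif)" if "0 \<le> t" "t \<le> T" for t
    using Acirc_measurable[OF assms that] by measurable
  show "snd \<in> borel_measurable (M \<Otimes>\<^sub>M unif)"
    using measurable_compose[OF measurable_snd id_measurable_unif] by simp
qed (auto simp: space_pair_measure space_unif intro!: Acirc_dpath[OF assms(2)])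

lemma lft_meas:
  assumes "is_filtration M T G" "\<rho> \<in> Acirc M T G" "e \<in> borel_measurable M" "\<And>p. p \<in> space M \<Longrightarrow> 0 \<le> e p \<and> e p \<le> T"
  shows "(\<lambda>\<omega>. lft (\<lambda>s. \<rho> s \<omega>) (e \<omega>)) \<in> borel_measurable M"
  by (rule measurable_lft[OF T Acirc_measurable[OF assms(1,2)] Acirc_dpath[OF assms(2)] assms(3,4)]) auto

lemma Yf_eval_meas:
  assumes "is_filtration M T G" "\<zeta> \<in> Acirc M T G"
    and e[measurable]: "e \<in> borel_measurable N" and et: "\<And>p. p \<in> space N \<Longrightarrow> 0 \<le> e p \<and> e p \<le> T" and k: "k \<in> N \<rightarrow>\<^sub>M M"
  shows "(\<lambda>p. Yf \<zeta> (e p) (k p)) \<in> borel_measurable N"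
proof -
  have [measurable]: "(\<lambda>p. f (e p) (k p)) \<in> borel_measurable N" "(\<lambda>p. \<zeta> (e p) (k p)) \<in> borel_measurable N"
    using prog_meas_eval[OF f_prog e et k] prog_meas_eval[OF Acirc_prog_meas[OF T assms(1,2)] e et k] by auto
  show ?thesis unfolding Yf_def by measurable
qed

lemma Xg_eval_meas:
  assumes "is_filtration M T G" "\<xi> \<in> Acirc M T G"
    and e[measurable]: "e \<in> borel_measurable N" and et: "\<And>p. p \<in> space N \<Longrightarrow> 0 \<le> e p \<and> e p \<le> T" and k: "k \<in> N \<rightarrow>\<^sub>M M"
  shows "(\<lambda>p. Xg \<xi> (e p) (k p)) \<in> borel_measurable N"
proof -
  have [measurable]: "(\<lambda>p. g (e p) (k p)) \<in> borel_measurable N" "(\<lambda>p. \<xi> (e p) (k p)) \<in> borel_measurable N"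
    using prog_meas_eval[OF g_prog e et k] prog_meas_eval[OF Acirc_prog_meas[OF T assms(1,2)] e et k] by auto
  have [measurable]: "(\<lambda>p. h T (k p)) \<in> borel_measurable N" "(\<lambda>p. lft (\<lambda>s. \<xi> s (k p)) T) \<in> borel_measurable N"
    using measurable_compose[OF k h_meas[OF T0 order_refl]]
      measurable_compose[OF k lft_meas[OF assms(1,2), of "\<lambda>_. T"]] T0 by auto
  show ?thesis unfolding Xg_def by measurable
qed

lemma pay_meas:
  assumes "\<xi> \<in> Acirc M T F1" "\<zeta> \<in> K2"
  shows "pay \<xi> \<zeta> \<in> borel_measurable (M \<Otimes>\<^sub>M unif)"
proof -
  have "(\<lambda>p. Yf \<zeta> (q \<xi> (fst p) (snd p)) (fst p)) \<in> borel_measurable (M \<Otimes>\<^sub>M unif)"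
    using q_in[OF assms(1)]
    by (intro Yf_eval_meas[OF filF2 assms(2) q_meas[OF filF1 assms(1)]]) (auto simp: space_pair_measure space_unif)
  moreover have "(\<lambda>p. Xg \<xi> (q \<zeta> (fst p) (snd p)) (fst p)) \<in> borel_measurable (M \<Otimes>\<^sub>M unif)"
    using q_in[OF assms(2)]
    by (intro Xg_eval_meas[OF filF1 assms(1) q_meas[OF filF2 assms(2)]]) (auto simp: space_pair_measure space_unif)
  moreover have "(\<lambda>\<omega>. h 0 \<omega> * \<xi> 0 \<omega> * \<zeta> 0 \<omega>) \<in> borel_measurable M"
    using h_meas[of 0] Acirc_measurable[OF filF1 assms(1), of 0] Acirc_measurable[OF filF2 assms(2), of 0] T0 by simp
  then have "(\<lambda>p. h 0 (fst p) * \<xi> 0 (fst p) * \<zeta> 0 (fst p)) \<in> borel_measurable (M \<Otimes>\<^sub>M unif)" 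
    using measurable_compose[OF measurable_fst] by blast
  ultimately show ?thesis unfolding pay_def[abs_def] by (intro borel_measurable_add)
qed

lemma dom_fst_integrable: "integrable (M \<Otimes>\<^sub>M unif) (\<lambda>p. 3 * dom (fst p))"
proof -
  have "integrable (M \<Otimes>\<^sub>M unif) (\<lambda>p. dom (fst p))"
    using dom_integrable
    by (subst P.Fubini_integrable)
      (auto simp: U.prob_space intro!: measurable_compose[OF measurable_fst borel_measurable_integrable])
  then show ?thesis by simp
qed

lemma pay_dom: 
  assumes "\<xi> \<in> Acirc M T F1" "\<zeta> \<in> K2"
  shows "AE p in M \<Otimes>\<^sub>M unif. \<bar>pay \<xi> \<zeta> p\<bar> \<le> 3 * dom (fst p)"
  using AE_fst_pair[OF prob_space_axioms prob_space_unif good_AE] AE_space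
  by eventually_elim (use pay_bound[OF _ assms] in \<open>auto simp: space_pair_measure space_unif\<close>)

lemma pay_integrable:
  assumes "\<xi> \<in> Acirc M T F1" "\<zeta> \<in> K2"
  shows "integrable (M \<Otimes>\<^sub>M unif) (pay \<xi> \<zeta>)"
  by (rule Bochner_Integration.integrable_bound[OF dom_fst_integrable pay_meas[OF assms]])
    (use pay_dom[OF assms] in \<open>auto elim!: eventually_mono\<close>)

lemma J_eq: "\<xi> \<in> Acirc M T F1 \<Longrightarrow> \<zeta> \<in> K2 \<Longrightarrow> J \<xi> \<zeta> = (\<integral>\<omega>. (\<integral>v. pay \<xi> \<zeta> (\<omega>, v) \<partial>unif) \<partial>M)"
  unfolding J_def using P.integral_fst'[OF pay_integrable] by simp

lemma J_bound: "\<xi> \<in> Acirc M T F1 \<Longrightarrow> \<zeta> \<in> K2 \<Longrightarrow> \<bar>J \<xi> \<zeta>\<bar> \<le> (\<integral>p. 3 * dom (fst p) \<partial>(M \<Otimes>\<^sub>M unif))"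
  unfolding J_def
  using integral_abs_bound[of "M \<Otimes>\<^sub>M unif" "pay \<xi> \<zeta>"] 
    integral_mono_AE[OF integrable_abs[OF pay_integrable] dom_fst_integrable pay_dom, of \<xi> \<zeta>] by linarith

lemma Yf_q_integrable:
  assumes "good \<omega>" "\<rho> \<in> Acirc M T G" "is_filtration M T G'" "\<zeta> \<in> Acirc M T G'"
  shows "integrable unif (\<lambda>v. Yf \<zeta> (q \<rho> \<omega> v) \<omega>)"
proof (rule U.integrable_const_bound[where B="dom \<omega>"])
  have \<omega>: "\<omega> \<in> space M" using assms by (simp add: good_def)
  show "AE v in unif. norm (Yf \<zeta> (q \<rho> \<omega> v) \<omega>) \<le> dom \<omega>"
    using Yf_bound[OF assms(1,4)] q_in[OF assms(2) \<omega>] by (intro AE_I2) (auto simp: space_unif)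
  show "(\<lambda>v. Yf \<zeta> (q \<rho> \<omega> v) \<omega>) \<in> borel_measurable unif"
    using q_in[OF assms(2) \<omega>] \<omega>
    by (intro Yf_eval_meas[OF assms(3,4) measurable_qtl_unif[OF T Acirc_dpath[OF assms(2)]]]) (auto simp: space_unif)
qed

lemma Xg_q_integrable:
  assumes "good \<omega>" "\<rho> \<in> Acirc M T G" "is_filtration M T G'" "\<xi> \<in> Acirc M T G'"
  shows "integrable unif (\<lambda>v. Xg \<xi> (q \<rho> \<omega> v) \<omega>)"
proof (rule U.integrable_const_bound[where B="dom \<omega>"])
  have \<omega>: "\<omega> \<in> space M" using assms by (simp add: good_def)
  show "AE v in unif. norm (Xg \<xi> (q \<rho> \<omega> v) \<omega>) \<le> dom \<omega>"
    using Xg_bound[OF assms(1,4)] q_in[OF assms(2) \<omega>] by (intro AE_I2) (auto simp: space_unif)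
  show "(\<lambda>v. Xg \<xi> (q \<rho> \<omega> v) \<omega>) \<in> borel_measurable unif"
    using q_in[OF assms(2) \<omega>] \<omega>
    by (intro Xg_eval_meas[OF assms(3,4) measurable_qtl_unif[OF T Acirc_dpath[OF assms(2)]]]) (auto simp: space_unif)
qed

lemma integral_pay_split:
  assumes "good \<omega>" "\<xi> \<in> Acirc M T F1" "\<zeta> \<in> K2"
  shows "(\<integral>v. pay \<xi> \<zeta> (\<omega>, v) \<partial>unif) = (\<integral>v. Yf \<zeta> (q \<xi> \<omega> v) \<omega> \<partial>unif) + (\<integral>v. Xg \<xi> (q \<zeta> \<omega> v) \<omega> \<partial>unif)
      + h 0 \<omega> * \<xi> 0 \<omega> * \<zeta> 0 \<omega>"
  using Yf_q_integrable[OF assms(1,2) filF2 assms(3)] Xg_q_integrable[OF assms(1,3) filF1 assms(2)]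
  by (simp add: pay_def U.prob_space)

text \<open>Affinity is asked for only after the level has been integrated out; at a fixed level it
  fails, since quantile times do not mix.\<close>

lemma J_affine_AE:
  assumes "\<xi> \<in> Acirc M T F1" "\<zeta> \<in> K2" "\<xi>' \<in> Acirc M T F1" "\<zeta>' \<in> K2" "\<xi>'' \<in> Acirc M T F1" "\<zeta>'' \<in> K2"
    and "\<And>\<omega>. good \<omega> \<Longrightarrow> (\<integral>v. pay \<xi>'' \<zeta>'' (\<omega>, v) \<partial>unif) =
      (1 - l) * (\<integral>v. pay \<xi> \<zeta> (\<omega>, v) \<partial>unif) + l * (\<integral>v. pay \<xi>' \<zeta>' (\<omega>, v) \<partial>unif)"
  shows "J \<xi>'' \<zeta>'' = (1 - l) * J \<xi> \<zeta> + l * J \<xi>' \<zeta>'"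
proof -
  note i = P.integrable_fst'[OF pay_integrable]
  have "J \<xi>'' \<zeta>'' = (\<integral>\<omega>. (1 - l) * (\<integral>v. pay \<xi> \<zeta> (\<omega>, v) \<partial>unif) + l * (\<integral>v. pay \<xi>' \<zeta>' (\<omega>, v) \<partial>unif) \<partial>M)"
    unfolding J_eq[OF assms(5,6)]
  proof (rule integral_cong_AE)
    show "AE \<omega> in M. (\<integral>v. pay \<xi>'' \<zeta>'' (\<omega>, v) \<partial>unif) =
      (1 - l) * (\<integral>v. pay \<xi> \<zeta> (\<omega>, v) \<partial>unif) + l * (\<integral>v. pay \<xi>' \<zeta>' (\<omega>, v) \<partial>unif)"
      using good_AE by eventually_elim (rule assms(7))
  qed (use i[OF assms(1,2)] i[OF assms(3,4)] i[OF assms(5,6)] in auto)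
  also have "\<dots> = (1 - l) * J \<xi> \<zeta> + l * J \<xi>' \<zeta>'"
    unfolding J_eq[OF assms(1,2)] J_eq[OF assms(3,4)] using i[OF assms(1,2)] i[OF assms(3,4)] by simp
  finally show ?thesis .
qed

lemma tborel_meas:
  "\<omega> \<in> space M \<Longrightarrow> is_filtration M T G \<Longrightarrow> \<rho> \<in> Acirc M T G \<Longrightarrow> (\<lambda>t. Yf \<rho> t \<omega>) \<in> borel_measurable (tborel T)"
  "\<omega> \<in> space M \<Longrightarrow> is_filtration M T G \<Longrightarrow> \<rho> \<in> Acirc M T G \<Longrightarrow> (\<lambda>t. Xg \<rho> t \<omega>) \<in> borel_measurable (tborel T)"
  using measurable_restrict_space1[OF measurable_ident, of borel "tset T"]
  by (auto intro!: Yf_eval_meas[where e="\<lambda>t. t" and k="\<lambda>_. \<omega>"] Xg_eval_meas[where e="\<lambda>t. t" and k="\<lambda>_. \<omega>"]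
    simp: id_def space_restrict_space tset_iff)

text \<open>The control is the integrator in the first term, where the laws of the quantile times
  mix, and enters the other two terms affinely. In \<open>J_mix2\<close> the first two terms
  exchange roles.\<close>

lemma J_mix1:
  assumes a: "\<xi> \<in> Acirc M T F1" "\<xi>' \<in> Acirc M T F1" "\<zeta> \<in> K2" "0 \<le> l" "l \<le> 1"
  shows "J (mixp l \<xi> \<xi>') \<zeta> = (1 - l) * J \<xi> \<zeta> + l * J \<xi>' \<zeta>"
proof (rule J_affine_AE)
  show m: "mixp l \<xi> \<xi>' \<in> Acirc M T F1" by (rule Acirc_mix[OF T a(1,2,4,5)])
  fix \<omega> assume g: "good \<omega>"
  then have \<omega>: "\<omega> \<in> space M" by (simp add: good_def)
  note d = Acirc_dpath[OF a(1) \<omega>] Acirc_dpath[OF a(2) \<omega>]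
  have 1: "(\<integral>v. Yf \<zeta> (q (mixp l \<xi> \<xi>') \<omega> v) \<omega> \<partial>unif) =
      (1 - l) * (\<integral>v. Yf \<zeta> (q \<xi> \<omega> v) \<omega> \<partial>unif) + l * (\<integral>v. Yf \<zeta> (q \<xi>' \<omega> v) \<omega> \<partial>unif)"
    unfolding mixp_def
    by (rule integral_qtl_mix[OF T d dpath_mix[OF T d a(4,5)] a(4,5), where B="dom \<omega>"])
      (use tborel_meas[OF \<omega> filF2 a(3)] Yf_bound[OF g a(3)] in auto)
  have "Xg (mixp l \<xi> \<xi>') t \<omega> = (1 - l) * Xg \<xi> t \<omega> + l * Xg \<xi>' t \<omega>" for t
    unfolding Xg_def mixp_def lft_lincomb[OF d T0 order_refl] by (simp add: algebra_simps)
  then have 2: "(\<integral>v. Xg (mixp l \<xi> \<xi>') (q \<zeta> \<omega> v) \<omega> \<partial>unif) =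
      (1 - l) * (\<integral>v. Xg \<xi> (q \<zeta> \<omega> v) \<omega> \<partial>unif) + l * (\<integral>v. Xg \<xi>' (q \<zeta> \<omega> v) \<omega> \<partial>unif)"
    using Xg_q_integrable[OF g a(3) filF1 a(1)] Xg_q_integrable[OF g a(3) filF1 a(2)] by simp
  show "(\<integral>v. pay (mixp l \<xi> \<xi>') \<zeta> (\<omega>, v) \<partial>unif) =
      (1 - l) * (\<integral>v. pay \<xi> \<zeta> (\<omega>, v) \<partial>unif) + l * (\<integral>v. pay \<xi>' \<zeta> (\<omega>, v) \<partial>unif)"
    unfolding integral_pay_split[OF g m a(3)] integral_pay_split[OF g a(1,3)] integral_pay_split[OF g a(2,3)] 1 2
    by (simp add: mixp_def algebra_simps)
qed (use a in auto)

lemma J_mix2: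
  assumes a: "\<xi> \<in> Acirc M T F1" "\<zeta> \<in> K2" "\<zeta>' \<in> K2" "0 \<le> l" "l \<le> 1"
  shows "J \<xi> (mixp l \<zeta> \<zeta>') = (1 - l) * J \<xi> \<zeta> + l * J \<xi> \<zeta>'"
proof (rule J_affine_AE)
  show m: "mixp l \<zeta> \<zeta>' \<in> K2" by (rule Acirc_mix[OF T a(2,3,4,5)])
  fix \<omega> assume g: "good \<omega>"
  then have \<omega>: "\<omega> \<in> space M" by (simp add: good_def)
  note d = Acirc_dpath[OF a(2) \<omega>] Acirc_dpath[OF a(3) \<omega>]
  have 1: "(\<integral>v. Xg \<xi> (q (mixp l \<zeta> \<zeta>') \<omega> v) \<omega> \<partial>unif) =
      (1 - l) * (\<integral>v. Xg \<xi> (q \<zeta> \<omega> v) \<omega> \<partial>unif) + l * (\<integral>v. Xg \<xi> (q \<zeta>' \<omega> v) \<omega> \<partial>unif)"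
    unfolding mixp_def
    by (rule integral_qtl_mix[OF T d dpath_mix[OF T d a(4,5)] a(4,5), where B="dom \<omega>"])
      (use tborel_meas[OF \<omega> filF1 a(1)] Xg_bound[OF g a(1)] in auto)
  have "Yf (mixp l \<zeta> \<zeta>') t \<omega> = (1 - l) * Yf \<zeta> t \<omega> + l * Yf \<zeta>' t \<omega>" for t
    unfolding Yf_def mixp_def by (simp add: algebra_simps)
  then have 2: "(\<integral>v. Yf (mixp l \<zeta> \<zeta>') (q \<xi> \<omega> v) \<omega> \<partial>unif) =
      (1 - l) * (\<integral>v. Yf \<zeta> (q \<xi> \<omega> v) \<omega> \<partial>unif) + l * (\<integral>v. Yf \<zeta>' (q \<xi> \<omega> v) \<omega> \<partial>unif)"
    using Yf_q_integrable[OF g a(1) filF2 a(2)] Yf_q_integrable[OF g a(1) filF2 a(3)] by simp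
  show "(\<integral>v. pay \<xi> (mixp l \<zeta> \<zeta>') (\<omega>, v) \<partial>unif) =
      (1 - l) * (\<integral>v. pay \<xi> \<zeta> (\<omega>, v) \<partial>unif) + l * (\<integral>v. pay \<xi> \<zeta>' (\<omega>, v) \<partial>unif)"
    unfolding integral_pay_split[OF g a(1) m] integral_pay_split[OF g a(1,2)] integral_pay_split[OF g a(1,3)] 1 2
    by (simp add: mixp_def algebra_simps)
qed (use a in auto)

end

section \<open>Left continuity of absolutely continuous controls, uniqueness of
  representatives\<close>

lemma abs_cont_imp_left_cont:
  assumes x: "dpath T x" and ac: "abs_cont_on (below_T T) (\<lambda>r. x (ereal r))" and t: "0 < t" "t < T"
  shows "lft x t = x t"
proof (rule antisym)
  show "lft x t \<le> x t" using lft_le[OF x] t by auto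
  obtain r where r: "t = ereal r" using t by (cases t) auto
  show "x t \<le> lft x t"
  proof (rule field_le_epsilon)
    fix e :: real assume "0 < e"
    then obtain d where d: "d > 0" and D: "\<And>n::nat. \<And>a b. (\<forall>i<n. a i \<in> below_T T \<and> b i \<in> below_T T \<and> a i \<le> b i) \<and>
      (\<forall>i<n. \<forall>j<n. i \<noteq> j \<longrightarrow> b i \<le> a j \<or> b j \<le> a i) \<and>
      (\<Sum>i<n. b i - a i) < d \<longrightarrow> (\<Sum>i<n. \<bar>x (ereal (b i)) - x (ereal (a i))\<bar>) < e"
      using ac unfolding abs_cont_on_def by blast
    \<comment> \<open>Halving \<open>r\<close> keeps \<open>s\<close> positive; subtracting
      \<open>d / 2\<close> keeps it within the admissible distance.\<close>
    define s where "s = max (r / 2) (r - d / 2)"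
    have "0 < r" using t r by simp
    then have s: "0 < s" "s < r" "r - s < d" using d by (auto simp: s_def)
    then have "ereal s < T" using t r by (metis ereal_less_eq(3) le_less_trans less_imp_le)
    then have "\<bar>x (ereal r) - x (ereal s)\<bar> < e"
      using D[of 1 "\<lambda>_. s" "\<lambda>_. r"] s t r by (auto simp: below_T_def)
    moreover have "x (ereal s) \<le> lft x t" using le_lft[OF x, of "ereal s" t] s r t by auto
    ultimately show "x t \<le> lft x t + e" using r by auto
  qed
qed

text \<open>The two infinite points are covered by null singletons, the rest by bounded
  intervals.\<close>

lemma sigma_finite_lam: "sigma_finite_measure (lam T)"
  unfolding lam_def
proof (rule sigma_finite_measure_restrict_space)
  show "tset T \<in> sets (distr lborel borel ereal)" by (simp add: tset_def)
  show "sigma_finite_measure (distr lborel borel ereal)"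
  proof
    let ?A = "insert {\<infinity>} (insert {-\<infinity>} (range (\<lambda>n::nat. {ereal (- real n)..ereal (real n)})))"
    have "\<Union>?A = UNIV"
    proof (intro set_eqI iffI UNIV_I)
      fix x :: ereal
      show "x \<in> \<Union>?A"
      proof (cases x)
        case (real r)
        obtain n where "\<bar>r\<bar> \<le> real n" using real_arch_simple by blast
        then show ?thesis using real by (auto intro!: exI[of _ n])
      qed auto
    qed
    moreover have "emeasure (distr lborel borel ereal) a \<noteq> \<infinity>" if "a \<in> ?A" for a
    proof -
      have "ereal -` {\<infinity>} = {}" "ereal -` {-\<infinity>} = {}" "ereal -` {ereal (- real n)..ereal (real n)} = {- real n..real n}" for n
        by auto
      then show ?thesis using that by (auto simp: emeasure_distr)
    qed
    ultimately show "\<exists>A. countable A \<and> A \<subseteq> sets (distr lborel borel ereal) \<and> \<Union>A = space (distr lborel borel ereal) \<and>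
        (\<forall>a\<in>A. emeasure (distr lborel borel ereal) a \<noteq> \<infinity>)"
      by (intro exI[of _ ?A]) auto
  qed
qed

lemma AE_lam_dense:
  assumes "AE t in lam T. P t" "0 \<le> a" "a < b" "b \<le> T"
  obtains t where "a < t" "t < b" "P t"
proof (rule ccontr)
  assume "\<not> thesis"
  then have no: "\<And>t. a < t \<Longrightarrow> t < b \<Longrightarrow> \<not> P t" using that by blast
  obtain c where c: "a < ereal c" "ereal c < b" using ereal_dense2[OF assms(3)] by auto
  obtain d where d: "ereal c < ereal d" "ereal d < b" using ereal_dense2[OF c(2)] by auto
  have "tset T \<inter> space (distr lborel borel ereal) \<in> sets (distr lborel borel ereal)" by (simp add: tset_def)
  with assms(1) have "AE t in distr lborel borel ereal. t \<in> tset T \<longrightarrow> P t"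
    unfolding lam_def by (simp add: AE_restrict_space_iff)
  then have "AE x in lborel. ereal x \<in> tset T \<longrightarrow> P (ereal x)"
    by (rule AE_distrD[rotated]) simp
  then have "AE x in lborel. x \<notin> {c<..<d}"
  proof eventually_elim
    case (elim x)
    show ?case
    proof
      assume "x \<in> {c<..<d}"
      then have "ereal c < ereal x" "ereal x < ereal d" by auto
      then have "a < ereal x" "ereal x < b" using c d by (meson less_trans)+
      moreover then have "ereal x \<in> tset T" unfolding tset_iff
        using assms(2,4) by (meson le_less_trans less_imp_le order_trans)
      ultimately show False using no elim by auto
    qed
  qed
  then have "emeasure lborel {c<..<d} = 0"
    by (subst (asm) AE_iff_measurable[of "{c<..<d}"]) auto
  then show False using d by simp
qed

text \<open>At times \<open>t < s\<close> a point of agreement in between gives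
  \<open>x t \<le> y s\<close>; letting \<open>s\<close> decrease to \<open>t\<close>, right
  continuity removes the gap. Exchanging the roles gives equality.\<close>

lemma dpath_eq_if_AE_eq:
  assumes T: "0 < T" and x: "dpath T x" and y: "dpath T y" and ae: "AE t in lam T. x t = y t" and t: "0 \<le> t" "t \<le> T"
  shows "x t = y t"
proof -
  have half: "x t \<le> y t" if x: "dpath T x" and y: "dpath T y" and ae: "AE t in lam T. x t = y t" and tT: "t < T" for x y
  proof (rule tendsto_lowerbound[OF cadlag_path_right])
    show "\<forall>\<^sub>F s in at_right t. x t \<le> y s"
      unfolding eventually_at_right[OF tT]
    proof (intro exI[of _ T] conjI allI impI tT)
      fix s assume s: "t < s" "s < T"
      obtain r where r: "t < r" "r < s" "x r = y r" 
        by (rule AE_lam_dense[OF ae t(1) s(1) less_imp_le[OF s(2)]])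
      have "x t \<le> x r" using dpath_mono[OF x t(1), of r] r s by auto
      also have "\<dots> \<le> y s" using dpath_mono[OF y, of r s] r s t by auto
      finally show "x t \<le> y s" .
    qed
  qed (use y t tT at_right_ereal_neq_bot[OF tT] in \<open>auto simp: dpath_def\<close>)
  show ?thesis
  proof (cases "t = T")
    case True then show ?thesis using x y by (simp add: dpath_def)
  next
    case False
    then have "t < T" using t by auto
    moreover have "AE t in lam T. y t = x t" using ae by eventually_elim simp
    ultimately show ?thesis using half[OF x y ae] half[OF y x] by (intro antisym) auto
  qed
qed

text \<open>This makes the choice in \<open>repr\<close> immaterial: two representatives of the same
  class differ only on a null set of outcomes, simultaneously for all times.\<close>

lemma indistinguishable:
  assumes M: "prob_space M" and T: "0 < T" and a: "\<sigma> \<in> Acirc M T G" "\<sigma>' \<in> Acirc M T G'"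
    and fil: "is_filtration M T G" "is_filtration M T G'"
    and ae: "ae_equal M T \<rho> \<sigma>" "ae_equal M T \<rho> \<sigma>'"
  shows "AE \<omega> in M. \<forall>t\<in>tset T. \<sigma> t \<omega> = \<sigma>' t \<omega>"
proof -
  interpret M: prob_space M by fact
  interpret L: sigma_finite_measure "lam T" by (rule sigma_finite_lam)
  interpret P: pair_sigma_finite "lam T" M ..
  have "AE p in lam T \<Otimes>\<^sub>M M. \<sigma> (fst p) (snd p) = \<sigma>' (fst p) (snd p)"
    using ae unfolding ae_equal_def by eventually_elim simp
  from P.AE_pair[OF this] have 1: "AE t in lam T. AE \<omega> in M. \<sigma> t \<omega> = \<sigma>' t \<omega>"
    by (simp only: fst_conv snd_conv)
  have "{p \<in> space (lam T \<Otimes>\<^sub>M M). \<sigma> (fst p) (snd p) = \<sigma>' (fst p) (snd p)} \<in> sets (lam T \<Otimes>\<^sub>M M)"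
    by (rule borel_measurable_eq[OF Acirc_prog_meas[OF T fil(1) a(1), unfolded prog_meas_def]
          Acirc_prog_meas[OF T fil(2) a(2), unfolded prog_meas_def]])
  \<comment> \<open>Fubini exchanges the quantifiers: for almost every outcome there is agreement at
    almost every time.\<close>
  from P.AE_commute[OF this] 1 have "AE \<omega> in M. AE t in lam T. \<sigma> t \<omega> = \<sigma>' t \<omega>"
    by (rule iffD1)
  with AE_space show ?thesis
  proof eventually_elim
    case (elim \<omega>)
    show ?case
    proof
      fix t assume "t \<in> tset T"
      then show "\<sigma> t \<omega> = \<sigma>' t \<omega>"
        using dpath_eq_if_AE_eq[OF T Acirc_dpath[OF a(1) elim(1)] Acirc_dpath[OF a(2) elim(1)] elim(2)]
        by (simp add: tset_iff)
    qed
  qed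
qed

section \<open>Identification of the Stieltjes payoff with \<open>J\<close>\<close>

context dynkin_game
begin

lemma Acirc_ac_Kc: "\<xi> \<in> Acirc_ac M T F1 \<Longrightarrow> \<xi> \<in> Kc"
  unfolding Acirc_ac_def Kc_def
  using abs_cont_imp_left_cont[OF Acirc_dpath[of \<xi> M T F1]] by (simp add: Ball_def)

text \<open>Stated for processes \<open>x\<close> and \<open>z\<close> that merely agree with \<xi>
  and \<zeta> at this outcome, because the representatives chosen by \<open>repr\<close> are tied to
  \<xi> and \<zeta> only up to null sets.\<close>

lemma Ncirc_integrand_eq:
  assumes g: "good \<omega>" and \<xi>: "\<xi> \<in> Kc" and \<zeta>: "\<zeta> \<in> K2"
    and eq: "\<forall>t\<in>tset T. x t \<omega> = \<xi> t \<omega>" "\<forall>t\<in>tset T. z t \<omega> = \<zeta> t \<omega>"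
  shows "(\<integral>r\<in>below_T T. f (ereal r) \<omega> * (1 - z (ereal r) \<omega>) \<partial>LS T x \<omega>)
    + (\<integral>r\<in>below_T T. g (ereal r) \<omega> * (1 - x (ereal r) \<omega>) \<partial>LS T z \<omega>)
    + (\<Sum>\<^sub>\<infinity>t\<in>tset T. h t \<omega> * jump x t \<omega> * jump z t \<omega>) = (\<integral>v. pay \<xi> \<zeta> (\<omega>, v) \<partial>unif)"
proof -
  have \<omega>: "\<omega> \<in> space M" using g by (simp add: good_def)
  note \<xi>A = Kc_Acirc[OF \<xi>]
  note dx = Acirc_dpath[OF \<xi>A \<omega>] and dz = Acirc_dpath[OF \<zeta> \<omega>]
  have LS: "LS T x \<omega> = LS T \<xi> \<omega>" "LS T z \<omega> = LS T \<zeta> \<omega>"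
    unfolding LS_def using eq T0 by (auto intro!: arg_cong[where f=interval_measure] simp: fun_eq_iff tset_iff)
  have bT: "ereal r \<in> tset T" if "r \<in> below_T T" for r using that by (auto simp: below_T_def tset_iff)
  have pm: "(\<lambda>t. f t \<omega> * (1 - \<zeta> t \<omega>)) \<in> borel_measurable (tborel T)" "(\<lambda>t. g t \<omega> * (1 - \<xi> t \<omega>)) \<in> borel_measurable (tborel T)"
  proof -
    have e: "(\<lambda>t. t) \<in> borel_measurable (tborel T)" "\<And>p. p \<in> space (tborel T) \<Longrightarrow> 0 \<le> p \<and> p \<le> T"
      using measurable_restrict_space1[OF measurable_ident, of borel "tset T"]
      by (auto simp: id_def space_restrict_space tset_iff)
    have k: "(\<lambda>_. \<omega>) \<in> tborel T \<rightarrow>\<^sub>M M" using \<omega> by simp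
    note [measurable] = prog_meas_eval[OF f_prog e k] prog_meas_eval[OF g_prog e k]
      prog_meas_eval[OF Acirc_prog_meas[OF T filF1 \<xi>A] e k] prog_meas_eval[OF Acirc_prog_meas[OF T filF2 \<zeta>] e k]
    show "(\<lambda>t. f t \<omega> * (1 - \<zeta> t \<omega>)) \<in> borel_measurable (tborel T)" "(\<lambda>t. g t \<omega> * (1 - \<xi> t \<omega>)) \<in> borel_measurable (tborel T)"
      by measurable
  qed
  have 1: "(\<integral>r\<in>below_T T. f (ereal r) \<omega> * (1 - z (ereal r) \<omega>) \<partial>LS T x \<omega>) = (\<integral>v. Yf \<zeta> (q \<xi> \<omega> v) \<omega> \<partial>unif)"
  proof -
    have "(\<integral>r\<in>below_T T. f (ereal r) \<omega> * (1 - z (ereal r) \<omega>) \<partial>LS T x \<omega>) =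
      (\<integral>r\<in>below_T T. f (ereal r) \<omega> * (1 - \<zeta> (ereal r) \<omega>) \<partial>LS T \<xi> \<omega>)"
      unfolding LS set_lebesgue_integral_def
      by (intro Bochner_Integration.integral_cong) (auto simp: indicator_def eq(2) bT)
    then show ?thesis using LS_integral_eq[of T \<xi> \<omega>, OF T dx pm(1)] by (simp add: Yf_def)
  qed
  have 2: "(\<integral>r\<in>below_T T. g (ereal r) \<omega> * (1 - x (ereal r) \<omega>) \<partial>LS T z \<omega>) =
     (\<integral>v. (if q \<zeta> \<omega> v < T then g (q \<zeta> \<omega> v) \<omega> * (1 - \<xi> (q \<zeta> \<omega> v) \<omega>) else 0) \<partial>unif)"
  proof -
    have "(\<integral>r\<in>below_T T. g (ereal r) \<omega> * (1 - x (ereal r) \<omega>) \<partial>LS T z \<omega>) =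
      (\<integral>r\<in>below_T T. g (ereal r) \<omega> * (1 - \<xi> (ereal r) \<omega>) \<partial>LS T \<zeta> \<omega>)"
      unfolding LS set_lebesgue_integral_def
      by (intro Bochner_Integration.integral_cong) (auto simp: indicator_def eq(1) bT)
    then show ?thesis using LS_integral_eq[of T \<zeta> \<omega>, OF T dz pm(2)] by simp
  qed
  have jx: "jump x t \<omega> = \<xi> t \<omega> - lft (\<lambda>s. \<xi> s \<omega>) t" "jump z t \<omega> = \<zeta> t \<omega> - lft (\<lambda>s. \<zeta> s \<omega>) t" if "t \<in> tset T" for t
    using that eq lft_cong[of t "\<lambda>s. x s \<omega>" "\<lambda>s. \<xi> s \<omega>"] lft_cong[of t "\<lambda>s. z s \<omega>" "\<lambda>s. \<zeta> s \<omega>"]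
    by (auto simp: jump_def lminus_eq_lft tset_iff)
  let ?c = "h T \<omega> * (1 - lft (\<lambda>s. \<xi> s \<omega>) T)"
  have "(\<Sum>\<^sub>\<infinity>t\<in>tset T. h t \<omega> * jump x t \<omega> * jump z t \<omega>) = (\<Sum>\<^sub>\<infinity>t\<in>{0, T}. h t \<omega> * jump x t \<omega> * jump z t \<omega>)"
  proof (rule infsum_cong_neutral)
    fix t assume t: "t \<in> tset T - {0, T}"
    then have "0 < t" "t < T" by (auto simp: tset_iff)
    then have "jump x t \<omega> = 0" using jx(1)[of t] \<xi> \<omega> t by (auto simp: Kc_def)
    then show "h t \<omega> * jump x t \<omega> * jump z t \<omega> = 0" by simp
  qed (use T0 in \<open>auto simp: tset_iff\<close>)
  also have "\<dots> = h 0 \<omega> * jump x 0 \<omega> * jump z 0 \<omega> + h T \<omega> * jump x T \<omega> * jump z T \<omega>"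
    using T by simp
  also have "\<dots> = h 0 \<omega> * \<xi> 0 \<omega> * \<zeta> 0 \<omega> + ?c * (1 - lft (\<lambda>s. \<zeta> s \<omega>) T)"
    using jx[of 0] jx[of T] T0 dx dz by (simp add: tset_iff dpath_def) (simp add: lft_def)
  finally have 3: "(\<Sum>\<^sub>\<infinity>t\<in>tset T. h t \<omega> * jump x t \<omega> * jump z t \<omega>) =
      h 0 \<omega> * \<xi> 0 \<omega> * \<zeta> 0 \<omega> + (\<integral>v. (if q \<zeta> \<omega> v < T then 0 else ?c) \<partial>unif)"
    using integral_qtl_eq_T[OF T dz, of ?c] by simp
  note [measurable] = measurable_qtl_unif[OF T dz]
  have i2: "integrable unif (\<lambda>v. if q \<zeta> \<omega> v < T then 0 else ?c)"
    by (rule U.integrable_const_bound[where B="\<bar>?c\<bar>"]) auto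
  \<comment> \<open>The two summands match the integral over \<open>[0,T)\<close> and the joint jump
    at \<open>T\<close>.\<close>
  have X: "Xg \<xi> (q \<zeta> \<omega> v) \<omega> = (if q \<zeta> \<omega> v < T then g (q \<zeta> \<omega> v) \<omega> * (1 - \<xi> (q \<zeta> \<omega> v) \<omega>) else 0) +
      (if q \<zeta> \<omega> v < T then 0 else ?c)" for v by (simp add: Xg_def)
  have "integrable unif (\<lambda>v. Xg \<xi> (q \<zeta> \<omega> v) \<omega> - (if q \<zeta> \<omega> v < T then 0 else ?c))"
    using Xg_q_integrable[OF g \<zeta> filF1 \<xi>A] i2 by (rule Bochner_Integration.integrable_diff)
  then have i1: "integrable unif (\<lambda>v. (if q \<zeta> \<omega> v < T then g (q \<zeta> \<omega> v) \<omega> * (1 - \<xi> (q \<zeta> \<omega> v) \<omega>) else 0))"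
    by (rule back_subst[where P="integrable unif"]) (auto simp: fun_eq_iff Xg_def)
  show ?thesis
    unfolding integral_pay_split[OF g \<xi>A \<zeta>] 1 2 3 X using i1 i2 by simp
qed

lemma Ncirc_eq_J:
  assumes \<xi>: "\<xi> \<in> Kc" and \<zeta>: "\<zeta> \<in> K2"
    and eq: "AE \<omega> in M. \<forall>t\<in>tset T. x t \<omega> = \<xi> t \<omega>" "AE \<omega> in M. \<forall>t\<in>tset T. z t \<omega> = \<zeta> t \<omega>"
  shows "Ncirc M T f g h x z = J \<xi> \<zeta>"
proof -
  define n where "n \<omega> = (\<integral>r\<in>below_T T. f (ereal r) \<omega> * (1 - z (ereal r) \<omega>) \<partial>LS T x \<omega>)
    + (\<integral>r\<in>below_T T. g (ereal r) \<omega> * (1 - x (ereal r) \<omega>) \<partial>LS T z \<omega>)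
    + (\<Sum>\<^sub>\<infinity>t\<in>tset T. h t \<omega> * jump x t \<omega> * jump z t \<omega>)" for \<omega>
  have ae: "AE \<omega> in M. (\<integral>v. pay \<xi> \<zeta> (\<omega>, v) \<partial>unif) = n \<omega>"
    using good_AE eq by eventually_elim (simp add: n_def Ncirc_integrand_eq[OF _ \<xi> \<zeta>])
  have m: "(\<lambda>\<omega>. \<integral>v. pay \<xi> \<zeta> (\<omega>, v) \<partial>unif) \<in> borel_measurable M"
    using P.integrable_fst'[OF pay_integrable[OF Kc_Acirc[OF \<xi>] \<zeta>]] by simp
  have "Ncirc M T f g h x z = (\<integral>\<omega>. n \<omega> \<partial>M)" by (simp add: Ncirc_def n_def)
  \<comment> \<open>\<open>n\<close> is not known to be measurable in advance; completeness supplies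
    this.\<close>
  also have "\<dots> = (\<integral>\<omega>. (\<integral>v. pay \<xi> \<zeta> (\<omega>, v) \<partial>unif) \<partial>M)"
    using ae by (intro integral_cong_AE measurable_AE_eq_complete[OF complete m ae] m) auto
  finally show ?thesis using J_eq[OF Kc_Acirc[OF \<xi>] \<zeta>] by simp
qed

text \<open>\<open>repr\<close> chooses among all controls in \<open>Acirc\<close>, so its value
  need not lie in \<open>Kc\<close>; it agrees almost surely at all times with the given \<xi>,
  which does.\<close>

lemma Npay_eq_J:
  assumes \<xi>: "\<xi> \<in> Kc" "ae_equal M T x \<xi>" and \<zeta>: "\<zeta> \<in> K2" "ae_equal M T z \<zeta>"
  shows "Npay M T F1 F2 f g h x z = J \<xi> \<zeta>"
proof -
  have 1: "repr M T F1 x \<in> Acirc M T F1 \<and> ae_equal M T x (repr M T F1 x)"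
    unfolding repr_def using someI_ex[of "\<lambda>\<sigma>. \<sigma> \<in> Acirc M T F1 \<and> ae_equal M T x \<sigma>"] \<xi> Kc_Acirc by blast
  have 2: "repr M T F2 z \<in> K2 \<and> ae_equal M T z (repr M T F2 z)"
    unfolding repr_def using someI_ex[of "\<lambda>\<sigma>. \<sigma> \<in> Acirc M T F2 \<and> ae_equal M T z \<sigma>"] \<zeta> by blast
  show ?thesis unfolding Npay_def
    using indistinguishable[OF prob_space_axioms T _ Kc_Acirc[OF \<xi>(1)] filF1 filF1 _ \<xi>(2)] 1
      indistinguishable[OF prob_space_axioms T _ \<zeta>(1) filF2 filF2 _ \<zeta>(2)] 2
    by (intro Ncirc_eq_J \<xi> \<zeta>) auto
qed

end

section \<open>Spreading an initial jump over a short interval\<close>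

lemma abs_cont_on_dominated:
  assumes u: "abs_cont_on S u" and v: "abs_cont_on S v"
    and le: "\<And>a b. a \<in> S \<Longrightarrow> b \<in> S \<Longrightarrow> \<bar>y b - y a\<bar> \<le> \<bar>u b - u a\<bar> + \<bar>v b - v a\<bar>"
  shows "abs_cont_on S y"
  unfolding abs_cont_on_def
proof (intro allI impI)
  fix e :: real assume "e > 0"
  then have e2: "e / 2 > 0" by simp
  obtain d1 where d1: "d1 > 0" and D1: "\<And>(n::nat) a b.
      (\<forall>i<n. a i \<in> S \<and> b i \<in> S \<and> a i \<le> b i) \<and> (\<forall>i<n. \<forall>j<n. i \<noteq> j \<longrightarrow> b i \<le> a j \<or> b j \<le> a i) \<and>
      (\<Sum>i<n. b i - a i) < d1 \<longrightarrow> (\<Sum>i<n. \<bar>u (b i) - u (a i)\<bar>) < e / 2"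
    using u[unfolded abs_cont_on_def, rule_format, OF e2] by auto
  obtain d2 where d2: "d2 > 0" and D2: "\<And>(n::nat) a b.
      (\<forall>i<n. a i \<in> S \<and> b i \<in> S \<and> a i \<le> b i) \<and> (\<forall>i<n. \<forall>j<n. i \<noteq> j \<longrightarrow> b i \<le> a j \<or> b j \<le> a i) \<and>
      (\<Sum>i<n. b i - a i) < d2 \<longrightarrow> (\<Sum>i<n. \<bar>v (b i) - v (a i)\<bar>) < e / 2"
    using v[unfolded abs_cont_on_def, rule_format, OF e2] by auto
  show "\<exists>d>0. \<forall>n::nat. \<forall>a b. (\<forall>i<n. a i \<in> S \<and> b i \<in> S \<and> a i \<le> b i) \<and>
      (\<forall>i<n. \<forall>j<n. i \<noteq> j \<longrightarrow> b i \<le> a j \<or> b j \<le> a i) \<and>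
      (\<Sum>i<n. b i - a i) < d \<longrightarrow> (\<Sum>i<n. \<bar>y (b i) - y (a i)\<bar>) < e"
  proof (intro exI[of _ "min d1 d2"] conjI allI impI)
    fix n :: nat and a b assume H: "(\<forall>i<n. a i \<in> S \<and> b i \<in> S \<and> a i \<le> b i) \<and>
      (\<forall>i<n. \<forall>j<n. i \<noteq> j \<longrightarrow> b i \<le> a j \<or> b j \<le> a i) \<and> (\<Sum>i<n. b i - a i) < min d1 d2"
    have "(\<Sum>i<n. \<bar>y (b i) - y (a i)\<bar>) \<le> (\<Sum>i<n. \<bar>u (b i) - u (a i)\<bar> + \<bar>v (b i) - v (a i)\<bar>)"
      using H by (intro sum_mono le) auto
    also have "\<dots> = (\<Sum>i<n. \<bar>u (b i) - u (a i)\<bar>) + (\<Sum>i<n. \<bar>v (b i) - v (a i)\<bar>)" by (rule sum.distrib)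
    also have "\<dots> < e / 2 + e / 2" using D1[of n a b] D2[of n a b] H by (intro add_strict_mono) auto
    finally show "(\<Sum>i<n. \<bar>y (b i) - y (a i)\<bar>) < e" by simp
  qed (use d1 d2 in auto)
qed

lemma abs_cont_on_linear:
  assumes "0 < k" shows "abs_cont_on S (\<lambda>x. k * x)"
  unfolding abs_cont_on_def
proof (intro allI impI)
  fix e :: real assume "e > 0"
  show "\<exists>d>0. \<forall>n::nat. \<forall>a b. (\<forall>i<n. a i \<in> S \<and> b i \<in> S \<and> a i \<le> b i) \<and>
      (\<forall>i<n. \<forall>j<n. i \<noteq> j \<longrightarrow> b i \<le> a j \<or> b j \<le> a i) \<and>
      (\<Sum>i<n. b i - a i) < d \<longrightarrow> (\<Sum>i<n. \<bar>k * b i - k * a i\<bar>) < e"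
  proof (intro exI[of _ "e / k"] conjI allI impI)
    fix n :: nat and a b :: "nat \<Rightarrow> real" assume H: "(\<forall>i<n. a i \<in> S \<and> b i \<in> S \<and> a i \<le> b i) \<and>
      (\<forall>i<n. \<forall>j<n. i \<noteq> j \<longrightarrow> b i \<le> a j \<or> b j \<le> a i) \<and> (\<Sum>i<n. b i - a i) < e / k"
    have "(\<Sum>i<n. \<bar>k * b i - k * a i\<bar>) = (\<Sum>i<n. k * (b i - a i))"
      using H assms by (intro sum.cong) (auto simp: right_diff_distrib[symmetric] abs_mult)
    also have "\<dots> < e" using H assms by (simp add: sum_distrib_left[symmetric] pos_less_divide_eq mult.commute)
    finally show "(\<Sum>i<n. \<bar>k * b i - k * a i\<bar>) < e" .
  qed (use assms \<open>e > 0\<close> in auto)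
qed

text \<open>A continuous deterministic clock running from 0 to 1 during \<open>[0, 1/k]\<close> and
  staying at 1 up to time \<infinity>. The minimum is taken in the extended reals to cover that
  point.\<close>

definition ramp :: "real \<Rightarrow> ereal \<Rightarrow> real" where
  "ramp k t = real_of_ereal (min 1 (ereal k * t))"

lemma ramp_ereal: "0 < k \<Longrightarrow> ramp k (ereal r) = min 1 (k * r)"
  by (simp add: ramp_def min_def one_ereal_def)

lemma ramp_infty: "0 < k \<Longrightarrow> ramp k \<infinity> = 1"
  by (simp add: ramp_def)

lemma ramp_0: "ramp k 0 = 0"
  by (simp add: ramp_def)

lemma ramp_eq_1: "0 < k \<Longrightarrow> ereal (1 / k) \<le> t \<Longrightarrow> ramp k t = 1"
  by (cases t) (auto simp: ramp_ereal ramp_infty field_simps)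

lemma ramp_bounds: "0 < k \<Longrightarrow> 0 \<le> t \<Longrightarrow> 0 \<le> ramp k t \<and> ramp k t \<le> 1"
  by (cases t) (auto simp: ramp_ereal ramp_infty)

lemma ramp_mono: "0 < k \<Longrightarrow> 0 \<le> s \<Longrightarrow> s \<le> t \<Longrightarrow> ramp k s \<le> ramp k t"
  by (cases s; cases t) (auto simp: ramp_ereal ramp_infty intro: min.coboundedI2 mult_left_mono)

lemma cadlag_ramp:
  assumes k: "0 < k" shows "cadlag_path T (\<lambda>t. ramp k t - 1)"
proof -
  have *: "((\<lambda>t. ramp k t - 1) \<longlongrightarrow> ramp k t - 1) (at t within A)" if "0 \<le> t" for t A
  proof (intro tendsto_intros)
    have "((\<lambda>s. min 1 (ereal k * s)) \<longlongrightarrow> min 1 (ereal k * t)) (at t within A)"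
      by (intro tendsto_min tendsto_const tendsto_cmult_ereal tendsto_ident_at) auto
    moreover have "min 1 (ereal k * t) = ereal (ramp k t)"
      using that k by (cases t) (auto simp: ramp_ereal ramp_infty min_def one_ereal_def)
    ultimately have "((\<lambda>s. min 1 (ereal k * s)) \<longlongrightarrow> ereal (ramp k t)) (at t within A)" by (simp only:)
    from lim_real_of_ereal[OF this] show "((\<lambda>s. ramp k s) \<longlongrightarrow> ramp k t) (at t within A)"
      by (simp only: ramp_def[symmetric])
  qed
  have r: "((\<lambda>t. ramp k t - 1) \<longlongrightarrow> ramp k t - 1) (at_right t)"
    and l: "\<exists>l. ((\<lambda>t. ramp k t - 1) \<longlongrightarrow> l) (at_left t)" if "t \<in> tset T" for t
    using * that unfolding tset_iff by metis+
  show ?thesis unfolding cadlag_path_def by (intro conjI ballI impI) (erule r l)+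
qed

context dynkin_game
begin

text \<open>The mass \<open>\<xi> 0 \<omega>\<close> is taken from time 0 and released uniformly
  over \<open>[0, 1/k]\<close>. The correction is known at time 0 and vanishes from
  \<open>1/k\<close> on.\<close>

definition spread :: "real \<Rightarrow> (ereal \<Rightarrow> 'a \<Rightarrow> real) \<Rightarrow> ereal \<Rightarrow> 'a \<Rightarrow> real" where
  "spread k \<xi> t \<omega> = \<xi> t \<omega> + \<xi> 0 \<omega> * (ramp k t - 1)"

lemma spread_Acirc_ac:
  assumes \<xi>: "\<xi> \<in> Acirc_ac M T F1" and k: "0 < k" "ereal (1 / k) \<le> T"
  shows "spread k \<xi> \<in> Acirc_ac M T F1"
proof -
  have \<xi>A: "\<xi> \<in> Acirc M T F1" using \<xi> by (simp add: Acirc_ac_def)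
  have "adapted T F1 (spread k \<xi>)"
    unfolding adapted_def
  proof
    fix t assume t: "t \<in> tset T"
    have "sets (F1 0) \<subseteq> sets (F1 t)" "space (F1 0) = space (F1 t)"
      using filF1 t T0 unfolding is_filtration_def by (auto simp: tset_iff)
    moreover have "\<xi> 0 \<in> borel_measurable (F1 0)" "\<xi> t \<in> borel_measurable (F1 t)"
      using \<xi>A t T0 by (auto simp: Acirc_def adapted_def tset_iff)
    ultimately have "\<xi> 0 \<in> borel_measurable (F1 t)" "\<xi> t \<in> borel_measurable (F1 t)"
      by (auto simp: measurable_def)
    then show "spread k \<xi> t \<in> borel_measurable (F1 t)" unfolding spread_def by measurable
  qed
  moreover have "cadlag_path T (\<lambda>t. spread k \<xi> t \<omega>) \<and> mono_on (tset T) (\<lambda>t. spread k \<xi> t \<omega>) \<and>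
      0 \<le> spread k \<xi> 0 \<omega> \<and> spread k \<xi> T \<omega> = 1 \<and> abs_cont_on (below_T T) (\<lambda>x. spread k \<xi> (ereal x) \<omega>)"
    if \<omega>: "\<omega> \<in> space M" for \<omega>
  proof (intro conjI)
    note d = Acirc_dpath[OF \<xi>A \<omega>]
    have c: "0 \<le> \<xi> 0 \<omega>" "\<xi> 0 \<omega> \<le> 1" using dpath_nonneg[OF d, of 0] dpath_le_1[OF d, of 0] T0 by auto
    show "cadlag_path T (\<lambda>t. spread k \<xi> t \<omega>)"
      using cadlag_path_lincomb[of T "\<lambda>t. \<xi> t \<omega>" "\<lambda>t. ramp k t - 1" 1 "\<xi> 0 \<omega>"] d cadlag_ramp[OF k(1)]
      by (simp add: spread_def dpath_def)
    show "mono_on (tset T) (\<lambda>t. spread k \<xi> t \<omega>)"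
      using dpath_mono[OF d] ramp_mono[OF k(1)] c unfolding spread_def
      by (intro mono_onI add_mono mult_left_mono) (auto simp: tset_iff)
    show "0 \<le> spread k \<xi> 0 \<omega>" by (simp add: spread_def ramp_0)
    show "spread k \<xi> T \<omega> = 1" using d by (simp add: spread_def ramp_eq_1[OF k] dpath_def)
    show "abs_cont_on (below_T T) (\<lambda>x. spread k \<xi> (ereal x) \<omega>)"
    proof (rule abs_cont_on_dominated[OF _ abs_cont_on_linear[OF k(1)]])
      show "abs_cont_on (below_T T) (\<lambda>x. \<xi> (ereal x) \<omega>)" using \<xi> \<omega> by (simp add: Acirc_ac_def)
      fix a b :: real
      \<comment> \<open>The ramp is Lipschitz with constant \<open>k\<close>, and scaling by
        \<open>\<xi> 0 \<omega> \<le> 1\<close> preserves this.\<close>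
      have "\<bar>ramp k (ereal b) - ramp k (ereal a)\<bar> \<le> \<bar>k * b - k * a\<bar>"
        by (simp add: ramp_ereal[OF k(1)] min_def)
      then have "\<bar>\<xi> 0 \<omega> * (ramp k (ereal b) - ramp k (ereal a))\<bar> \<le> \<bar>k * b - k * a\<bar>"
        using abs_mult_le[of "ramp k (ereal b) - ramp k (ereal a)" "\<bar>k * b - k * a\<bar>" "\<xi> 0 \<omega>"] c
        by (simp add: mult.commute)
      moreover have "spread k \<xi> (ereal b) \<omega> - spread k \<xi> (ereal a) \<omega> =
          (\<xi> (ereal b) \<omega> - \<xi> (ereal a) \<omega>) + \<xi> 0 \<omega> * (ramp k (ereal b) - ramp k (ereal a))"
        by (simp add: spread_def algebra_simps)
      ultimately show "\<bar>spread k \<xi> (ereal b) \<omega> - spread k \<xi> (ereal a) \<omega>\<bar>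
          \<le> \<bar>\<xi> (ereal b) \<omega> - \<xi> (ereal a) \<omega>\<bar> + \<bar>k * b - k * a\<bar>" by linarith
    qed
  qed
  ultimately show ?thesis by (auto simp: Acirc_ac_def Acirc_def)
qed

lemma spread_0: "spread k \<xi> 0 \<omega> = 0" by (simp add: spread_def ramp_0)

lemma spread_eq: "0 < k \<Longrightarrow> ereal (1 / k) \<le> t \<Longrightarrow> spread k \<xi> t \<omega> = \<xi> t \<omega>"
  by (simp add: spread_def ramp_eq_1)

lemma Yf_right_cont:
  assumes "\<zeta> \<in> Acirc M T G" "\<omega> \<in> space M" "0 \<le> t" "t < T"
  shows "((\<lambda>s. Yf \<zeta> s \<omega>) \<longlongrightarrow> Yf \<zeta> t \<omega>) (at_right t)"
proof -
  have "((\<lambda>s. f s \<omega> * (1 - \<zeta> s \<omega>)) \<longlongrightarrow> f t \<omega> * (1 - \<zeta> t \<omega>)) (at_right t)"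
    using cadlag_path_right[of T "\<lambda>s. f s \<omega>" t] cadlag_path_right[of T "\<lambda>s. \<zeta> s \<omega>" t] assms f_Lb
    by (intro tendsto_intros) (auto simp: Lb_def Acirc_def)
  moreover have "\<forall>\<^sub>F s in at_right t. f s \<omega> * (1 - \<zeta> s \<omega>) = Yf \<zeta> s \<omega>"
    unfolding eventually_at_right[OF assms(4)] using assms(4) by (intro exI[of _ T]) (auto simp: Yf_def)
  ultimately have "((\<lambda>s. Yf \<zeta> s \<omega>) \<longlongrightarrow> f t \<omega> * (1 - \<zeta> t \<omega>)) (at_right t)"
    by (rule Lim_transform_eventually)
  then show ?thesis using assms(4) by (simp add: Yf_def)
qed

lemma lft_spread_T:
  assumes \<xi>: "\<xi> \<in> Acirc M T F1" and \<omega>: "\<omega> \<in> space M" and k: "0 < k" "ereal (1 / k) < T"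
  shows "lft (\<lambda>s. spread k \<xi> s \<omega>) T = lft (\<lambda>s. \<xi> s \<omega>) T"
proof -
  have "((\<lambda>s. \<xi> s \<omega>) \<longlongrightarrow> lft (\<lambda>s. \<xi> s \<omega>) T) (at_left T)"
    using dpath_left_tendsto[OF Acirc_dpath[OF \<xi> \<omega>] T] by simp
  then have "((\<lambda>s. spread k \<xi> s \<omega>) \<longlongrightarrow> lft (\<lambda>s. \<xi> s \<omega>) T) (at_left T)"
    by (rule Lim_transform_eventually)
      (use k in \<open>auto simp: eventually_at_left[OF T] spread_eq intro!: exI[of _ "ereal (1 / k)"]\<close>)
  from tendsto_Lim[OF at_left_ereal_neq_bot[OF T] this] show ?thesis using T by (simp add: lft_def)
qed

text \<open>As the spreading interval shrinks, the first term does not change in the limit, since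
  quantile times are moved to the right by at most \<open>1/k\<close> and the integrand is right
  continuous. At time 0 the joint jump worth \<open>h 0\<close> disappears and \<zeta> collects
  \<open>g 0\<close> on the same mass; as \<open>g \<le> h\<close>, this favours the
  minimiser.\<close>

lemma J_spread_le:
  assumes \<xi>: "\<xi> \<in> Acirc_ac M T F1" and \<zeta>: "\<zeta> \<in> K2" and e: "0 < e"
  obtains \<xi>' where "\<xi>' \<in> Acirc_ac M T F1" "\<forall>\<omega>\<in>space M. \<xi>' 0 \<omega> = 0" "J \<xi>' \<zeta> < J \<xi> \<zeta> + e"
proof -
  have \<xi>A: "\<xi> \<in> Acirc M T F1" using \<xi> by (simp add: Acirc_ac_def)
  \<comment> \<open>\<open>T\<close> may be infinite, so a finite \<open>r\<close> below it is
    fixed; the offset \<open>1 / r\<close> keeps every \<open>1 / k n\<close> below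
    \<open>T\<close>.\<close>
  obtain r where r: "0 < r" "ereal r < T" using ereal_dense2[OF T] by auto
  define K0 where "K0 = 1 / r"
  define k where "k n = K0 + real n" for n
  have k: "0 < k n" "ereal (1 / k n) < T" for n
  proof -
    show "0 < k n" using r by (simp add: k_def K0_def add_pos_nonneg)
    have "1 / k n \<le> r" using r by (simp add: k_def K0_def divide_le_eq add_pos_nonneg field_simps)
    then show "ereal (1 / k n) < T" using r by (meson ereal_less_eq(3) le_less_trans)
  qed
  have kinf: "(\<lambda>n. 1 / k n) \<longlonglongrightarrow> 0"
    unfolding k_def
    by (rule tendsto_divide_0[OF tendsto_const filterlim_at_top_imp_at_infinity[
          OF filterlim_tendsto_add_at_top[OF tendsto_const filterlim_real_sequentially]]])
  define S where "S n = spread (k n) \<xi>" for n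
  have S: "S n \<in> Acirc_ac M T F1" "S n \<in> Acirc M T F1" for n
    using spread_Acirc_ac[OF \<xi> k(1) less_imp_le[OF k(2)]] by (auto simp: S_def Acirc_ac_def)
  \<comment> \<open>The limit of the payoffs: the extra term is what \<zeta> gains from its jump at
    0 once \<xi> starts at 0.\<close>
  define L where "L p = Yf \<zeta> (q \<xi> (fst p) (snd p)) (fst p) + Xg \<xi> (q \<zeta> (fst p) (snd p)) (fst p) +
      (if q \<zeta> (fst p) (snd p) \<le> 0 then g 0 (fst p) * \<xi> 0 (fst p) else 0)" for p
  have Lm: "L \<in> borel_measurable (M \<Otimes>\<^sub>M unif)"
  proof -
    have [measurable]: "(\<lambda>p. Yf \<zeta> (q \<xi> (fst p) (snd p)) (fst p)) \<in> borel_measurable (M \<Otimes>\<^sub>M unif)"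
      using q_in[OF \<xi>A]
      by (intro Yf_eval_meas[OF filF2 \<zeta> q_meas[OF filF1 \<xi>A]]) (auto simp: space_pair_measure space_unif)
    have [measurable]: "(\<lambda>p. Xg \<xi> (q \<zeta> (fst p) (snd p)) (fst p)) \<in> borel_measurable (M \<Otimes>\<^sub>M unif)"
      using q_in[OF \<zeta>]
      by (intro Xg_eval_meas[OF filF1 \<xi>A q_meas[OF filF2 \<zeta>]]) (auto simp: space_pair_measure space_unif)
    note [measurable] = q_meas[OF filF2 \<zeta>] measurable_compose[OF measurable_fst g_meas[OF order_refl T0]]
      measurable_compose[OF measurable_fst Acirc_measurable[OF filF1 \<xi>A order_refl T0]]
    show ?thesis unfolding L_def by measurable
  qed
  have pt: "(\<lambda>n. pay (S n) \<zeta> (\<omega>, v)) \<longlonglongrightarrow> L (\<omega>, v)" if \<omega>: "\<omega> \<in> space M" and v: "0 < v" "v < 1" for \<omega> v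
  proof -
    note d = Acirc_dpath[OF \<xi>A \<omega>] and dz = Acirc_dpath[OF \<zeta> \<omega>]
    have dS: "dpath T (\<lambda>t. S n t \<omega>)" for n by (rule Acirc_dpath[OF S(2) \<omega>])
    have ev: "\<forall>\<^sub>F n in sequentially. ereal (1 / k n) < t" if t0: "0 < t" for t
    proof -
      obtain r where r: "0 < r" "ereal r < t" using ereal_dense2[OF t0] by auto
      have "\<forall>\<^sub>F n in sequentially. 1 / k n < r" using order_tendstoD(2)[OF kinf r(1)] .
      then show ?thesis by eventually_elim (use r in \<open>meson ereal_less_eq(3) less_le_trans less_imp_le le_less_trans\<close>)
    qed
    have c: "0 \<le> \<xi> 0 \<omega>" using dpath_nonneg[OF d, of 0] T0 by auto
    have "(\<lambda>n. Yf \<zeta> (q (S n) \<omega> v) \<omega>) \<longlonglongrightarrow> Yf \<zeta> (q \<xi> \<omega> v) \<omega>"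
    proof (cases "v \<le> \<xi> 0 \<omega>")
      case True
      then have q0: "q \<xi> \<omega> v = 0" using qtl_le_iff[OF T d, of v 0] qtl_in_tset[OF T d, of v] v T0 by auto
      \<comment> \<open>These levels belong to the initial jump; after spreading, their quantile
        times are positive and at most \<open>1 / k n\<close>.\<close>
      have up: "q (S n) \<omega> v \<le> ereal (1 / k n)" for n
      proof -
        have "v \<le> \<xi> (ereal (1 / k n)) \<omega>"
          using True dpath_mono[OF d order_refl, of "ereal (1 / k n)"] k[of n] by (auto simp: less_imp_le)
        then show ?thesis
          using qtl_le_iff[OF T dS, of v "ereal (1 / k n)" n] v k[of n]
          by (auto simp: S_def spread_eq less_imp_le)
      qed
      have lo: "0 < q (S n) \<omega> v" for n
        using less_qtl_iff[OF T dS, of v 0 n] v T0 by (simp add: S_def spread_0)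
      have "filterlim (\<lambda>n. q (S n) \<omega> v) (at_right 0) sequentially"
      proof (rule tendsto_imp_filterlim_at_right)
        show "(\<lambda>n. q (S n) \<omega> v) \<longlonglongrightarrow> 0"
        proof (rule tendsto_sandwich[of "\<lambda>_. 0" _ _ "\<lambda>n. ereal (1 / k n)"])
          show "(\<lambda>n. ereal (1 / k n)) \<longlonglongrightarrow> 0" using kinf by (simp add: zero_ereal_def)
        qed (use up lo in \<open>auto simp: less_imp_le\<close>)
      qed (use lo in auto)
      from filterlim_compose[OF Yf_right_cont[OF \<zeta> \<omega> order_refl T] this] show ?thesis by (simp add: q0)
    next
      case False
      \<comment> \<open>Once \<open>1 / k n < s\<close>, this quantile time is unchanged: the spread
        path lies below the original one and agrees with it from \<open>1 / k n\<close> on.\<close>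
      define s where "s = q \<xi> \<omega> v"
      have s: "0 < s" "s \<le> T" using False less_qtl_iff[OF T d, of v 0] qtl_in_tset[OF T d, of v] v T0 by (auto simp: s_def)
      have "\<forall>\<^sub>F n in sequentially. q (S n) \<omega> v = s"
        using ev[OF s(1)]
      proof eventually_elim
        case (elim n)
        have "v \<le> S n s \<omega>" using le_at_qtl[OF T d, of v] v elim k(1)[of n] by (simp add: S_def spread_eq s_def less_imp_le)
        then have "q (S n) \<omega> v \<le> s" using qtl_le_iff[OF T dS, of v s n] v s by auto
        moreover have "s \<le> q (S n) \<omega> v"
        proof -
          let ?t = "q (S n) \<omega> v"
          have t: "0 \<le> ?t" "?t \<le> T" using qtl_in_tset[OF T dS, of v n] v by auto
          have "v \<le> S n ?t \<omega>" using le_at_qtl[OF T dS, of v n] v by auto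
          also have "\<dots> \<le> \<xi> ?t \<omega>"
            using ramp_bounds[OF k(1)[of n] t(1)] c by (simp add: S_def spread_def mult_nonneg_nonpos)
          finally show ?thesis using qtl_le_iff[OF T d, of v ?t] t v by (simp add: s_def)
        qed
        ultimately show ?case by (rule antisym)
      qed
      then show ?thesis by (intro tendsto_eventually) (auto simp: s_def elim!: eventually_mono)
    qed
    moreover have "(\<lambda>n. Xg (S n) (q \<zeta> \<omega> v) \<omega>) \<longlonglongrightarrow> Xg \<xi> (q \<zeta> \<omega> v) \<omega> + (if q \<zeta> \<omega> v \<le> 0 then g 0 \<omega> * \<xi> 0 \<omega> else 0)"
    proof (cases "q \<zeta> \<omega> v \<le> 0")
      case True
      then have "q \<zeta> \<omega> v = 0" using qtl_in_tset[OF T dz, of v] v by auto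
      then show ?thesis using T by (simp add: Xg_def S_def spread_0 algebra_simps)
    next
      case False
      then have p: "0 < q \<zeta> \<omega> v" by auto
      have "\<forall>\<^sub>F n in sequentially. Xg (S n) (q \<zeta> \<omega> v) \<omega> = Xg \<xi> (q \<zeta> \<omega> v) \<omega>"
        using ev[OF p] by eventually_elim
          (use k in \<open>auto simp: Xg_def S_def lft_spread_T[OF \<xi>A \<omega>] spread_eq less_imp_le\<close>)
      then show ?thesis using False by (intro tendsto_eventually) simp
    qed
    ultimately have "(\<lambda>n. Yf \<zeta> (q (S n) \<omega> v) \<omega> + Xg (S n) (q \<zeta> \<omega> v) \<omega>) \<longlonglongrightarrow> L (\<omega>, v)"
      unfolding L_def fst_conv snd_conv add.assoc by (intro tendsto_add)
    then show ?thesis by (simp add: pay_def S_def spread_0)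
  qed
  have ae: "AE p in M \<Otimes>\<^sub>M unif. (\<lambda>n. pay (S n) \<zeta> p) \<longlonglongrightarrow> L p"
    using pt by (intro AE_I2) (auto simp: space_pair_measure space_unif)
  have Li: "integrable (M \<Otimes>\<^sub>M unif) L" and lim: "(\<lambda>n. J (S n) \<zeta>) \<longlonglongrightarrow> (\<integral>p. L p \<partial>(M \<Otimes>\<^sub>M unif))"
    unfolding J_def
    using integrable_dominated_convergence[OF Lm pay_meas[OF S(2) \<zeta>] dom_fst_integrable ae]
      integral_dominated_convergence[OF Lm pay_meas[OF S(2) \<zeta>] dom_fst_integrable ae] pay_dom[OF S(2) \<zeta>]
    by auto
  have "(\<integral>p. L p \<partial>(M \<Otimes>\<^sub>M unif)) = (\<integral>\<omega>. (\<integral>v. L (\<omega>, v) \<partial>unif) \<partial>M)"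
    using P.integral_fst'[OF Li] by simp
  also have "\<dots> \<le> (\<integral>\<omega>. (\<integral>v. pay \<xi> \<zeta> (\<omega>, v) \<partial>unif) \<partial>M)"
  proof (rule integral_mono_AE[OF P.integrable_fst'[OF Li] P.integrable_fst'[OF pay_integrable[OF \<xi>A \<zeta>]]])
    show "AE \<omega> in M. (\<integral>v. L (\<omega>, v) \<partial>unif) \<le> (\<integral>v. pay \<xi> \<zeta> (\<omega>, v) \<partial>unif)"
      using good_AE
    proof eventually_elim
      case (elim \<omega>)
      then have \<omega>: "\<omega> \<in> space M" by (simp add: good_def)
      note d = Acirc_dpath[OF \<xi>A \<omega>] and dz = Acirc_dpath[OF \<zeta> \<omega>]
      note [measurable] = measurable_qtl_unif[OF T dz]
      let ?c = "g 0 \<omega> * \<xi> 0 \<omega>"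
      let ?A = "{v \<in> {0<..<1}. q \<zeta> \<omega> v \<le> 0}"
      have A: "?A \<in> sets unif"
      proof -
        have "{v \<in> space unif. q \<zeta> \<omega> v \<le> 0} \<in> sets unif" by measurable
        then show ?thesis by (simp add: space_unif)
      qed
      have mA: "measure unif ?A = \<zeta> 0 \<omega>"
        using emeasure_qtl_atMost[OF T dz order_refl T0] dpath_nonneg[OF dz order_refl T0] by (simp add: measure_def)
      have i3: "integrable unif (\<lambda>v. if q \<zeta> \<omega> v \<le> 0 then ?c else 0)"
        by (rule U.integrable_const_bound[where B="\<bar>?c\<bar>"]) auto
      have "(\<integral>v. (if q \<zeta> \<omega> v \<le> 0 then ?c else 0) \<partial>unif) = (\<integral>v. ?c * indicator ?A v \<partial>unif)"
        by (intro Bochner_Integration.integral_cong) (auto simp: space_unif)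
      also have "\<dots> = ?c * \<zeta> 0 \<omega>" using A mA by simp
      finally have "(\<integral>v. L (\<omega>, v) \<partial>unif) = (\<integral>v. Yf \<zeta> (q \<xi> \<omega> v) \<omega> \<partial>unif) + (\<integral>v. Xg \<xi> (q \<zeta> \<omega> v) \<omega> \<partial>unif)
          + ?c * \<zeta> 0 \<omega>"
        using Yf_q_integrable[OF elim \<xi>A filF2 \<zeta>] Xg_q_integrable[OF elim \<zeta> filF1 \<xi>A] i3
        unfolding L_def fst_conv snd_conv by simp
      moreover have "?c * \<zeta> 0 \<omega> \<le> h 0 \<omega> * \<xi> 0 \<omega> * \<zeta> 0 \<omega>"
        using goodD(4)[OF elim order_refl T0] dpath_nonneg[OF dz order_refl T0] dpath_nonneg[OF d order_refl T0]
        by (intro mult_right_mono) auto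
      ultimately show ?case unfolding integral_pay_split[OF elim \<xi>A \<zeta>] by simp
    qed
  qed
  also have "\<dots> = J \<xi> \<zeta>" using J_eq[OF \<xi>A \<zeta>] by simp
  also have "\<dots> < J \<xi> \<zeta> + e" using e by simp
  finally have "\<forall>\<^sub>F n in sequentially. J (S n) \<zeta> < J \<xi> \<zeta> + e" using order_tendstoD(2)[OF lim] by auto
  then obtain n where "J (S n) \<zeta> < J \<xi> \<zeta> + e" by (auto simp: eventually_sequentially)
  then show thesis using that[of "S n"] S(1)[of n] by (auto simp: S_def spread_0)
qed

end

section \<open>Predictability and regularity\<close>

context
  fixes M :: "'a measure" and T :: ereal and F :: "ereal \<Rightarrow> 'a measure"
  assumes T: "0 < T" and fil: "is_filtration M T F"
begin

abbreviation (input) "PS \<equiv> predictable_sigma M T F"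

lemma fil_space: "t \<in> tset T \<Longrightarrow> space (F t) = space M"
  and fil_sets: "t \<in> tset T \<Longrightarrow> A \<in> sets (F t) \<Longrightarrow> A \<in> sets M"
  and fil_mono: "s \<in> tset T \<Longrightarrow> t \<in> tset T \<Longrightarrow> s \<le> t \<Longrightarrow> A \<in> sets (F s) \<Longrightarrow> A \<in> sets (F t)"
  using fil unfolding is_filtration_def by blast+

lemma zero_tset: "0 \<in> tset T" and T_tset: "T \<in> tset T"
  using T by (auto simp: tset_iff)

lemma fil_subset: "t \<in> tset T \<Longrightarrow> A \<in> sets (F t) \<Longrightarrow> A \<subseteq> space M"
  using fil_space sets.sets_into_space by blast

lemma predictable_gen_Pow:
  "{{0} \<times> A | A. A \<in> sets (F 0)} \<union>
      {{s<..t} \<times> A | s t A. s \<in> tset T \<and> t \<in> tset T \<and> s \<le> t \<and> A \<in> sets (F s)} \<subseteq> Pow (tset T \<times> space M)"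
  using fil_subset zero_tset by (fastforce simp: tset_iff)

lemma space_predictable: "space PS = tset T \<times> space M"
  unfolding predictable_sigma_def by (rule space_measure_of[OF predictable_gen_Pow])

lemma sets_predictable: "sets PS = sigma_sets (tset T \<times> space M) ({{0} \<times> A | A. A \<in> sets (F 0)} \<union>
      {{s<..t} \<times> A | s t A. s \<in> tset T \<and> t \<in> tset T \<and> s \<le> t \<and> A \<in> sets (F s)})"
  unfolding predictable_sigma_def by (rule sets_measure_of[OF predictable_gen_Pow])

lemma predictable_zero: "A \<in> sets (F 0) \<Longrightarrow> {0} \<times> A \<in> sets PS"
  unfolding sets_predictable by (rule sigma_sets.Basic) blast

lemma predictable_interval:
  "s \<in> tset T \<Longrightarrow> t \<in> tset T \<Longrightarrow> s \<le> t \<Longrightarrow> A \<in> sets (F s) \<Longrightarrow> {s<..t} \<times> A \<in> sets PS"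
  unfolding sets_predictable by (rule sigma_sets.Basic) blast

lemma predictable_const: "A \<in> sets (F 0) \<Longrightarrow> tset T \<times> A \<in> sets PS"
proof -
  assume A: "A \<in> sets (F 0)"
  have "tset T \<times> A = {0} \<times> A \<union> {0<..T} \<times> A" using T by (auto simp: tset_iff)
  then show ?thesis using predictable_zero[OF A] predictable_interval[OF zero_tset T_tset _ A] T by auto
qed

text \<open>A rational strictly between \<open>\<tau> \<omega>\<close> and \<open>t\<close> exhibits
  the set as a countable union of left-open rectangles. The hypothesis \<open>B\<close> says that
  \<open>Q\<close> belongs to the sigma-algebra at time \<tau>.\<close>

lemma predictable_after_event:
  assumes B: "\<And>r. r \<in> tset T \<Longrightarrow> {\<omega> \<in> space M. \<tau> \<omega> \<le> r \<and> Q \<omega>} \<in> sets (F r)" and \<tau>: "\<And>\<omega>. \<omega> \<in> space M \<Longrightarrow> \<tau> \<omega> \<in> tset T"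
  shows "{(t, \<omega>) \<in> tset T \<times> space M. \<tau> \<omega> < t \<and> Q \<omega>} \<in> sets PS"
proof -
  let ?I = "{r. ereal (real_of_rat r) \<in> tset T}"
  have "{(t, \<omega>) \<in> tset T \<times> space M. \<tau> \<omega> < t \<and> Q \<omega>} =
    (\<Union>r\<in>?I. {ereal (of_rat r)<..T} \<times> {\<omega> \<in> space M. \<tau> \<omega> \<le> ereal (of_rat r) \<and> Q \<omega>})"
  proof (intro equalityI subsetI)
    fix p assume "p \<in> {(t, \<omega>) \<in> tset T \<times> space M. \<tau> \<omega> < t \<and> Q \<omega>}"
    then obtain t \<omega> where p: "p = (t, \<omega>)" "t \<in> tset T" "\<omega> \<in> space M" "\<tau> \<omega> < t" "Q \<omega>" by auto
    obtain r where r: "\<tau> \<omega> < ereal (real_of_rat r)" "ereal (real_of_rat r) < t" using ereal_dense3[OF p(4)] by auto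
    have "0 \<le> \<tau> \<omega>" "t \<le> T" using \<tau>[OF p(3)] p(2) by (auto simp: tset_iff)
    then have "ereal (of_rat r) \<in> tset T" unfolding tset_iff using r
      by (meson le_less_trans less_imp_le less_le_trans)
    then show "p \<in> (\<Union>r\<in>?I. {ereal (of_rat r)<..T} \<times> {\<omega> \<in> space M. \<tau> \<omega> \<le> ereal (of_rat r) \<and> Q \<omega>})"
      using r p \<open>t \<le> T\<close> by (intro UN_I[of r]) (auto simp: less_imp_le)
  next
    fix p assume "p \<in> (\<Union>r\<in>?I. {ereal (of_rat r)<..T} \<times> {\<omega> \<in> space M. \<tau> \<omega> \<le> ereal (of_rat r) \<and> Q \<omega>})"
    then obtain r where r: "ereal (real_of_rat r) \<in> tset T" "ereal (of_rat r) < fst p" "fst p \<le> T"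
       "snd p \<in> space M" "\<tau> (snd p) \<le> ereal (of_rat r)" "Q (snd p)" by auto
    then have "\<tau> (snd p) < fst p" by (meson le_less_trans)
    moreover have "fst p \<in> tset T" using r unfolding tset_iff by (meson le_less_trans less_imp_le)
    ultimately show "p \<in> {(t, \<omega>) \<in> tset T \<times> space M. \<tau> \<omega> < t \<and> Q \<omega>}" using r by (auto simp: case_prod_beta)
  qed
  also have "\<dots> \<in> sets PS"
  proof (rule sets.countable_UN'')
    fix r assume "r \<in> ?I"
    then have r: "ereal (of_rat r) \<in> tset T" by simp
    then have "ereal (of_rat r) \<le> T" by (simp add: tset_iff)
    then show "{ereal (of_rat r)<..T} \<times> {\<omega> \<in> space M. \<tau> \<omega> \<le> ereal (of_rat r) \<and> Q \<omega>} \<in> sets PS"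
      by (rule predictable_interval[OF r T_tset _ B[OF r]])
  qed simp
  finally show ?thesis .
qed

lemma predictable_after:
  assumes "stopping_time_on M T F \<tau>"
  shows "{(t, \<omega>) \<in> tset T \<times> space M. \<tau> \<omega> < t} \<in> sets PS"
  using predictable_after_event[of \<tau> "\<lambda>_. True"] assms by (simp add: stopping_time_on_def)

text \<open>Complement of the countably many rectangles up to rational times before
  \<open>T\<close>. A stopping time restricted to an event takes the value \<open>T\<close> off that
  event, which is where this set enters.\<close>

lemma predictable_at_T: "{(t, \<omega>) \<in> tset T \<times> space M. t = T} \<in> sets PS"
proof -
  let ?I = "{r. 0 \<le> ereal (real_of_rat r) \<and> ereal (real_of_rat r) < T}"
  have S: "space M \<in> sets (F t)" if "t \<in> tset T" for t using sets.top[of "F t"] fil_space[OF that] by simp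
  have "{(t, \<omega>) \<in> tset T \<times> space M. t = T} =
    tset T \<times> space M - ({0} \<times> space M \<union> (\<Union>r\<in>?I. {0<..ereal (of_rat r)} \<times> space M))"
  proof (intro equalityI subsetI)
    fix p assume "p \<in> {(t, \<omega>) \<in> tset T \<times> space M. t = T}"
    then show "p \<in> tset T \<times> space M - ({0} \<times> space M \<union> (\<Union>r\<in>?I. {0<..ereal (of_rat r)} \<times> space M))"
      using T by auto
  next
    fix p assume p: "p \<in> tset T \<times> space M - ({0} \<times> space M \<union> (\<Union>r\<in>?I. {0<..ereal (of_rat r)} \<times> space M))"
    then have t: "0 < fst p" "fst p \<le> T" "snd p \<in> space M" by (auto simp: tset_iff less_le)
    have "fst p = T"
    proof (rule ccontr)
      assume "fst p \<noteq> T"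
      then have "fst p < T" using t by auto
      from ereal_dense3[OF this] obtain r where r: "fst p < ereal (real_of_rat r)" "ereal (real_of_rat r) < T" by auto
      moreover have "0 \<le> ereal (real_of_rat r)" using t(1) r(1) by (meson less_imp_le less_trans)
      ultimately have "p \<in> (\<Union>r\<in>?I. {0<..ereal (of_rat r)} \<times> space M)"
        using t by (intro UN_I[of r]) (auto simp: mem_Times_iff less_imp_le)
      then show False using p by auto
    qed
    then show "p \<in> {(t, \<omega>) \<in> tset T \<times> space M. t = T}" using t T by (auto simp: case_prod_beta tset_iff)
  qed
  also have "\<dots> \<in> sets PS"
  proof (intro sets.Diff sets.Un sets.countable_UN'')
    show "tset T \<times> space M \<in> sets PS" by (rule predictable_const[OF S[OF zero_tset]])
    show "{0} \<times> space M \<in> sets PS" by (rule predictable_zero[OF S[OF zero_tset]])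
    show "{0<..ereal (of_rat r)} \<times> space M \<in> sets PS" if "r \<in> ?I" for r
      using that by (intro predictable_interval S zero_tset) (auto simp: tset_iff)
  qed auto
  finally show ?thesis .
qed

text \<open>The set version of the fact that a predictable process stopped at \<tau> is adapted;
  sections commute with complements and countable unions, so the generators decide. It makes the
  event that the graph of \<tau> meets \<open>D\<close> known at time \<tau>.\<close>

lemma predictable_stopped:
  assumes D: "D \<in> sets PS" and \<tau>: "stopping_time_on M T F \<tau>" and t: "t \<in> tset T"
  shows "{\<omega> \<in> space M. (min (\<tau> \<omega>) t, \<omega>) \<in> D} \<in> sets (F t)"
proof -
  have le: "{\<omega> \<in> space M. min (\<tau> \<omega>) t \<le> s} \<in> sets (F t)" if s: "s \<in> tset T" for s
  proof (cases "t \<le> s")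
    case True
    then have "{\<omega> \<in> space M. min (\<tau> \<omega>) t \<le> s} = space (F t)" by (auto simp: fil_space[OF t] min_le_iff_disj)
    then show ?thesis by (metis sets.top)
  next
    case False
    then have "{\<omega> \<in> space M. min (\<tau> \<omega>) t \<le> s} = {\<omega> \<in> space M. \<tau> \<omega> \<le> s}" by (auto simp: min_le_iff_disj)
    moreover have "{\<omega> \<in> space M. \<tau> \<omega> \<le> s} \<in> sets (F t)"
      by (rule fil_mono[OF s t]) (use \<tau> s False in \<open>auto simp: stopping_time_on_def\<close>)
    ultimately show ?thesis by simp
  qed
  have gt: "{\<omega> \<in> space M. s < min (\<tau> \<omega>) t} \<in> sets (F t)" if s: "s \<in> tset T" for s
  proof -
    have "{\<omega> \<in> space M. s < min (\<tau> \<omega>) t} = space (F t) - {\<omega> \<in> space M. min (\<tau> \<omega>) t \<le> s}"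
      unfolding fil_space[OF t] not_le[symmetric] by blast
    then show ?thesis using sets.compl_sets[OF le[OF s]] by (simp only:)
  qed
  have pos: "min (\<tau> \<omega>) t \<in> tset T" if "\<omega> \<in> space M" for \<omega>
  proof -
    have "\<tau> \<omega> \<in> tset T" using \<tau> that unfolding stopping_time_on_def by blast
    then show ?thesis using t by (simp add: tset_iff min.coboundedI1)
  qed
  have "D \<in> sigma_sets (tset T \<times> space M) ({{0} \<times> A | A. A \<in> sets (F 0)} \<union>
      {{s<..t} \<times> A | s t A. s \<in> tset T \<and> t \<in> tset T \<and> s \<le> t \<and> A \<in> sets (F s)})"
    using D by (simp only: sets_predictable)
  then show ?thesis
  proof induction
    case (Basic a)
    then consider A where "a = {0} \<times> A" "A \<in> sets (F 0)"
      | s r A where "a = {s<..r} \<times> A" "s \<in> tset T" "r \<in> tset T" "s \<le> r" "A \<in> sets (F s)" by auto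
    then show ?case
    proof cases
      case 1
      have "{\<omega> \<in> space M. (min (\<tau> \<omega>) t, \<omega>) \<in> a} = {\<omega> \<in> space M. min (\<tau> \<omega>) t \<le> 0} \<inter> A"
      proof -
        have "min (\<tau> \<omega>) t = 0 \<longleftrightarrow> min (\<tau> \<omega>) t \<le> 0" if "\<omega> \<in> space M" for \<omega>
          using pos[OF that] unfolding tset_iff by (metis antisym order_refl)
        then show ?thesis unfolding 1(1) using fil_subset[OF zero_tset 1(2)] by blast
      qed
      moreover have "A \<in> sets (F t)" by (rule fil_mono[OF zero_tset t _ 1(2)]) (use t in \<open>simp add: tset_iff\<close>)
      ultimately show ?thesis using le[OF zero_tset] by auto
    next
      case 2
      show ?thesis
      proof (cases "s < t")
        case True
        have "{\<omega> \<in> space M. (min (\<tau> \<omega>) t, \<omega>) \<in> a} =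
           {\<omega> \<in> space M. s < min (\<tau> \<omega>) t} \<inter> {\<omega> \<in> space M. min (\<tau> \<omega>) t \<le> r} \<inter> A"
          using 2 by auto
        then show ?thesis using gt[OF 2(2)] le[OF 2(3)] fil_mono[OF 2(2) t less_imp_le[OF True] 2(5)] by auto
      next
        case False
        \<comment> \<open>For \<open>t \<le> s\<close> the stopped time never exceeds
          \<open>s\<close>, so the section is empty.\<close>
        then have "{\<omega> \<in> space M. (min (\<tau> \<omega>) t, \<omega>) \<in> a} = {}" using 2 by auto
        then show ?thesis by (metis sets.empty_sets)
      qed
    qed
  next
    case Empty then show ?case by simp
  next
    case (Compl a)
    have "{\<omega> \<in> space M. (min (\<tau> \<omega>) t, \<omega>) \<in> tset T \<times> space M - a} = space (F t) - {\<omega> \<in> space M. (min (\<tau> \<omega>) t, \<omega>) \<in> a}"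
      using pos by (auto simp: fil_space[OF t])
    then show ?case using Compl by auto
  next
    case (Union a)
    have "{\<omega> \<in> space M. (min (\<tau> \<omega>) t, \<omega>) \<in> (\<Union>i. a i)} = (\<Union>i. {\<omega> \<in> space M. (min (\<tau> \<omega>) t, \<omega>) \<in> a i})" by auto
    then show ?case using Union by auto
  qed
qed

lemma F_minus_gen_Pow: "sets (F 0) \<union> {A \<inter> {\<omega>\<in>space M. t < \<eta> \<omega>} | A t. t \<in> tset T \<and> A \<in> sets (F t)} \<subseteq> Pow (space M)"
  using fil_subset zero_tset by blast

lemma space_F_minus: "space (F_minus M T F \<eta>) = space M"
  unfolding F_minus_def by (rule space_measure_of[OF F_minus_gen_Pow])

lemma sets_F_minus: "sets (F_minus M T F \<eta>) = sigma_sets (space M) (sets (F 0) \<union> {A \<inter> {\<omega>\<in>space M. t < \<eta> \<omega>} | A t. t \<in> tset T \<and> A \<in> sets (F t)})"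
  unfolding F_minus_def by (rule sets_measure_of[OF F_minus_gen_Pow])

lemma subalgebra_F_minus:
  assumes \<eta>: "stopping_time_on M T F \<eta>" shows "subalgebra M (F_minus M T F \<eta>)"
  unfolding subalgebra_def space_F_minus
proof (intro conjI refl)
  have "sets (F 0) \<union> {A \<inter> {\<omega>\<in>space M. t < \<eta> \<omega>} | A t. t \<in> tset T \<and> A \<in> sets (F t)} \<subseteq> sets M"
  proof -
    have "A \<inter> {\<omega>\<in>space M. t < \<eta> \<omega>} \<in> sets M" if "t \<in> tset T" "A \<in> sets (F t)" for A t
    proof -
      have "{\<omega>\<in>space M. t < \<eta> \<omega>} = space M - {\<omega>\<in>space M. \<eta> \<omega> \<le> t}" by auto
      moreover have "{\<omega>\<in>space M. \<eta> \<omega> \<le> t} \<in> sets M"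
        by (rule fil_sets[OF that(1)]) (use \<eta> that(1) in \<open>simp add: stopping_time_on_def\<close>)
      ultimately have "{\<omega>\<in>space M. t < \<eta> \<omega>} \<in> sets M" by (simp only: sets.Diff sets.top)
      then show ?thesis using fil_sets[OF that] by (rule sets.Int[rotated])
    qed
    moreover have "sets (F 0) \<subseteq> sets M" using fil_sets[OF zero_tset] by blast
    ultimately show ?thesis by blast
  qed
  then show "sets (F_minus M T F \<eta>) \<subseteq> sets M" unfolding sets_F_minus by (rule sets.sigma_sets_subset)
qed

text \<open>Allows predictable factors to be pulled out of the conditional expectation given
  \<open>F_minus\<close>. On generators the preimages reduce to events \<open>t < \<eta>\<close> and
  their complements, and \<open>F_minus\<close> is generated by such events.\<close>

lemma measurable_F_minus_predictable:
  assumes \<eta>: "stopping_time_on M T F \<eta>"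
  shows "(\<lambda>\<omega>. (\<eta> \<omega>, \<omega>)) \<in> F_minus M T F \<eta> \<rightarrow>\<^sub>M PS"
  unfolding predictable_sigma_def
proof (rule measurable_measure_of[OF predictable_gen_Pow])
  let ?N = "F_minus M T F \<eta>"
  have in_tset: "\<eta> \<omega> \<in> tset T" if "\<omega> \<in> space M" for \<omega> using \<eta> that by (simp add: stopping_time_on_def)
  have gt: "A \<inter> {\<omega>\<in>space M. t < \<eta> \<omega>} \<in> sets ?N" if "t \<in> tset T" "A \<in> sets (F t)" for A t
    unfolding sets_F_minus using that by (intro sigma_sets.Basic) blast
  have gt': "{\<omega>\<in>space M. t < \<eta> \<omega>} \<in> sets ?N" if "t \<in> tset T" for t
    using gt[OF that, of "space M"] sets.top[of "F t"] fil_space[OF that] by (simp add: Int_def)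
  have le: "{\<omega>\<in>space M. \<eta> \<omega> \<le> t} \<in> sets ?N" if "t \<in> tset T" for t
  proof -
    have "{\<omega>\<in>space M. \<eta> \<omega> \<le> t} = space ?N - {\<omega>\<in>space M. t < \<eta> \<omega>}" by (auto simp: space_F_minus)
    then show ?thesis using gt'[OF that] by auto
  qed
  show "(\<lambda>\<omega>. (\<eta> \<omega>, \<omega>)) \<in> space ?N \<rightarrow> tset T \<times> space M" using in_tset by (auto simp: space_F_minus)
  fix B assume "B \<in> {{0} \<times> A | A. A \<in> sets (F 0)} \<union>
      {{s<..t} \<times> A | s t A. s \<in> tset T \<and> t \<in> tset T \<and> s \<le> t \<and> A \<in> sets (F s)}"
  then consider A where "B = {0} \<times> A" "A \<in> sets (F 0)"
      | s r A where "B = {s<..r} \<times> A" "s \<in> tset T" "r \<in> tset T" "s \<le> r" "A \<in> sets (F s)" by auto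
  then show "(\<lambda>\<omega>. (\<eta> \<omega>, \<omega>)) -` B \<inter> space ?N \<in> sets ?N"
  proof cases
    case 1
    have "(\<lambda>\<omega>. (\<eta> \<omega>, \<omega>)) -` B \<inter> space ?N = A \<inter> {\<omega>\<in>space M. \<eta> \<omega> \<le> 0}"
    proof -
      have "\<eta> \<omega> = 0 \<longleftrightarrow> \<eta> \<omega> \<le> 0" if "\<omega> \<in> space M" for \<omega>
        using in_tset[OF that] unfolding tset_iff by (metis antisym order_refl)
      then show ?thesis unfolding 1(1) space_F_minus using fil_subset[OF zero_tset 1(2)] by blast
    qed
    moreover have "A \<in> sets ?N" unfolding sets_F_minus using 1 by (intro sigma_sets.Basic) blast
    ultimately show ?thesis using le[OF zero_tset] by auto
  next
    case 2
    have "(\<lambda>\<omega>. (\<eta> \<omega>, \<omega>)) -` B \<inter> space ?N = (A \<inter> {\<omega>\<in>space M. s < \<eta> \<omega>}) \<inter> {\<omega>\<in>space M. \<eta> \<omega> \<le> r}"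
      using 2 by (auto simp: space_F_minus)
    then show ?thesis using gt[OF 2(2,5)] le[OF 2(3)] by auto
  qed
qed

lemma qtl_stopping_time:
  assumes G: "\<And>t A. t \<in> tset T \<Longrightarrow> A \<in> sets (G t) \<Longrightarrow> A \<in> sets (F t)" "\<And>t. t \<in> tset T \<Longrightarrow> space (G t) = space M"
    and \<rho>: "\<rho> \<in> Acirc M T G" and u: "u \<le> 1"
  shows "stopping_time_on M T F (\<lambda>\<omega>. qtl T (\<lambda>t. \<rho> t \<omega>) u)"
  unfolding stopping_time_on_def
proof (intro conjI ballI)
  fix \<omega> assume "\<omega> \<in> space M"
  then show "qtl T (\<lambda>t. \<rho> t \<omega>) u \<in> tset T" using qtl_in_tset[OF T Acirc_dpath[OF \<rho>] u] by (auto simp: tset_iff)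
next
  fix t assume t: "t \<in> tset T"
  have "{\<omega> \<in> space M. qtl T (\<lambda>t. \<rho> t \<omega>) u \<le> t} = {\<omega> \<in> space (G t). u \<le> \<rho> t \<omega>}"
    using qtl_le_iff[OF T Acirc_dpath[OF \<rho>] u] t G(2)[OF t] by (auto simp: tset_iff)
  also have "\<dots> \<in> sets (G t)" using \<rho> t by (auto simp: Acirc_def adapted_def)
  finally show "{\<omega> \<in> space M. qtl T (\<lambda>t. \<rho> t \<omega>) u \<le> t} \<in> sets (F t)" by (rule G(1)[OF t])
qed

text \<open>By \<open>less_lft_iff_qtl\<close> the superlevel sets are countable unions of intervals
  strictly after stopping times, namely the quantile times at rational levels.\<close>

lemma predictable_lft:
  assumes G: "\<And>t A. t \<in> tset T \<Longrightarrow> A \<in> sets (G t) \<Longrightarrow> A \<in> sets (F t)" "\<And>t. t \<in> tset T \<Longrightarrow> space (G t) = space M"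
    and \<rho>: "\<rho> \<in> Acirc M T G"
  shows "(\<lambda>p. lft (\<lambda>s. \<rho> s (snd p)) (fst p)) \<in> borel_measurable PS"
proof (rule borel_measurableI_greater)
  fix u :: real
  show "{p \<in> space PS. u < lft (\<lambda>s. \<rho> s (snd p)) (fst p)} \<in> sets PS"
  proof (cases "0 \<le> u")
    case False
    have "0 \<le> lft (\<lambda>s. \<rho> s (snd p)) (fst p)" if "p \<in> space PS" for p
      using lft_nonneg[OF Acirc_dpath[OF \<rho>], of "snd p" "fst p"] that
      by (auto simp: space_predictable tset_iff)
    then have "{p \<in> space PS. u < lft (\<lambda>s. \<rho> s (snd p)) (fst p)} = space PS" using False by force
    then show ?thesis by simp
  next
    case True
    have "{p \<in> space PS. u < lft (\<lambda>s. \<rho> s (snd p)) (fst p)} =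
      (\<Union>r\<in>{r. u < real_of_rat r \<and> of_rat r \<le> (1::real)}. {(t, \<omega>) \<in> tset T \<times> space M. qtl T (\<lambda>t. \<rho> t \<omega>) (of_rat r) < t})"
      using less_lft_iff_qtl[OF T Acirc_dpath[OF \<rho>] _ _ True] by (auto simp: space_predictable tset_iff)
    also have "\<dots> \<in> sets PS"
    proof (intro sets.countable_UN'' predictable_after)
      fix r assume "r \<in> {r. u < real_of_rat r \<and> of_rat r \<le> (1::real)}"
      then show "stopping_time_on M T F (\<lambda>\<omega>. qtl T (\<lambda>t. \<rho> t \<omega>) (of_rat r))"
        by (intro qtl_stopping_time[OF G \<rho>]) auto
    qed simp
    finally show ?thesis .
  qed
qed

text \<open>The set \<open>D\<close> may only be charged at or after \<open>\<tau>\<close>, so that \<open>D \<inter> [0,\<tau>]\<close> is the part of the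
  graph of \<open>\<tau>\<close> lying in \<open>D\<close>; this makes the restriction of \<open>\<tau>\<close> to that part predictable.\<close>

lemma predictable_time_restriction:
  assumes \<tau>: "stopping_time_on M T F \<tau>" and D: "D \<in> sets PS"
    and after: "\<And>t \<omega>. (t, \<omega>) \<in> D \<Longrightarrow> \<tau> \<omega> \<le> t"
  shows "predictable_time M T F (\<lambda>\<omega>. if (\<tau> \<omega>, \<omega>) \<in> D then \<tau> \<omega> else T)"
    (is "predictable_time M T F ?\<eta>")
proof -
  have \<tau>t: "\<tau> \<omega> \<in> tset T" if "\<omega> \<in> space M" for \<omega> using \<tau> that by (simp add: stopping_time_on_def)
  have B: "{\<omega> \<in> space M. \<tau> \<omega> \<le> r \<and> (\<tau> \<omega>, \<omega>) \<in> D} \<in> sets (F r)" if r: "r \<in> tset T" for r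
  proof -
    have "{\<omega> \<in> space M. \<tau> \<omega> \<le> r \<and> (\<tau> \<omega>, \<omega>) \<in> D} =
      {\<omega> \<in> space M. \<tau> \<omega> \<le> r} \<inter> {\<omega> \<in> space M. (min (\<tau> \<omega>) r, \<omega>) \<in> D}" by (auto simp: min_absorb1)
    then show ?thesis using predictable_stopped[OF D \<tau> r] \<tau> r by (auto simp: stopping_time_on_def)
  qed
  have "stopping_time_on M T F ?\<eta>"
    unfolding stopping_time_on_def
  proof (intro conjI ballI)
    fix t assume t: "t \<in> tset T"
    show "{\<omega> \<in> space M. ?\<eta> \<omega> \<le> t} \<in> sets (F t)"
    proof (cases "t = T")
      case True
      then have "{\<omega> \<in> space M. ?\<eta> \<omega> \<le> t} = space (F t)"
        using \<tau>t fil_space[OF T_tset] by (auto simp: tset_iff)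
      then show ?thesis by (metis sets.top)
    next
      case False
      then have "\<not> T \<le> t" using t by (auto simp: tset_iff)
      then have "{\<omega> \<in> space M. ?\<eta> \<omega> \<le> t} = {\<omega> \<in> space M. \<tau> \<omega> \<le> t \<and> (\<tau> \<omega>, \<omega>) \<in> D}" by auto
      then show ?thesis using B[OF t] by simp
    qed
  qed (use \<tau>t T_tset in auto)
  moreover have "{(t, \<omega>) \<in> tset T \<times> space M. ?\<eta> \<omega> \<le> t} \<in> sets PS"
  proof -
    have Dsub: "D \<subseteq> tset T \<times> space M" using sets.sets_into_space[OF D] by (simp add: space_predictable)
    \<comment> \<open>Besides the time \<open>T\<close>, the set consists of the part of the graph
      of \<tau> in \<open>D\<close>, isolated by removing everything after \<tau>, and of the points
      strictly after that part.\<close>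
    have "{(t, \<omega>) \<in> tset T \<times> space M. ?\<eta> \<omega> \<le> t} = {(t, \<omega>) \<in> tset T \<times> space M. t = T} \<union>
      (D - {(t, \<omega>) \<in> tset T \<times> space M. \<tau> \<omega> < t}) \<union> {(t, \<omega>) \<in> tset T \<times> space M. \<tau> \<omega> < t \<and> (\<tau> \<omega>, \<omega>) \<in> D}"
    proof (intro equalityI subsetI)
      fix p assume "p \<in> {(t, \<omega>) \<in> tset T \<times> space M. ?\<eta> \<omega> \<le> t}"
      then obtain t \<omega> where p: "p = (t, \<omega>)" "t \<in> tset T" "\<omega> \<in> space M" "?\<eta> \<omega> \<le> t" by auto
      show "p \<in> {(t, \<omega>) \<in> tset T \<times> space M. t = T} \<union>
      (D - {(t, \<omega>) \<in> tset T \<times> space M. \<tau> \<omega> < t}) \<union> {(t, \<omega>) \<in> tset T \<times> space M. \<tau> \<omega> < t \<and> (\<tau> \<omega>, \<omega>) \<in> D}"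
      proof (cases "(\<tau> \<omega>, \<omega>) \<in> D")
        case True
        then have "\<tau> \<omega> = t \<or> \<tau> \<omega> < t" using p by auto
        then show ?thesis using True p by auto
      next
        case False
        then have "t = T" using p by (auto simp: tset_iff)
        then show ?thesis using p by auto
      qed
    next
      fix p assume a: "p \<in> {(t, \<omega>) \<in> tset T \<times> space M. t = T} \<union>
      (D - {(t, \<omega>) \<in> tset T \<times> space M. \<tau> \<omega> < t}) \<union> {(t, \<omega>) \<in> tset T \<times> space M. \<tau> \<omega> < t \<and> (\<tau> \<omega>, \<omega>) \<in> D}"
      obtain t \<omega> where p: "p = (t, \<omega>)" by (cases p)
      with a Dsub have t: "t \<in> tset T" "\<omega> \<in> space M" by auto
      from a p consider "t = T" | "(t, \<omega>) \<in> D" "\<not> \<tau> \<omega> < t" | "\<tau> \<omega> < t" "(\<tau> \<omega>, \<omega>) \<in> D" using t by auto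
      then have "?\<eta> \<omega> \<le> t"
      proof cases
        case 1 then show ?thesis using \<tau>t[OF t(2)] by (auto simp: tset_iff)
      next
        case 2 then have "\<tau> \<omega> = t" using after by (meson antisym not_le)
        with 2 show ?thesis by auto
      next
        case 3 then show ?thesis by auto
      qed
      then show "p \<in> {(t, \<omega>) \<in> tset T \<times> space M. ?\<eta> \<omega> \<le> t}" using p t by auto
    qed
    also have "\<dots> \<in> sets PS"
      using D predictable_at_T predictable_after[OF \<tau>] predictable_after_event[of \<tau> "\<lambda>\<omega>. (\<tau> \<omega>, \<omega>) \<in> D", OF B \<tau>t]
      by (intro sets.Un sets.Diff)
    finally show ?thesis .
  qed
  ultimately show ?thesis by (simp add: predictable_time_def)
qed

end

text \<open>An explicit sequence approaching a positive \<open>t\<close> strictly from the left,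
  measurable in \<open>t\<close>. It turns left limits into sequential limits, to which
  measurability and bounds pass.\<close>

definition lshift :: "nat \<Rightarrow> ereal \<Rightarrow> ereal" where
  "lshift n t = (if t = \<infinity> then ereal (real n) else ereal (real_of_ereal t * (1 - 1 / (real n + 2))))"

lemma lshift_bounds: "0 \<le> t \<Longrightarrow> 0 \<le> lshift n t \<and> lshift n t \<le> t"
proof (cases t)
  case (real r)
  assume "0 \<le> t"
  then have r: "0 \<le> r" using real by simp
  have "0 \<le> 1 - 1 / (real n + 2)" "1 - 1 / (real n + 2) \<le> 1" by (auto simp: field_simps)
  then show ?thesis using real r mult_left_mono[of "1 - 1 / (real n + 2)" 1 r] by (simp add: lshift_def)
qed (auto simp: lshift_def)

lemma lshift_less: "0 < t \<Longrightarrow> lshift n t < t"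
  by (cases t) (auto simp: lshift_def field_simps)

lemma lshift_tendsto: "0 < t \<Longrightarrow> (\<lambda>n. lshift n t) \<longlonglongrightarrow> t"
proof (cases t)
  case (real r)
  have "(\<lambda>n. 1 / (2 + real n)) \<longlonglongrightarrow> 0"
    by (rule tendsto_divide_0[OF tendsto_const filterlim_at_top_imp_at_infinity[
          OF filterlim_tendsto_add_at_top[OF tendsto_const filterlim_real_sequentially]]])
  then have "(\<lambda>n. r * (1 - 1 / (real n + 2))) \<longlonglongrightarrow> r * (1 - 0)"
    by (intro tendsto_intros) (simp add: add.commute)
  then show ?thesis using real by (simp add: lshift_def)
next
  case PInf
  then show ?thesis by (simp add: lshift_def tendsto_PInfty_eq_at_top filterlim_real_sequentially)
qed auto

lemma lminus_reg_tendsto: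
  assumes x: "cadlag_path T (\<lambda>t. X t \<omega>)" and t: "0 \<le> t" "t \<le> T"
  shows "(\<lambda>n. X (lshift n t) \<omega>) \<longlonglongrightarrow> lminus_reg X t \<omega>"
proof (cases "t = 0")
  case True then show ?thesis by (simp add: lshift_def lminus_reg_def zero_ereal_def)
next
  case False
  then have t0: "0 < t" using t by auto
  have "filterlim (\<lambda>n. lshift n t) (at_left t) sequentially"
    by (rule tendsto_imp_filterlim_at_left[OF lshift_tendsto[OF t0]]) (simp add: lshift_less[OF t0])
  from filterlim_compose[OF cadlag_path_left[OF x t0 t(2)] this] show ?thesis
    using False by (simp add: lminus_reg_def llim_def)
qed

lemma lminus_reg_meas:
  assumes x: "\<And>\<omega>. \<omega> \<in> space M \<Longrightarrow> cadlag_path T (\<lambda>t. X t \<omega>)" and X: "prog_meas M T X"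
    and e[measurable]: "e \<in> borel_measurable N" and et: "\<And>p. p \<in> space N \<Longrightarrow> 0 \<le> e p \<and> e p \<le> T" and k: "k \<in> N \<rightarrow>\<^sub>M M"
  shows "(\<lambda>p. lminus_reg X (e p) (k p)) \<in> borel_measurable N"
proof (rule borel_measurable_LIMSEQ_real)
  fix p assume p: "p \<in> space N"
  show "(\<lambda>n. X (lshift n (e p)) (k p)) \<longlonglongrightarrow> lminus_reg X (e p) (k p)"
    using et[OF p] measurable_space[OF k p] by (intro lminus_reg_tendsto[OF x]) auto
next
  fix n
  have "0 \<le> lshift n (e p) \<and> lshift n (e p) \<le> T" if "p \<in> space N" for p
    using lshift_bounds[of "e p" n] et[OF that] by (meson order_trans)
  then show "(\<lambda>p. X (lshift n (e p)) (k p)) \<in> borel_measurable N"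
    by (intro prog_meas_eval[OF X _ _ k]) (auto simp: lshift_def)
qed

section \<open>Regularity of \<open>g\<close> tested along a stopping time\<close>

context dynkin_game
begin

lemma g_cadlag: "\<omega> \<in> space M \<Longrightarrow> cadlag_path T (\<lambda>t. g t \<omega>)"
  using g_Lb by (auto simp: Lb_def)

lemma lminus_reg_g_bound: "good \<omega> \<Longrightarrow> 0 \<le> t \<Longrightarrow> t \<le> T \<Longrightarrow> \<bar>lminus_reg g t \<omega>\<bar> \<le> dom \<omega>"
proof -
  assume g: "good \<omega>" and t: "0 \<le> t" "t \<le> T"
  have "(\<lambda>n. \<bar>g (lshift n t) \<omega>\<bar>) \<longlonglongrightarrow> \<bar>lminus_reg g t \<omega>\<bar>"
    using g t by (intro tendsto_rabs lminus_reg_tendsto[OF g_cadlag]) (auto simp: good_def)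
  moreover have "\<bar>g (lshift n t) \<omega>\<bar> \<le> dom \<omega>" for n
    using lshift_bounds[OF t(1), of n] t(2) by (intro goodD(2)[OF g]) (meson order_trans)+
  ultimately show ?thesis by (intro LIMSEQ_le_const2) auto
qed

lemma sub_filD:
  assumes "sub_filtration T G F" "is_filtration M T G" "t \<in> tset T"
  shows "A \<in> sets (G t) \<Longrightarrow> A \<in> sets (F t)" "space (G t) = space M"
  using assms by (auto simp: sub_filtration_def is_filtration_def)

text \<open>Regularity of \<open>g\<close> at the predictable time \<eta>, tested against a bounded
  factor known just before \<eta>. The factor contains the event that \<tau> lies in
  \<open>D\<close>, so that only the part of \<eta> coming from \<tau> counts, and the left limit of
  \<xi>, which is predictable while \<xi> itself need not be.\<close>

lemma regular_jump_integral:
  assumes \<tau>: "stopping_time_on M T F \<tau>" and D: "D \<in> sets (predictable_sigma M T F)"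
    and after: "\<And>t \<omega>. (t, \<omega>) \<in> D \<Longrightarrow> \<tau> \<omega> \<le> t" and \<xi>: "\<xi> \<in> Acirc M T F1"
  defines "W \<equiv> \<lambda>\<omega>. if (\<tau> \<omega>, \<omega>) \<in> D then (1 - lft (\<lambda>s. \<xi> s \<omega>) (\<tau> \<omega>)) * (g (\<tau> \<omega>) \<omega> - lminus_reg g (\<tau> \<omega>) \<omega>) else 0"
  shows "integrable M W" "(\<integral>\<omega>. W \<omega> \<partial>M) = 0"
proof -
  let ?PS = "predictable_sigma M T F"
  define \<eta> where "\<eta> \<omega> = (if (\<tau> \<omega>, \<omega>) \<in> D then \<tau> \<omega> else T)" for \<omega>
  have pt: "predictable_time M T F \<eta>"
    using predictable_time_restriction[OF T filF \<tau> D after] by (simp add: \<eta>_def[abs_def])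
  then have st: "stopping_time_on M T F \<eta>" by (simp add: predictable_time_def)
  let ?N = "F_minus M T F \<eta>"
  interpret N: finite_measure_subalgebra M ?N
    by standard (rule subalgebra_F_minus[OF T filF st])
  have \<tau>t: "0 \<le> \<tau> \<omega>" "\<tau> \<omega> \<le> T" if "\<omega> \<in> space M" for \<omega>
    using \<tau> that unfolding stopping_time_on_def tset_iff by blast+
  have \<eta>t: "0 \<le> \<eta> \<omega> \<and> \<eta> \<omega> \<le> T" if "\<omega> \<in> space M" for \<omega> using \<tau>t[OF that] T0 by (auto simp: \<eta>_def)
  \<comment> \<open>Off the event, \<eta> equals \<open>T\<close>, and \<open>(T, \<omega>)\<close>
    might still belong to \<open>D\<close>. Cutting \<open>D\<close> down to the graph of \<tau>
    excludes this.\<close>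
  define D' where "D' = D - {(t, \<omega>) \<in> tset T \<times> space M. \<tau> \<omega> < t}"
  have D': "D' \<in> sets ?PS" unfolding D'_def using D predictable_after[OF T filF \<tau>] by auto
  define b where "b \<omega> = indicator D' (\<eta> \<omega>, \<omega>) * (1 - lft (\<lambda>s. \<xi> s \<omega>) (\<eta> \<omega>))" for \<omega>
  have bm[measurable]: "b \<in> borel_measurable ?N"
  proof -
    have "(\<lambda>p. indicator D' p * (1 - lft (\<lambda>s. \<xi> s (snd p)) (fst p))) \<in> borel_measurable ?PS"
      by (intro borel_measurable_times borel_measurable_indicator D' borel_measurable_diff borel_measurable_const
          predictable_lft[OF T filF sub_filD[OF sub1 filF1] \<xi>])
    from measurable_compose[OF measurable_F_minus_predictable[OF T filF st] this] show ?thesis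
      by (simp add: b_def[abs_def])
  qed
  have \<eta>m: "\<eta> \<in> borel_measurable M"
  proof (rule borel_measurableI_le)
    fix t
    consider "t < 0" | "0 \<le> t" "t \<le> T" | "T < t" by force
    then show "{\<omega> \<in> space M. \<eta> \<omega> \<le> t} \<in> sets M"
    proof cases
      case 1
      then have "{\<omega> \<in> space M. \<eta> \<omega> \<le> t} = {}" using \<eta>t by force
      then show ?thesis by (metis sets.empty_sets)
    next
      case 2
      then show ?thesis
        by (intro fil_sets[OF T filF, of t]) (use st in \<open>auto simp: stopping_time_on_def tset_iff\<close>)
    next
      case 3
      then have "{\<omega> \<in> space M. \<eta> \<omega> \<le> t} = space M" using \<eta>t by force
      then show ?thesis by simp
    qed
  qed
  define \<Delta> where "\<Delta> \<omega> = g (\<eta> \<omega>) \<omega> - lminus_reg g (\<eta> \<omega>) \<omega>" for \<omega>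
  have \<Delta>m[measurable]: "\<Delta> \<in> borel_measurable M"
    unfolding \<Delta>_def[abs_def]
    using prog_meas_eval[OF g_prog \<eta>m \<eta>t measurable_ident] lminus_reg_meas[OF g_cadlag g_prog \<eta>m \<eta>t measurable_ident]
    by (simp add: id_def)
  have b1: "\<bar>b \<omega>\<bar> \<le> 1" if "\<omega> \<in> space M" for \<omega>
    using lft_nonneg[OF Acirc_dpath[OF \<xi> that]] lft_le_1[OF Acirc_dpath[OF \<xi> that]] \<eta>t[OF that]
    by (auto simp: b_def indicator_def)
  have bM[measurable]: "b \<in> borel_measurable M" using measurable_from_subalg[OF N.subalg bm] .
  have int: "integrable M (\<lambda>\<omega>. b \<omega> * \<Delta> \<omega>)"
  proof (rule Bochner_Integration.integrable_bound[of M "\<lambda>\<omega>. 2 * dom \<omega>"])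
    show "AE \<omega> in M. norm (b \<omega> * \<Delta> \<omega>) \<le> norm (2 * dom \<omega>)"
      using good_AE
    proof eventually_elim
      case (elim \<omega>)
      then have \<omega>: "\<omega> \<in> space M" by (simp add: good_def)
      have "\<bar>\<Delta> \<omega>\<bar> \<le> 2 * dom \<omega>"
        using goodD(2)[OF elim, of "\<eta> \<omega>"] lminus_reg_g_bound[OF elim, of "\<eta> \<omega>"] \<eta>t[OF \<omega>] by (simp add: \<Delta>_def)
      then have "\<bar>b \<omega>\<bar> * \<bar>\<Delta> \<omega>\<bar> \<le> 1 * (2 * dom \<omega>)" using b1[OF \<omega>] by (intro mult_mono) auto
      then show ?case by (simp add: abs_mult)
    qed
  qed (use dom_integrable in auto)
  have eq: "W \<omega> = b \<omega> * \<Delta> \<omega>" if \<omega>: "\<omega> \<in> space M" for \<omega>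
  proof (cases "(\<tau> \<omega>, \<omega>) \<in> D")
    case True
    then show ?thesis by (simp add: W_def b_def \<Delta>_def \<eta>_def D'_def)
  next
    case False
    have "(T, \<omega>) \<notin> D'"
    proof
      assume "(T, \<omega>) \<in> D'"
      then have "(T, \<omega>) \<in> D" "\<not> \<tau> \<omega> < T" using \<omega> T0 by (auto simp: D'_def tset_iff)
      then have "\<tau> \<omega> = T" using \<tau>t[OF \<omega>] by auto
      with False \<open>(T, \<omega>) \<in> D\<close> show False by simp
    qed
    then show ?thesis using False by (simp add: W_def b_def \<eta>_def)
  qed
  have "integrable M W \<longleftrightarrow> integrable M (\<lambda>\<omega>. b \<omega> * \<Delta> \<omega>)"
    by (rule Bochner_Integration.integrable_cong) (auto simp: eq)
  with int show "integrable M W" by simp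
  have "(\<integral>\<omega>. W \<omega> \<partial>M) = (\<integral>\<omega>. b \<omega> * \<Delta> \<omega> \<partial>M)" by (rule Bochner_Integration.integral_cong) (auto simp: eq)
  \<comment> \<open>The factor \<open>b\<close> is measurable for \<open>?N\<close>, so it passes
    through the conditional expectation.\<close>
  also have "\<dots> = (\<integral>\<omega>. b \<omega> * real_cond_exp M ?N \<Delta> \<omega> \<partial>M)"
    using N.real_cond_exp_intg(2)[OF int bm \<Delta>m] by simp
  also have "\<dots> = (\<integral>\<omega>. 0 \<partial>M)"
  proof (rule integral_cong_AE)
    have "AE \<omega> in M. real_cond_exp M ?N \<Delta> \<omega> = 0"
      using g_regular pt unfolding regular_def \<Delta>_def[abs_def] by blast
    then show "AE \<omega> in M. b \<omega> * real_cond_exp M ?N \<Delta> \<omega> = 0" by eventually_elim simp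
  qed auto
  finally show "(\<integral>\<omega>. W \<omega> \<partial>M) = 0" by simp
qed

end

section \<open>Upper semicontinuity in the second control\<close>

lemma tendsto_from_right:
  fixes X :: "ereal \<Rightarrow> real"
  assumes X: "(X \<longlongrightarrow> X s) (at_right s)" and sT: "s < T" and lim: "sn \<longlonglongrightarrow> s" and ge: "\<forall>\<^sub>F n in sequentially. s \<le> sn n"
  shows "(\<lambda>n. X (sn n)) \<longlonglongrightarrow> X s"
proof (rule topological_tendstoI)
  fix S assume S: "open S" "X s \<in> S"
  obtain b where b: "s < b" "\<And>y. s < y \<Longrightarrow> y < b \<Longrightarrow> X y \<in> S"
    using topological_tendstoD[OF X S] unfolding eventually_at_right[OF sT] by auto
  show "\<forall>\<^sub>F n in sequentially. X (sn n) \<in> S"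
    using order_tendstoD(2)[OF lim b(1)] ge
  proof eventually_elim
    case (elim n)
    then show ?case using b(2)[of "sn n"] S by (cases "sn n = s") auto
  qed
qed

lemma tendsto_from_both:
  fixes X :: "ereal \<Rightarrow> real"
  assumes X: "(X \<longlongrightarrow> X s) (at_right s)" "(X \<longlongrightarrow> X s) (at_left s)" and sT: "r < s" "s < T" and lim: "sn \<longlonglongrightarrow> s"
  shows "(\<lambda>n. X (sn n)) \<longlonglongrightarrow> X s"
proof (rule topological_tendstoI)
  fix S assume S: "open S" "X s \<in> S"
  obtain b where b: "s < b" "\<And>y. s < y \<Longrightarrow> y < b \<Longrightarrow> X y \<in> S"
    using topological_tendstoD[OF X(1) S] unfolding eventually_at_right[OF sT(2)] by auto
  obtain a where a: "a < s" "\<And>y. a < y \<Longrightarrow> y < s \<Longrightarrow> X y \<in> S"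
    using topological_tendstoD[OF X(2) S] unfolding eventually_at_left[OF sT(1)] by auto
  show "\<forall>\<^sub>F n in sequentially. X (sn n) \<in> S"
    using order_tendstoD(2)[OF lim b(1)] order_tendstoD(1)[OF lim a(1)]
  proof eventually_elim
    case (elim n)
    then show ?case using b(2)[of "sn n"] a(2)[of "sn n"] S by (cases "sn n" s rule: linorder_cases) auto
  qed
qed

text \<open>The upper bound can fail only if the limit path stays at the value \<open>v\<close> for
  a while after its quantile time. Such a flat piece contains a rational time, so \<open>v\<close>
  would be one of countably many values.\<close>

lemma qtl_tendsto:
  assumes T: "0 < T" and x: "dpath T x" and z: "\<And>n. dpath T (z n)"
    and C: "\<And>t. 0 \<le> t \<Longrightarrow> t < T \<Longrightarrow> lft x t = x t \<Longrightarrow> (\<lambda>n. z n t) \<longlonglongrightarrow> x t"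
    and v: "0 < v" "v < 1" "v \<notin> range (\<lambda>r. x (ereal (real_of_rat r)))"
  shows "(\<lambda>n. qtl T (z n) v) \<longlonglongrightarrow> qtl T x v"
proof (rule order_tendstoI)
  let ?s = "qtl T x v"
  have s: "0 \<le> ?s" "?s \<le> T" using qtl_in_tset[OF T x, of v] v by auto
  have zs: "0 \<le> qtl T (z n) v" "qtl T (z n) v \<le> T" for n using qtl_in_tset[OF T z, of v n] v by auto
  { fix a assume a: "a < ?s"
    show "\<forall>\<^sub>F n in sequentially. a < qtl T (z n) v"
    proof (cases "a < 0")
      case True then show ?thesis using zs(1) by (intro always_eventually allI) (rule less_le_trans)
    next
      case False
      then have "0 \<le> a" by auto
      from exists_continuity_point[OF x this a s(2)] obtain t where t: "a < t" "t < ?s" "lft x t = x t" .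
      have tt: "0 \<le> t" "t < T" using \<open>0 \<le> a\<close> t s by auto
      have "x t < v" using less_qtl_iff[OF T x, of v t] t tt v by auto
      from order_tendstoD(2)[OF C[OF tt t(3)] this] show ?thesis
      proof eventually_elim
        case (elim n)
        then have "t < qtl T (z n) v" using less_qtl_iff[OF T z, of v t n] tt v by auto
        with t(1) show ?case by simp
      qed
    qed }
  { fix b assume b: "?s < b"
    show "\<forall>\<^sub>F n in sequentially. qtl T (z n) v < b"
    proof (cases "?s = T")
      case True then show ?thesis using zs(2) b by (intro always_eventually allI) (auto intro: le_less_trans)
    next
      case False
      then have "?s < min b T" using b s by auto
      from exists_continuity_point[OF x s(1) this] obtain t where t: "?s < t" "t < b" "t < T" "lft x t = x t" by auto
      obtain r where r: "?s < ereal (real_of_rat r)" "ereal (real_of_rat r) < t" using ereal_dense3[OF t(1)] by auto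
      have r0: "0 \<le> ereal (real_of_rat r)" "ereal (real_of_rat r) \<le> T" "0 \<le> t"
        using r s t by (meson le_less_trans less_imp_le less_trans)+
      have "v \<le> x (ereal (real_of_rat r))" using qtl_le_iff[OF T x, of v "ereal (real_of_rat r)"] r r0 v by auto
      moreover have "v \<noteq> x (ereal (real_of_rat r))" using v(3) by auto
      moreover have "x (ereal (real_of_rat r)) \<le> x t" using r r0 t by (intro dpath_mono[OF x]) auto
      ultimately have "v < x t" by linarith
      from order_tendstoD(1)[OF C[OF r0(3) t(3,4)] this] show ?thesis
      proof eventually_elim
        case (elim n)
        then have "qtl T (z n) v \<le> t" using qtl_le_iff[OF T z, of v t n] r0 t v by auto
        with t(2) show ?case by simp
      qed
    qed }
qed

section \<open>Limits of the two payoff terms\<close>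

context dynkin_game
begin

lemma Xg_right_cont:
  assumes "\<xi> \<in> Acirc M T G" "\<omega> \<in> space M" "0 \<le> t" "t < T"
  shows "((\<lambda>s. Xg \<xi> s \<omega>) \<longlongrightarrow> Xg \<xi> t \<omega>) (at_right t)"
proof -
  have "((\<lambda>s. g s \<omega> * (1 - \<xi> s \<omega>)) \<longlongrightarrow> g t \<omega> * (1 - \<xi> t \<omega>)) (at_right t)"
    using cadlag_path_right[OF g_cadlag[OF assms(2)] assms(3,4)] cadlag_path_right[of T "\<lambda>s. \<xi> s \<omega>" t] assms
    by (intro tendsto_intros) (auto simp: Acirc_def)
  moreover have "\<forall>\<^sub>F s in at_right t. g s \<omega> * (1 - \<xi> s \<omega>) = Xg \<xi> s \<omega>"
    unfolding eventually_at_right[OF assms(4)] using assms(4) by (intro exI[of _ T]) (auto simp: Xg_def)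
  ultimately have "((\<lambda>s. Xg \<xi> s \<omega>) \<longlongrightarrow> g t \<omega> * (1 - \<xi> t \<omega>)) (at_right t)"
    by (rule Lim_transform_eventually)
  then show ?thesis using assms(4) by (simp add: Xg_def)
qed

text \<open>The left limit of \<open>Xg\<close>. At \<open>T\<close> it involves \<open>g\<close>
  and not \<open>h\<close>, as times before \<open>T\<close> do not see the terminal branch.\<close>

definition Xl :: "(ereal \<Rightarrow> 'a \<Rightarrow> real) \<Rightarrow> ereal \<Rightarrow> 'a \<Rightarrow> real" where
  "Xl \<xi> t \<omega> = lminus_reg g t \<omega> * (1 - lft (\<lambda>s. \<xi> s \<omega>) t)"

lemma Xg_left_limit:
  assumes "\<xi> \<in> Acirc M T G" "\<omega> \<in> space M" "0 < t" "t \<le> T"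
  shows "((\<lambda>s. Xg \<xi> s \<omega>) \<longlongrightarrow> Xl \<xi> t \<omega>) (at_left t)"
proof -
  have "((\<lambda>s. g s \<omega> * (1 - \<xi> s \<omega>)) \<longlongrightarrow> Lim (at_left t) (\<lambda>s. g s \<omega>) * (1 - lft (\<lambda>s. \<xi> s \<omega>) t)) (at_left t)"
    using cadlag_path_left[OF g_cadlag[OF assms(2)] assms(3,4)] dpath_left_tendsto[OF Acirc_dpath[OF assms(1,2)] assms(3,4)]
    by (intro tendsto_intros)
  moreover have "\<forall>\<^sub>F s in at_left t. g s \<omega> * (1 - \<xi> s \<omega>) = Xg \<xi> s \<omega>"
    unfolding eventually_at_left[OF assms(3)] using assms by (intro exI[of _ 0]) (auto simp: Xg_def)
  ultimately have "((\<lambda>s. Xg \<xi> s \<omega>) \<longlongrightarrow> Lim (at_left t) (\<lambda>s. g s \<omega>) * (1 - lft (\<lambda>s. \<xi> s \<omega>) t)) (at_left t)"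
    by (rule Lim_transform_eventually)
  moreover have "t \<noteq> 0" using assms(3) by auto
  ultimately show ?thesis by (simp add: Xl_def lminus_reg_def llim_def)
qed

lemma Xl_bound: "good \<omega> \<Longrightarrow> \<xi> \<in> Acirc M T G \<Longrightarrow> 0 \<le> t \<Longrightarrow> t \<le> T \<Longrightarrow> \<bar>Xl \<xi> t \<omega>\<bar> \<le> dom \<omega>"
  using lminus_reg_g_bound[of \<omega> t] lft_nonneg[OF Acirc_dpath, of \<xi> M T G \<omega> t] lft_le_1[OF Acirc_dpath, of \<xi> M T G \<omega> t]
  by (auto simp: Xl_def good_def intro!: abs_mult_le)

definition limsup_lft :: "(nat \<Rightarrow> ereal \<Rightarrow> 'a \<Rightarrow> real) \<Rightarrow> ereal \<Rightarrow> 'a \<Rightarrow> ereal" where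
  "limsup_lft z t \<omega> = limsup (\<lambda>n. ereal (lft (\<lambda>s. z n s \<omega>) t))"

text \<open>If \<open>g\<close> is continuous at a positive limit time \<open>s < T\<close>, then so
  is \<open>Xg\<close>, and the side of approach is irrelevant. The remaining positive times are
  \<open>T\<close> and the jump times of \<open>g\<close>, countably many for the given outcome; at
  such a time, if the left limits converge to \<open>w\<close>, the comparison of
  \<open>v \<noteq> w\<close> with \<open>w\<close> decides the side. The limsup allows the
  exceptional levels to be listed before convergence is known.\<close>

lemma Xg_qtl_tendsto:
  fixes z :: "nat \<Rightarrow> ereal \<Rightarrow> 'a \<Rightarrow> real"
  assumes \<omega>: "\<omega> \<in> space M" and \<xi>: "\<xi> \<in> Kc" and z: "\<And>n. z n \<in> K2" and \<zeta>: "\<zeta> \<in> K2" and v: "0 < v" "v < 1"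
    and lim: "(\<lambda>n. q (z n) \<omega> v) \<longlonglongrightarrow> q \<zeta> \<omega> v"
    and conv: "convergent (\<lambda>n. lft (\<lambda>s. z n s \<omega>) (q \<zeta> \<omega> v))"
    and ex: "v \<notin> (\<lambda>s. real_of_ereal (limsup_lft z s \<omega>)) ` insert T {t. 0 < t \<and> t \<le> T \<and> Lim (at_left t) (\<lambda>s. g s \<omega>) \<noteq> g t \<omega>}"
  shows "(\<lambda>n. Xg \<xi> (q (z n) \<omega> v) \<omega>) \<longlonglongrightarrow>
    (if ereal v < limsup_lft z (q \<zeta> \<omega> v) \<omega> then Xl \<xi> (q \<zeta> \<omega> v) \<omega> else Xg \<xi> (q \<zeta> \<omega> v) \<omega>)"
proof -
  define s where "s = q \<zeta> \<omega> v"
  note \<xi>A = Kc_Acirc[OF \<xi>]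
  note dz = Acirc_dpath[OF z \<omega>] and d\<zeta> = Acirc_dpath[OF \<zeta> \<omega>] and d\<xi> = Acirc_dpath[OF \<xi>A \<omega>]
  have s: "0 \<le> s" "s \<le> T" using q_in[OF \<zeta> \<omega> v] by (auto simp: s_def)
  have sn: "0 \<le> q (z n) \<omega> v" "q (z n) \<omega> v \<le> T" for n using q_in[OF z \<omega> v] by auto
  have lim': "(\<lambda>n. q (z n) \<omega> v) \<longlonglongrightarrow> s" using lim by (simp add: s_def)
  show ?thesis unfolding s_def[symmetric]
  proof (cases "s = 0")
    case True
    \<comment> \<open>At time 0 only the right side is possible.\<close>
    then have "limsup_lft z s \<omega> = 0" by (simp add: limsup_lft_def lft_def Limsup_const zero_ereal_def)
    moreover have "(\<lambda>n. Xg \<xi> (q (z n) \<omega> v) \<omega>) \<longlonglongrightarrow> Xg \<xi> s \<omega>"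
      using True sn(1) T by (intro tendsto_from_right[OF Xg_right_cont[OF \<xi>A \<omega>] _ lim']) auto
    ultimately show "(\<lambda>n. Xg \<xi> (q (z n) \<omega> v) \<omega>) \<longlonglongrightarrow> (if ereal v < limsup_lft z s \<omega> then Xl \<xi> s \<omega> else Xg \<xi> s \<omega>)"
      using v by simp
  next
    case False
    then have s0: "0 < s" using s by auto
    show "(\<lambda>n. Xg \<xi> (q (z n) \<omega> v) \<omega>) \<longlonglongrightarrow> (if ereal v < limsup_lft z s \<omega> then Xl \<xi> s \<omega> else Xg \<xi> s \<omega>)"
    proof (cases "s < T \<and> Lim (at_left s) (\<lambda>s. g s \<omega>) = g s \<omega>")
      case True
      then have "lft (\<lambda>t. \<xi> t \<omega>) s = \<xi> s \<omega>" using \<xi> \<omega> s0 by (auto simp: Kc_def)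
      then have eq: "Xl \<xi> s \<omega> = Xg \<xi> s \<omega>" using True s0 by (simp add: Xl_def Xg_def lminus_reg_def llim_def)
      have "(\<lambda>n. Xg \<xi> (q (z n) \<omega> v) \<omega>) \<longlonglongrightarrow> Xg \<xi> s \<omega>"
        using True s0 Xg_left_limit[OF \<xi>A \<omega> s0 s(2)] Xg_right_cont[OF \<xi>A \<omega> s(1)] eq
        by (intro tendsto_from_both[where s=s and r=0 and T=T, OF _ _ _ _ lim']) auto
      then show ?thesis using eq by simp
    next
      case False
      obtain w where w: "(\<lambda>n. lft (\<lambda>t. z n t \<omega>) s) \<longlonglongrightarrow> w" using conv by (auto simp: convergent_def s_def)
      then have "limsup_lft z s \<omega> = ereal w" unfolding limsup_lft_def by (intro lim_imp_Limsup) auto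
      moreover have "s = T \<or> Lim (at_left s) (\<lambda>s. g s \<omega>) \<noteq> g s \<omega>" using False s by auto
      ultimately have vw: "v \<noteq> w" "limsup_lft z s \<omega> = ereal w" using ex s s0 by (auto simp: image_iff)
      show ?thesis
      proof (cases "v < w")
        case True
        have "\<forall>\<^sub>F n in sequentially. q (z n) \<omega> v < s"
          using order_tendstoD(1)[OF w True]
          by eventually_elim (use v s in \<open>auto intro!: qtl_less_if_less_lft[OF T dz]\<close>)
        then have "filterlim (\<lambda>n. q (z n) \<omega> v) (at_left s) sequentially"
          by (rule tendsto_imp_filterlim_at_left[OF lim'])
        from filterlim_compose[OF Xg_left_limit[OF \<xi>A \<omega> s0 s(2)] this] show ?thesis
          using True vw by simp
      next
        case False
        then have "w < v" using vw by simp
        have ev: "\<forall>\<^sub>F n in sequentially. s \<le> q (z n) \<omega> v"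
          using order_tendstoD(2)[OF w \<open>w < v\<close>]
          by eventually_elim (use v s in \<open>auto intro!: le_qtl_if_lft_less[OF T dz]\<close>)
        have "(\<lambda>n. Xg \<xi> (q (z n) \<omega> v) \<omega>) \<longlonglongrightarrow> Xg \<xi> s \<omega>"
        proof (cases "s < T")
          case True
          show ?thesis by (rule tendsto_from_right[OF Xg_right_cont[OF \<xi>A \<omega> s(1) True] True lim' ev])
        next
          case False
          \<comment> \<open>Quantile times never exceed \<open>T\<close>, so those at or beyond
            \<open>s\<close> are equal to it.\<close>
          then have "s = T" using s by auto
          from ev have "\<forall>\<^sub>F n in sequentially. Xg \<xi> (q (z n) \<omega> v) \<omega> = Xg \<xi> s \<omega>"
          proof eventually_elim
            case (elim n)
            then have "q (z n) \<omega> v = s" using sn(2)[of n] \<open>s = T\<close> by auto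
            then show ?case by simp
          qed
          then show ?thesis by (rule tendsto_eventually)
        qed
        then show ?thesis using vw False by simp
      qed
    qed
  qed
qed

text \<open>Continuity of \<xi> at its quantile time forces \<open>v\<close> to be the value there.
  A jump of \<zeta> at that time would put \<open>v\<close> into a countable set; otherwise the
  controls converge at it.\<close>

lemma Yf_tendsto:
  fixes z :: "nat \<Rightarrow> ereal \<Rightarrow> 'a \<Rightarrow> real"
  assumes \<omega>: "\<omega> \<in> space M" and \<xi>: "\<xi> \<in> Kc" "\<xi> 0 \<omega> = 0" and v: "0 < v" "v < 1"
    and C: "\<And>t. 0 \<le> t \<Longrightarrow> t < T \<Longrightarrow> lft (\<lambda>s. \<zeta> s \<omega>) t = \<zeta> t \<omega> \<Longrightarrow> (\<lambda>n. z n t \<omega>) \<longlonglongrightarrow> \<zeta> t \<omega>"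
    and ex: "v \<notin> (\<lambda>s. \<xi> s \<omega>) ` {t. 0 \<le> t \<and> t \<le> T \<and> lft (\<lambda>s. \<zeta> s \<omega>) t \<noteq> \<zeta> t \<omega>}"
  shows "(\<lambda>n. Yf (z n) (q \<xi> \<omega> v) \<omega>) \<longlonglongrightarrow> Yf \<zeta> (q \<xi> \<omega> v) \<omega>"
proof -
  define s where "s = q \<xi> \<omega> v"
  note d = Acirc_dpath[OF Kc_Acirc[OF \<xi>(1)] \<omega>]
  have s: "0 \<le> s" "s \<le> T" using q_in[OF Kc_Acirc[OF \<xi>(1)] \<omega> v] by (auto simp: s_def)
  have vs: "v \<le> \<xi> s \<omega>" "lft (\<lambda>t. \<xi> t \<omega>) s \<le> v" using le_at_qtl[OF T d, of v] lft_at_qtl_le[OF T d, of v] v by (auto simp: s_def)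
  show ?thesis unfolding s_def[symmetric]
  proof (cases "s < T")
    case True
    \<comment> \<open>\<open>\<xi> 0 \<omega> = 0\<close> and \<open>0 < v\<close> exclude time 0,
      the one place before \<open>T\<close> where \<xi> could jump.\<close>
    have "s \<noteq> 0" using vs(1) \<xi>(2) v by auto
    then have "lft (\<lambda>t. \<xi> t \<omega>) s = \<xi> s \<omega>" using \<xi>(1) \<omega> True s by (auto simp: Kc_def)
    then have "v = \<xi> s \<omega>" using vs by simp
    then have "lft (\<lambda>t. \<zeta> t \<omega>) s = \<zeta> s \<omega>" using ex s by auto
    from C[OF s(1) True this] show "(\<lambda>n. Yf (z n) s \<omega>) \<longlonglongrightarrow> Yf \<zeta> s \<omega>"
      using True by (auto simp: Yf_def intro!: tendsto_intros)
  qed (simp add: Yf_def)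
qed

end

section \<open>Convex refinement and semicontinuity\<close>

context dynkin_game
begin

text \<open>Convergence at the continuity times of \<zeta> says nothing about left limits at a jump
  of \<zeta>, and quantile times may sit at jumps. The norm argument is therefore repeated with an
  observation \<open>u\<close> that records these left limits. Here the family is a decreasing
  sequence, and the choice \<open>B = C\<close> places \<open>z n\<close> in the hull of the tail
  from \<open>n\<close> on.\<close>

lemma convex_refinement:
  assumes \<xi>: "\<xi> \<in> Acirc M T F1" and y: "\<And>n. y n \<in> K2" and \<zeta>: "\<zeta> \<in> K2" and c: "\<And>n. c \<le> J \<xi> (y n)"
  shows "\<exists>z. (\<forall>n. z n \<in> K2 \<and> c \<le> J \<xi> (z n)) \<and>
    (\<forall>n t \<omega> a b. (\<forall>m\<ge>n. a \<le> y m t \<omega> \<and> y m t \<omega> \<le> b) \<longrightarrow> a \<le> z n t \<omega> \<and> z n t \<omega> \<le> b) \<and>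
    (AE p in M \<Otimes>\<^sub>M unif. convergent (\<lambda>n. lft (\<lambda>s. z n s (fst p)) (q \<zeta> (fst p) (snd p))))"
proof -
  \<comment> \<open>The interval condition stands in for the convex hull of the tail of \<open>y\<close>: it is stable under
    midpoints and preserves pointwise limits.\<close>
  define C where "C k = {z \<in> K2. c \<le> J \<xi> z \<and>
     (\<forall>t \<omega> a b. (\<forall>m\<ge>k. a \<le> y m t \<omega> \<and> y m t \<omega> \<le> b) \<longrightarrow> a \<le> z t \<omega> \<and> z t \<omega> \<le> b)}" for k :: nat
  define u where "u z p = lft (\<lambda>s. z s (fst p)) (q \<zeta> (fst p) (snd p))" for z :: "ereal \<Rightarrow> 'a \<Rightarrow> real" and p
  have Csub: "C k \<subseteq> K2" for k by (auto simp: C_def)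
  have Canti: "C k \<subseteq> C j" if "j \<le> k" for j k
  proof
    fix z assume z: "z \<in> C k"
    have "a \<le> z t \<omega> \<and> z t \<omega> \<le> b" if "\<forall>m\<ge>j. a \<le> y m t \<omega> \<and> y m t \<omega> \<le> b" for t \<omega> a b
    proof -
      have "\<forall>m\<ge>k. a \<le> y m t \<omega> \<and> y m t \<omega> \<le> b" using that \<open>j \<le> k\<close> by auto
      then show ?thesis using z unfolding C_def by blast
    qed
    then show "z \<in> C j" using z unfolding C_def by blast
  qed
  obtain w where w: "\<And>B. (\<And>n::nat. B n \<in> range C) \<Longrightarrow> \<exists>z. (\<forall>n. z n \<in> B n) \<and>
      (AE p in M \<Otimes>\<^sub>M unif. (\<lambda>n. u (z n) p) \<longlonglongrightarrow> w p)"
  proof (rule directed_convex_AE_limit[of "M \<Otimes>\<^sub>M unif" "range C" u "mixp (1/2)"])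
    show "finite_measure (M \<Otimes>\<^sub>M unif)"
      by (intro finite_measureI) (simp add: space_pair_measure U.emeasure_pair_measure_Times emeasure_space_1 U.emeasure_space_1)
    have qt: "0 \<le> q \<zeta> (fst p) (snd p) \<and> q \<zeta> (fst p) (snd p) \<le> T" if "p \<in> space (M \<Otimes>\<^sub>M unif)" for p
      using q_in[OF \<zeta>] that by (auto simp: space_pair_measure space_unif)
    { fix D a assume "D \<in> range C" "a \<in> D"
      then have a: "a \<in> K2" using Csub by blast
      show "u a \<in> borel_measurable (M \<Otimes>\<^sub>M unif)"
        unfolding u_def[abs_def]
        using Acirc_dpath[OF a]
        by (intro measurable_lft[where r="\<lambda>t p. a t (fst p)", OF T _ _ q_meas[OF filF2 \<zeta>] qt]
            measurable_compose[OF measurable_fst Acirc_measurable[OF filF2 a]])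
          (auto simp: space_pair_measure)
      show "\<bar>u a p\<bar> \<le> 1" if "p \<in> space (M \<Otimes>\<^sub>M unif)" for p
        unfolding u_def using that qt[OF that] lft_nonneg[OF Acirc_dpath[OF a]] lft_le_1[OF Acirc_dpath[OF a]]
        by (auto simp: space_pair_measure) }
    { fix D a b assume D: "D \<in> range C" and ab: "a \<in> D" "b \<in> D"
      then obtain k where k: "D = C k" by auto
      have abK: "a \<in> K2" "b \<in> K2" using ab k Csub by auto
      have m: "mixp (1/2) a b \<in> K2" by (rule Acirc_mix[OF T abK]) auto
      have "c \<le> J \<xi> (mixp (1/2) a b)"
        using J_mix2[OF \<xi> abK, of "1/2"] ab k by (simp add: C_def)
      moreover have "l \<le> mixp (1/2) a b t \<omega> \<and> mixp (1/2) a b t \<omega> \<le> r" if H: "\<forall>m\<ge>k. l \<le> y m t \<omega> \<and> y m t \<omega> \<le> r" for t \<omega> l r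
      proof -
        have "l \<le> a t \<omega> \<and> a t \<omega> \<le> r" "l \<le> b t \<omega> \<and> b t \<omega> \<le> r" using ab H unfolding k C_def by blast+
        then show ?thesis by (simp add: mixp_def)
      qed
      ultimately show "mixp (1/2) a b \<in> D" using m unfolding k C_def by blast
      show "u (mixp (1/2) a b) p = (u a p + u b p) / 2" if p: "p \<in> space (M \<Otimes>\<^sub>M unif)" for p
      proof -
        have "fst p \<in> space M" using p by (auto simp: space_pair_measure)
        then show ?thesis unfolding u_def mixp_def
          using lft_lincomb[OF Acirc_dpath[OF abK(1)] Acirc_dpath[OF abK(2)], of "fst p" "fst p" _ "1 - 1/2" "1/2"] qt[OF p]
          by (simp add: field_simps)
      qed }
    { fix D assume "D \<in> range C"
      then obtain k where k: "D = C k" by auto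
      have "y k \<in> C k" using y c by (simp add: C_def)
      then show "D \<noteq> {}" using k by auto }
    show "range C \<noteq> {}" by simp
    fix A B assume "A \<in> range C" "B \<in> range C"
    then obtain i j where "A = C i" "B = C j" by auto
    then show "\<exists>D\<in>range C. D \<subseteq> A \<inter> B" using Canti[of i "max i j"] Canti[of j "max i j"] by auto
  qed (use that in blast)
  obtain z where z: "\<And>n. z n \<in> C n" "AE p in M \<Otimes>\<^sub>M unif. (\<lambda>n. u (z n) p) \<longlonglongrightarrow> w p"
    using w[of C] by auto
  have "AE p in M \<Otimes>\<^sub>M unif. convergent (\<lambda>n. lft (\<lambda>s. z n s (fst p)) (q \<zeta> (fst p) (snd p)))"
    using z(2) by eventually_elim (auto simp: u_def convergent_def)
  moreover have "\<forall>n. z n \<in> K2 \<and> c \<le> J \<xi> (z n)" using z(1) unfolding C_def by blast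
  moreover have "\<forall>n t \<omega> a b. (\<forall>m\<ge>n. a \<le> y m t \<omega> \<and> y m t \<omega> \<le> b) \<longrightarrow> a \<le> z n t \<omega> \<and> z n t \<omega> \<le> b"
    using z(1) unfolding C_def by blast
  ultimately show ?thesis by blast
qed

text \<open>Along the refined sequence the payoffs converge to \<open>Y\<close>, which differs from
  the payoff at \<zeta> only where quantile times arrive strictly from the left. There the excess is
  at most minus the jump of \<open>g\<close> times one minus the left limit of \<xi>, and this has
  mean zero for every fixed level.\<close>

lemma J_usc:
  assumes \<xi>: "\<xi> \<in> Kc" "\<forall>\<omega>\<in>space M. \<xi> 0 \<omega> = 0" and y: "\<And>n. y n \<in> K2" and \<zeta>: "\<zeta> \<in> K2" and c: "\<And>n. c \<le> J \<xi> (y n)"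
    and Cy: "AE \<omega> in M. \<forall>t. 0 \<le> t \<longrightarrow> t < T \<longrightarrow> lft (\<lambda>s. \<zeta> s \<omega>) t = \<zeta> t \<omega> \<longrightarrow> (\<lambda>n. y n t \<omega>) \<longlonglongrightarrow> \<zeta> t \<omega>"
  shows "c \<le> J \<xi> \<zeta>"
proof -
  note \<xi>A = Kc_Acirc[OF \<xi>(1)]
  obtain z where z0: "\<forall>n. z n \<in> K2 \<and> c \<le> J \<xi> (z n)"
    and zy: "\<forall>n t \<omega> a b. (\<forall>m\<ge>n. a \<le> y m t \<omega> \<and> y m t \<omega> \<le> b) \<longrightarrow> a \<le> z n t \<omega> \<and> z n t \<omega> \<le> b"
    and conv: "AE p in M \<Otimes>\<^sub>M unif. convergent (\<lambda>n. lft (\<lambda>s. z n s (fst p)) (q \<zeta> (fst p) (snd p)))"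
    using convex_refinement[of \<xi> y \<zeta> c, OF \<xi>A y \<zeta> c] by (elim exE conjE) (rule that)
  have z: "z n \<in> K2" "c \<le> J \<xi> (z n)" for n using z0 by auto
  obtain N0 where N0: "N0 \<in> null_sets M"
    "{\<omega> \<in> space M. \<not> (\<forall>t. 0 \<le> t \<longrightarrow> t < T \<longrightarrow> lft (\<lambda>s. \<zeta> s \<omega>) t = \<zeta> t \<omega> \<longrightarrow> (\<lambda>n. y n t \<omega>) \<longlonglongrightarrow> \<zeta> t \<omega>)} \<subseteq> N0"
    using Cy by (auto simp: eventually_ae_filter)
  \<comment> \<open>The discarded null set belongs to the initial sigma-algebra, so intersecting
    with \<open>\<Omega>0\<close> keeps sets predictable, while convergence now holds for every
    remaining outcome.\<close>
  define \<Omega>0 where "\<Omega>0 = space M - N0"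
  have C: "(\<lambda>n. z n t \<omega>) \<longlonglongrightarrow> \<zeta> t \<omega>" if "\<omega> \<in> \<Omega>0" "0 \<le> t" "t < T" "lft (\<lambda>s. \<zeta> s \<omega>) t = \<zeta> t \<omega>" for t \<omega>
  proof -
    have yl: "(\<lambda>n. y n t \<omega>) \<longlonglongrightarrow> \<zeta> t \<omega>" using N0(2) that unfolding \<Omega>0_def by blast
    show ?thesis
    proof (rule LIMSEQ_I)
      fix r :: real assume "0 < r"
      then obtain k where k: "\<And>m. k \<le> m \<Longrightarrow> norm (y m t \<omega> - \<zeta> t \<omega>) < r / 2"
        using LIMSEQ_D[OF yl, of "r / 2"] by auto
      \<comment> \<open>A band around the limit that contains the tail of \<open>y\<close> also
        contains the tail of \<open>z\<close>; half of \<open>r\<close> makes the final inequality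
        strict.\<close>
      have "\<zeta> t \<omega> - r / 2 \<le> z n t \<omega> \<and> z n t \<omega> \<le> \<zeta> t \<omega> + r / 2" if "k \<le> n" for n
      proof (rule zy[rule_format])
        fix m assume "n \<le> m"
        then have "\<bar>y m t \<omega> - \<zeta> t \<omega>\<bar> < r / 2" using k[of m] that by simp
        then show "\<zeta> t \<omega> - r / 2 \<le> y m t \<omega> \<and> y m t \<omega> \<le> \<zeta> t \<omega> + r / 2" by (intro conjI; linarith)
      qed
      then show "\<exists>no. \<forall>n\<ge>no. norm (z n t \<omega> - \<zeta> t \<omega>) < r"
        using \<open>0 < r\<close> by (intro exI[of _ k]) (force simp: abs_less_iff)
    qed
  qed
  have \<Omega>0_AE: "AE \<omega> in M. \<omega> \<in> \<Omega>0" using N0 by (intro AE_I'[of N0]) (auto simp: \<Omega>0_def)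
  have \<Omega>0_F: "\<Omega>0 \<in> sets (F 0)"
  proof -
    have t0: "0 \<in> tset T" using T0 by (simp add: tset_iff)
    have "N0 \<in> sets (F 0)" using N0(1) nullF2 sub_filD(1)[OF sub2 filF2 t0] by blast
    moreover have "space M = space (F 0)" using filF t0 by (simp add: is_filtration_def)
    ultimately show ?thesis by (auto simp: \<Omega>0_def)
  qed
  then have \<Omega>0_M: "\<Omega>0 \<in> sets M" using fil_sets[OF T filF zero_tset[OF T filF]] by blast
  let ?\<tau> = "\<lambda>v \<omega>. q \<zeta> \<omega> v"
  let ?D = "\<lambda>\<omega> v. \<omega> \<in> \<Omega>0 \<and> ereal v < limsup_lft z (?\<tau> v \<omega>) \<omega>"
  define Y where "Y p = Yf \<zeta> (q \<xi> (fst p) (snd p)) (fst p) +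
     (if ?D (fst p) (snd p) then Xl \<xi> (?\<tau> (snd p) (fst p)) (fst p) else Xg \<xi> (?\<tau> (snd p) (fst p)) (fst p))" for p
  have q\<zeta>t: "0 \<le> q \<zeta> (fst p) (snd p) \<and> q \<zeta> (fst p) (snd p) \<le> T" if "p \<in> space (M \<Otimes>\<^sub>M unif)" for p
    using q_in[OF \<zeta>] that by (auto simp: space_pair_measure space_unif)
  have lftm: "(\<lambda>p. lft (\<lambda>s. \<rho> s (fst p)) (q \<zeta> (fst p) (snd p))) \<in> borel_measurable (M \<Otimes>\<^sub>M unif)"
    if "is_filtration M T G" "\<rho> \<in> Acirc M T G" for \<rho> G
    using Acirc_dpath[OF that(2)]
    by (intro measurable_lft[where r="\<lambda>t p. \<rho> t (fst p)", OF T _ _ q_meas[OF filF2 \<zeta>] q\<zeta>t]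
        measurable_compose[OF measurable_fst Acirc_measurable[OF that]])
      (auto simp: space_pair_measure)
  have Ym: "Y \<in> borel_measurable (M \<Otimes>\<^sub>M unif)"
  proof -
    have [measurable]: "(\<lambda>p. Yf \<zeta> (q \<xi> (fst p) (snd p)) (fst p)) \<in> borel_measurable (M \<Otimes>\<^sub>M unif)"
      using q_in[OF \<xi>A]
      by (intro Yf_eval_meas[OF filF2 \<zeta> q_meas[OF filF1 \<xi>A]]) (auto simp: space_pair_measure space_unif)
    have [measurable]: "(\<lambda>p. Xg \<xi> (q \<zeta> (fst p) (snd p)) (fst p)) \<in> borel_measurable (M \<Otimes>\<^sub>M unif)"
      using q\<zeta>t by (intro Xg_eval_meas[OF filF1 \<xi>A q_meas[OF filF2 \<zeta>]]) auto
    have [measurable]: "(\<lambda>p. lminus_reg g (q \<zeta> (fst p) (snd p)) (fst p)) \<in> borel_measurable (M \<Otimes>\<^sub>M unif)"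
      using q\<zeta>t by (intro lminus_reg_meas[OF g_cadlag g_prog q_meas[OF filF2 \<zeta>]]) auto
    note [measurable] = lftm[OF filF1 \<xi>A] lftm[OF filF2 z(1)]
    have [measurable]: "(\<lambda>p. limsup_lft z (q \<zeta> (fst p) (snd p)) (fst p)) \<in> borel_measurable (M \<Otimes>\<^sub>M unif)"
      unfolding limsup_lft_def by measurable
    note [measurable] = \<Omega>0_M measurable_compose[OF measurable_snd id_measurable_unif]
    show ?thesis unfolding Y_def Xl_def by measurable
  qed
  have "AE p in M \<Otimes>\<^sub>M unif. (\<lambda>n. pay \<xi> (z n) p) \<longlonglongrightarrow> Y p"
  proof (rule AE_pair_tendsto[OF prob_space_axioms prob_space_unif pay_meas[OF \<xi>A z(1)] Ym])
    show "AE \<omega> in M. AE v in unif. (\<lambda>n. pay \<xi> (z n) (\<omega>, v)) \<longlonglongrightarrow> Y (\<omega>, v)"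
      using \<Omega>0_AE P.AE_pair[OF conv]
    proof eventually_elim
      case (elim \<omega>)
      then have \<omega>: "\<omega> \<in> space M" by (simp add: \<Omega>0_def)
      \<comment> \<open>For this outcome three countable sets of levels are discarded, one for each
        of the limit statements that follow.\<close>
      have cnt: "countable (range (\<lambda>r. \<zeta> (ereal (real_of_rat r)) \<omega>))"
        "countable ((\<lambda>s. real_of_ereal (limsup_lft z s \<omega>)) ` insert T {t. 0 < t \<and> t \<le> T \<and> Lim (at_left t) (\<lambda>s. g s \<omega>) \<noteq> g t \<omega>})"
        "countable ((\<lambda>s. \<xi> s \<omega>) ` {t. 0 \<le> t \<and> t \<le> T \<and> lft (\<lambda>s. \<zeta> s \<omega>) t \<noteq> \<zeta> t \<omega>})"
        using countable_cadlag_jumps[OF g_cadlag[OF \<omega>]] countable_dpath_jumps[OF Acirc_dpath[OF \<zeta> \<omega>]]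
        by (auto intro!: countable_image)
      show ?case
        using elim(2) AE_unif_not_in_countable[OF cnt(1)] AE_unif_not_in_countable[OF cnt(2)]
          AE_unif_not_in_countable[OF cnt(3)] AE_space
      proof eventually_elim
        case (elim v)
        then have v: "0 < v" "v < 1" by (auto simp: space_unif)
        have lim: "(\<lambda>n. q (z n) \<omega> v) \<longlonglongrightarrow> q \<zeta> \<omega> v"
          using C[OF \<open>\<omega> \<in> \<Omega>0\<close>] elim(2) v by (intro qtl_tendsto[OF T Acirc_dpath[OF \<zeta> \<omega>] Acirc_dpath[OF z(1) \<omega>]]) auto
        have "(\<lambda>n. Xg \<xi> (q (z n) \<omega> v) \<omega>) \<longlonglongrightarrow> (if ?D \<omega> v then Xl \<xi> (?\<tau> v \<omega>) \<omega> else Xg \<xi> (?\<tau> v \<omega>) \<omega>)"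
          using Xg_qtl_tendsto[OF \<omega> \<xi>(1) z(1) \<zeta> v lim _ elim(3)] elim(1) \<open>\<omega> \<in> \<Omega>0\<close> by simp
        moreover have "(\<lambda>n. Yf (z n) (q \<xi> \<omega> v) \<omega>) \<longlonglongrightarrow> Yf \<zeta> (q \<xi> \<omega> v) \<omega>"
          using C[OF \<open>\<omega> \<in> \<Omega>0\<close>] elim(4) \<xi> \<omega> v by (intro Yf_tendsto) auto
        ultimately have "(\<lambda>n. Yf (z n) (q \<xi> \<omega> v) \<omega> + Xg \<xi> (q (z n) \<omega> v) \<omega>) \<longlonglongrightarrow> Y (\<omega>, v)"
          unfolding Y_def fst_conv snd_conv by (rule tendsto_add[rotated])
        then show ?case using \<xi>(2) \<omega> by (simp add: pay_def)
      qed
    qed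
  qed
  then have Yi: "integrable (M \<Otimes>\<^sub>M unif) Y" and lim: "(\<lambda>n. J \<xi> (z n)) \<longlonglongrightarrow> (\<integral>p. Y p \<partial>(M \<Otimes>\<^sub>M unif))"
    unfolding J_def
    using integrable_dominated_convergence[OF Ym pay_meas[OF \<xi>A z(1)] dom_fst_integrable]
      integral_dominated_convergence[OF Ym pay_meas[OF \<xi>A z(1)] dom_fst_integrable] pay_dom[OF \<xi>A z(1)]
    by auto
  have cY: "c \<le> (\<integral>p. Y p \<partial>(M \<Otimes>\<^sub>M unif))" using LIMSEQ_le_const[OF lim] z(2) by auto
  define V where "V p = Y p - pay \<xi> \<zeta> p" for p
  have Vi: "integrable (M \<Otimes>\<^sub>M unif) V"
    unfolding V_def[abs_def] by (rule Bochner_Integration.integrable_diff[OF Yi pay_integrable[OF \<xi>A \<zeta>]])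
  \<comment> \<open>The level is fixed here, since only then is the quantile time of \<zeta> a
    stopping time.\<close>
  have Vle: "(\<integral>\<omega>. V (\<omega>, v) \<partial>M) \<le> 0" if v: "0 < v" "v < 1" for v
  proof -
    define D where "D = {(t, \<omega>) \<in> tset T \<times> space M. \<omega> \<in> \<Omega>0 \<and> ereal v < limsup_lft z t \<omega>}"
    have st: "stopping_time_on M T F (?\<tau> v)"
      using v by (intro qtl_stopping_time[OF T filF sub_filD[OF sub2 filF2] \<zeta>]) auto
    have Dp: "D \<in> sets (predictable_sigma M T F)"
    proof -
      note [measurable] = predictable_lft[OF T filF sub_filD[OF sub2 filF2] z(1)]
      have [measurable]: "(\<lambda>p. limsup_lft z (fst p) (snd p)) \<in> borel_measurable (predictable_sigma M T F)"
        unfolding limsup_lft_def by measurable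
      have "{p \<in> space (predictable_sigma M T F). ereal v < limsup_lft z (fst p) (snd p)} \<inter> (tset T \<times> \<Omega>0) \<in> sets (predictable_sigma M T F)"
        by (intro sets.Int predictable_const[OF T filF \<Omega>0_F]) measurable
      also have "{p \<in> space (predictable_sigma M T F). ereal v < limsup_lft z (fst p) (snd p)} \<inter> (tset T \<times> \<Omega>0) = D"
        by (auto simp: D_def space_predictable[OF T filF] \<Omega>0_def)
      finally show ?thesis .
    qed
    \<comment> \<open>Before the quantile time \<zeta> is below \<open>v\<close>, and a continuity
      time in between bounds all left limits at \<open>t\<close> by values converging to something
      below \<open>v\<close>.\<close>
    have after: "?\<tau> v \<omega> \<le> t" if "(t, \<omega>) \<in> D" for t \<omega>
    proof (rule ccontr)
      assume "\<not> ?\<tau> v \<omega> \<le> t"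
      then have lt: "t < ?\<tau> v \<omega>" by simp
      have t: "0 \<le> t" "\<omega> \<in> space M" "\<omega> \<in> \<Omega>0" "ereal v < limsup_lft z t \<omega>" using that by (auto simp: D_def tset_iff)
      have \<tau>T: "?\<tau> v \<omega> \<le> T" using q_in[OF \<zeta> t(2) v] by simp
      obtain r where r: "t < r" "r < ?\<tau> v \<omega>" "lft (\<lambda>s. \<zeta> s \<omega>) r = \<zeta> r \<omega>"
        using exists_continuity_point[OF Acirc_dpath[OF \<zeta> t(2)] t(1) lt \<tau>T] by blast
      have r': "0 \<le> r" "r < T" using r t \<tau>T by auto
      have "\<zeta> r \<omega> < v" using less_qtl_iff[OF T Acirc_dpath[OF \<zeta> t(2)], of v r] r r' v by auto
      moreover have "limsup_lft z t \<omega> \<le> ereal (\<zeta> r \<omega>)"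
      proof -
        have "lft (\<lambda>s. z n s \<omega>) t \<le> z n r \<omega>" for n
          using lft_le[OF Acirc_dpath[OF z(1) t(2)], of t n] dpath_mono[OF Acirc_dpath[OF z(1) t(2)], of t r n] t(1) r r'
          by (meson less_imp_le order_trans)
        then have "limsup_lft z t \<omega> \<le> limsup (\<lambda>n. ereal (z n r \<omega>))"
          unfolding limsup_lft_def by (intro Limsup_mono always_eventually) auto
        also have "\<dots> = ereal (\<zeta> r \<omega>)" using C[OF t(3) r' r(3)] by (intro lim_imp_Limsup) auto
        finally show ?thesis .
      qed
      ultimately show False using t(4) by (metis ereal_less_eq(3) leD le_less_trans less_imp_le not_le order_trans)
    qed
    note reg = regular_jump_integral[OF st Dp after \<xi>A]
    have inD: "(?\<tau> v \<omega>, \<omega>) \<in> D \<longleftrightarrow> ?D \<omega> v" if "\<omega> \<in> space M" for \<omega>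
      using q_in[OF \<zeta> that v] that by (auto simp: D_def tset_iff)
    let ?W = "\<lambda>\<omega>. if (?\<tau> v \<omega>, \<omega>) \<in> D then (1 - lft (\<lambda>s. \<xi> s \<omega>) (?\<tau> v \<omega>)) * (g (?\<tau> v \<omega>) \<omega> - lminus_reg g (?\<tau> v \<omega>) \<omega>) else 0"
    have Vb: "V (\<omega>, v) \<le> - ?W \<omega> \<and> \<bar>V (\<omega>, v)\<bar> \<le> 2 * dom \<omega>" if g: "good \<omega>" for \<omega>
    proof -
      have \<omega>: "\<omega> \<in> space M" using g by (simp add: good_def)
      let ?t = "?\<tau> v \<omega>"
      have t: "0 \<le> ?t" "?t \<le> T" using q_in[OF \<zeta> \<omega> v] by auto
      have Veq: "V (\<omega>, v) = (if ?D \<omega> v then Xl \<xi> ?t \<omega> - Xg \<xi> ?t \<omega> else 0)"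
        using \<xi>(2) \<omega> by (simp add: V_def Y_def pay_def)
      have l: "0 \<le> 1 - lft (\<lambda>s. \<xi> s \<omega>) ?t" using lft_le_1[OF Acirc_dpath[OF \<xi>A \<omega>] t] by simp
      have "V (\<omega>, v) \<le> - ?W \<omega>"
      proof (cases "?D \<omega> v")
        case True
        have "?t \<noteq> 0"
        proof
          assume "?t = 0"
          then have "limsup_lft z ?t \<omega> = 0" by (simp add: limsup_lft_def lft_def Limsup_const zero_ereal_def)
          then show False using True v by simp
        qed
        \<comment> \<open>In the interior \<xi> is continuous, which gives equality; at
          \<open>T\<close> the payoff uses \<open>h\<close>, which dominates
          \<open>g\<close>.\<close>
        have "g ?t \<omega> * (1 - lft (\<lambda>s. \<xi> s \<omega>) ?t) \<le> Xg \<xi> ?t \<omega>"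
        proof (cases "?t < T")
          case True
          then have "lft (\<lambda>s. \<xi> s \<omega>) ?t = \<xi> ?t \<omega>" using \<xi>(1) \<omega> t \<open>?t \<noteq> 0\<close> by (auto simp: Kc_def)
          then show ?thesis using True by (simp add: Xg_def)
        next
          case False
          then have "?t = T" using t by auto
          then show ?thesis using goodD(4)[OF g t] l by (auto simp: Xg_def intro!: mult_right_mono)
        qed
        then show ?thesis using True inD[OF \<omega>] by (simp add: Veq Xl_def algebra_simps)
      next
        case False then show ?thesis using inD[OF \<omega>] by (auto simp: Veq)
      qed
      moreover have "\<bar>V (\<omega>, v)\<bar> \<le> 2 * dom \<omega>"
        using Xl_bound[OF g \<xi>A t] Xg_bound[OF g \<xi>A t] goodD(6)[OF g t] by (auto simp: Veq)
      ultimately show ?thesis by blast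
    qed
    have "integrable M (\<lambda>\<omega>. V (\<omega>, v))"
    proof (rule Bochner_Integration.integrable_bound[of M "\<lambda>\<omega>. 2 * dom \<omega>"])
      have "V \<in> borel_measurable (M \<Otimes>\<^sub>M unif)" using Vi by simp
      moreover have "(\<lambda>\<omega>. (\<omega>, v)) \<in> M \<rightarrow>\<^sub>M M \<Otimes>\<^sub>M unif"
        by (rule measurable_Pair2') (use v in \<open>simp add: space_unif\<close>)
      ultimately show "(\<lambda>\<omega>. V (\<omega>, v)) \<in> borel_measurable M" by (rule measurable_compose[rotated])
      show "AE \<omega> in M. norm (V (\<omega>, v)) \<le> norm (2 * dom \<omega>)" using good_AE by eventually_elim (use Vb in force)
    qed (use dom_integrable in auto)
    then have "(\<integral>\<omega>. V (\<omega>, v) \<partial>M) \<le> (\<integral>\<omega>. - ?W \<omega> \<partial>M)"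
    proof (rule integral_mono_AE)
      show "integrable M (\<lambda>\<omega>. - ?W \<omega>)" using reg(1) by (rule Bochner_Integration.integrable_minus)
      show "AE \<omega> in M. V (\<omega>, v) \<le> - ?W \<omega>" using good_AE by eventually_elim (rule Vb[THEN conjunct1])
    qed
    also have "\<dots> = 0" using reg by simp
    finally show ?thesis .
  qed
  \<comment> \<open>Fubini with the level integrated last.\<close>
  have "(\<integral>p. V p \<partial>(M \<Otimes>\<^sub>M unif)) = (\<integral>v. (\<integral>\<omega>. V (\<omega>, v) \<partial>M) \<partial>unif)"
    using P.integral_snd[of "\<lambda>\<omega> v. V (\<omega>, v)"] Vi by simp
  also have "\<dots> \<le> (\<integral>v. 0 \<partial>unif)"
    using P.integrable_snd[of "\<lambda>\<omega> v. V (\<omega>, v)"] Vi Vle by (intro integral_mono) (auto simp: space_unif)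
  finally have "(\<integral>p. Y p \<partial>(M \<Otimes>\<^sub>M unif)) \<le> J \<xi> \<zeta>"
    unfolding V_def[abs_def] J_def using Yi pay_integrable[OF \<xi>A \<zeta>] by simp
  with cY show ?thesis by simp
qed

end

section \<open>Existence of an optimal control and the minimax identity\<close>

lemma mono_path_left_limit:
  fixes x :: "ereal \<Rightarrow> real"
  assumes m: "\<And>r s. 0 \<le> r \<Longrightarrow> r \<le> s \<Longrightarrow> s \<le> T \<Longrightarrow> x r \<le> x s" and t: "0 < t" "t \<le> T"
  shows "\<exists>l. (x \<longlongrightarrow> l) (at_left t)"
proof
  have bdd: "bdd_above (x ` {0..<t})" using m t by (intro bdd_aboveI[of _ "x t"]) auto
  show "(x \<longlongrightarrow> (SUP s\<in>{0..<t}. x s)) (at_left t)"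
  proof (rule increasing_tendsto)
    show "\<forall>\<^sub>F s in at_left t. x s \<le> (SUP s\<in>{0..<t}. x s)"
      unfolding eventually_at_left[OF t(1)] using t
      by (intro exI[of _ 0]) (auto intro!: cSUP_upper[OF _ bdd])
    fix a assume "a < (SUP s\<in>{0..<t}. x s)"
    then obtain r where r: "0 \<le> r" "r < t" "a < x r" using t by (subst (asm) less_cSUP_iff[OF _ bdd]) auto
    show "\<forall>\<^sub>F s in at_left t. a < x s"
      unfolding eventually_at_left[OF t(1)] using r t m
      by (intro exI[of _ r]) (auto intro: less_le_trans)
  qed
qed

text \<open>The control acting only at \<open>T\<close>; it witnesses that the control sets of both
  players are nonempty.\<close>

lemma terminal_Acirc:
  assumes T: "0 < T"
  shows "(\<lambda>t \<omega>. if T \<le> t then 1 else 0) \<in> Acirc M T G"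
proof -
  have "cadlag_path T (\<lambda>t. if T \<le> t then 1 else 0 :: real)"
    unfolding cadlag_path_def
  proof (intro conjI ballI impI)
    fix t assume "t < T"
    have "\<forall>\<^sub>F s in at_right t. (if T \<le> s then 1 else 0 :: real) = 0"
      unfolding eventually_at_right[OF \<open>t < T\<close>] using \<open>t < T\<close> by (intro exI[of _ T]) auto
    then show "((\<lambda>t. if T \<le> t then 1 else 0) \<longlongrightarrow> (if T \<le> t then 1 else 0 :: real)) (at_right t)"
      using \<open>t < T\<close> by (auto intro: tendsto_eventually)
  next
    fix t assume "t \<in> tset T" "0 < t"
    then show "\<exists>l. ((\<lambda>t. if T \<le> t then 1 else 0 :: real) \<longlongrightarrow> l) (at_left t)"
      by (intro mono_path_left_limit[where T=T]) (auto simp: tset_iff)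
  qed
  then show ?thesis using T by (auto simp: Acirc_def adapted_def intro!: mono_onI)
qed

text \<open>A countable dense set of times; the absolute value and the cap at \<open>T\<close> turn
  every index into a time in \<open>[0,T]\<close>.\<close>

definition ratime :: "ereal \<Rightarrow> nat \<Rightarrow> ereal" where
  "ratime T k = min T (ereal \<bar>real_of_rat (from_nat k)\<bar>)"

lemma ratime_bounds: "0 \<le> T \<Longrightarrow> 0 \<le> ratime T k \<and> ratime T k \<le> T"
  by (simp add: ratime_def)

lemma ratime_dense:
  assumes "0 \<le> a" "a < b" "b \<le> T"
  obtains k where "a < ratime T k" "ratime T k < b"
proof -
  obtain r where r: "a < ereal (real_of_rat r)" "ereal (real_of_rat r) < b" using ereal_dense3[OF assms(2)] by auto
  have "0 \<le> ereal (real_of_rat r)" using assms(1) r(1) by (meson le_less_trans less_imp_le)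
  then have "\<bar>real_of_rat r\<bar> = real_of_rat r" by simp
  moreover have "ereal (real_of_rat r) \<le> T" using r(2) assms(3) by (meson less_imp_le less_le_trans)
  ultimately have "ratime T (to_nat r) = ereal (real_of_rat r)" by (simp add: ratime_def min_absorb2)
  then show thesis using that[of "to_nat r"] r by simp
qed

section \<open>The limit control and the value of the game\<close>

context dynkin_game
begin

definition K1 :: "(ereal \<Rightarrow> 'a \<Rightarrow> real) set" where
  "K1 = {\<xi> \<in> Acirc_ac M T F1. \<forall>\<omega>\<in>space M. \<xi> 0 \<omega> = 0}"

lemma K1_Kc: "\<xi> \<in> K1 \<Longrightarrow> \<xi> \<in> Kc" and K1_Acirc: "\<xi> \<in> K1 \<Longrightarrow> \<xi> \<in> Acirc M T F1"
  using Acirc_ac_Kc Kc_Acirc by (auto simp: K1_def)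

lemma K1_nonempty: "K1 \<noteq> {}"
proof -
  have "(\<lambda>t \<omega>. if T \<le> t then 1 else 0) \<in> K1"
    unfolding K1_def Acirc_ac_def
  proof (intro CollectI conjI ballI terminal_Acirc[OF T])
    have z: "(if T \<le> ereal x then 1 else 0 :: real) = 0" if "x \<in> below_T T" for x using that by (auto simp: below_T_def)
    show "abs_cont_on (below_T T) (\<lambda>x. if T \<le> ereal x then 1 else 0)"
      by (rule abs_cont_on_dominated[OF abs_cont_on_linear[of 1] abs_cont_on_linear[of 1]]) (auto simp: z)
  qed (use T in auto)
  then show ?thesis by auto
qed

lemma K2_nonempty: "K2 \<noteq> {}"
  using terminal_Acirc[OF T, of M F2] by auto

lemma K1_mix:
  assumes "\<xi> \<in> K1" "\<xi>' \<in> K1" "0 \<le> l" "l \<le> 1"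
  shows "mixp l \<xi> \<xi>' \<in> K1"
proof -
  have "abs_cont_on (below_T T) (\<lambda>x. mixp l \<xi> \<xi>' (ereal x) \<omega>)" if "\<omega> \<in> space M" for \<omega>
  proof (rule abs_cont_on_dominated)
    show "abs_cont_on (below_T T) (\<lambda>x. \<xi> (ereal x) \<omega>)" "abs_cont_on (below_T T) (\<lambda>x. \<xi>' (ereal x) \<omega>)"
      using assms that by (auto simp: K1_def Acirc_ac_def)
    fix a b :: real
    have "mixp l \<xi> \<xi>' (ereal b) \<omega> - mixp l \<xi> \<xi>' (ereal a) \<omega> =
      (\<xi> (ereal b) \<omega> - \<xi> (ereal a) \<omega>) * (1 - l) + (\<xi>' (ereal b) \<omega> - \<xi>' (ereal a) \<omega>) * l"
      by (simp add: mixp_def algebra_simps)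
    then show "\<bar>mixp l \<xi> \<xi>' (ereal b) \<omega> - mixp l \<xi> \<xi>' (ereal a) \<omega>\<bar>
        \<le> \<bar>\<xi> (ereal b) \<omega> - \<xi> (ereal a) \<omega>\<bar> + \<bar>\<xi>' (ereal b) \<omega> - \<xi>' (ereal a) \<omega>\<bar>"
      using abs_mult_le[of "\<xi> (ereal b) \<omega> - \<xi> (ereal a) \<omega>" _ "1 - l", OF order_refl]
        abs_mult_le[of "\<xi>' (ereal b) \<omega> - \<xi>' (ereal a) \<omega>" _ l, OF order_refl] assms(3,4) by simp
  qed
  then show ?thesis
    using Acirc_mix[OF T K1_Acirc[OF assms(1)] K1_Acirc[OF assms(2)] assms(3,4)] assms(1,2)
    by (auto simp: K1_def Acirc_ac_def) (simp add: mixp_def)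
qed

text \<open>Only controls starting at 0 enter the infimum. That it is also the value over all of
  \<open>Acirc_ac\<close> results from \<open>J_spread_le\<close> through
  \<open>optimal_control\<close>.\<close>

definition V :: real where
  "V = (INF \<xi>\<in>K1. SUP \<zeta>\<in>K2. J \<xi> \<zeta>)"

lemma J_bdd: "\<xi> \<in> Acirc M T F1 \<Longrightarrow> bdd_above (J \<xi> ` K2)"
  by (rule bdd_aboveI[of _ "\<integral>p. 3 * dom (fst p) \<partial>(M \<Otimes>\<^sub>M unif)"]) (use J_bound in force)

lemma SUP_bdd: "bdd_below ((\<lambda>\<xi>. SUP \<zeta>\<in>K2. J \<xi> \<zeta>) ` K1)"
proof (rule bdd_belowI2)
  fix \<xi> assume "\<xi> \<in> K1"
  then have \<xi>: "\<xi> \<in> Acirc M T F1" by (rule K1_Acirc)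
  obtain \<zeta> where "\<zeta> \<in> K2" using K2_nonempty by auto
  then have "- (\<integral>p. 3 * dom (fst p) \<partial>(M \<Otimes>\<^sub>M unif)) \<le> J \<xi> \<zeta>" using J_bound[OF \<xi>, of \<zeta>] by linarith
  also have "\<dots> \<le> (SUP \<zeta>\<in>K2. J \<xi> \<zeta>)" by (rule cSUP_upper[OF \<open>\<zeta> \<in> K2\<close> J_bdd[OF \<xi>]])
  finally show "- (\<integral>p. 3 * dom (fst p) \<partial>(M \<Otimes>\<^sub>M unif)) \<le> (SUP \<zeta>\<in>K2. J \<xi> \<zeta>)" .
qed

text \<open>Otherwise \<open>finite_minimax\<close> would merge the finitely many controls of
  \<open>A\<close> into one that keeps the payoff at most \<open>c\<close> against all of
  \<open>K2\<close>, contrary to \<open>c < V\<close>.\<close>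

lemma finite_intersection:
  assumes A: "finite A" "A \<noteq> {}" "A \<subseteq> K1" and c: "c < V"
  shows "{\<zeta> \<in> K2. \<forall>\<xi>\<in>A. c < J \<xi> \<zeta>} \<noteq> {}"
proof
  assume e: "{\<zeta> \<in> K2. \<forall>\<xi>\<in>A. c < J \<xi> \<zeta>} = {}"
  have "\<exists>b\<in>K1. \<forall>z\<in>K2. J b z \<le> c"
  proof (rule finite_minimax[of K1 K2 mixp J mixp A K2 c])
    show "mixp l i j \<in> K1 \<and> J (mixp l i j) z = (1 - l) * J i z + l * J j z"
      if "0 \<le> l" "l \<le> 1" "i \<in> K1" "j \<in> K1" "z \<in> K2" for l i j z
      using K1_mix J_mix1 K1_Acirc that by auto
    show "J i (mixp l z z') = (1 - l) * J i z + l * J i z'"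
      if "0 \<le> l" "l \<le> 1" "i \<in> K1" "z \<in> K2" "z' \<in> K2" for l i z z'
      using J_mix2 K1_Acirc that by auto
    show "mixp l z z' \<in> K2" if "0 \<le> l" "l \<le> 1" "z \<in> K2" "z' \<in> K2" for l z z'
      using Acirc_mix[OF T that(3,4,1,2)] .
    show "\<exists>i\<in>A. J i z \<le> c" if "z \<in> K2" for z using e that by (force simp: not_less)
  qed (use A in auto)
  then obtain b where b: "b \<in> K1" "\<And>z. z \<in> K2 \<Longrightarrow> J b z \<le> c" by auto
  have "V \<le> (SUP \<zeta>\<in>K2. J b \<zeta>)" unfolding V_def by (rule cINF_lower[OF SUP_bdd b(1)])
  also have "\<dots> \<le> c" using b(2) K2_nonempty by (intro cSUP_least) auto
  finally show False using c by simp
qed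

text \<open>Up to a null set the limit control is determined by \<open>w\<close> alone: at
  \<open>t < T\<close> it is the infimum of \<open>w\<close> over the listed times after
  \<open>t\<close>. Hence every sequence with these limits converges to it where it is continuous,
  which allows one \<zeta> to be paired with many sequences. The sequence \<open>y\<close> serves to
  make it adapted.\<close>

lemma limit_control:
  assumes y: "\<And>n. y n \<in> K2" and lim: "AE \<omega> in M. \<forall>k. (\<lambda>n. y n (ratime T k) \<omega>) \<longlonglongrightarrow> w k \<omega>"
  shows "\<exists>\<zeta>\<in>K2. \<forall>y'. (\<forall>n. y' n \<in> K2) \<longrightarrow> (AE \<omega> in M. \<forall>k. (\<lambda>n. y' n (ratime T k) \<omega>) \<longlonglongrightarrow> w k \<omega>) \<longrightarrow>
      (AE \<omega> in M. \<forall>t. 0 \<le> t \<longrightarrow> t < T \<longrightarrow> lft (\<lambda>s. \<zeta> s \<omega>) t = \<zeta> t \<omega> \<longrightarrow> (\<lambda>n. y' n t \<omega>) \<longlonglongrightarrow> \<zeta> t \<omega>)"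
proof -
  let ?r = "ratime T"
  have rb: "0 \<le> ?r k" "?r k \<le> T" for k using ratime_bounds[OF T0] by auto
  obtain N0 where N0: "N0 \<in> null_sets M" "{\<omega> \<in> space M. \<not> (\<forall>k. (\<lambda>n. y n (?r k) \<omega>) \<longlonglongrightarrow> w k \<omega>)} \<subseteq> N0"
    using lim by (auto simp: eventually_ae_filter)
  define \<Omega>1 where "\<Omega>1 = space M - N0"
  have \<Omega>1_AE: "AE \<omega> in M. \<omega> \<in> \<Omega>1" using N0 by (intro AE_I'[of N0]) (auto simp: \<Omega>1_def)
  have sp: "space (F2 t) = space M" if "0 \<le> t" "t \<le> T" for t using filF2 that by (simp add: is_filtration_def tset_iff)
  have \<Omega>1_F: "\<Omega>1 \<in> sets (F2 t)" if t: "0 \<le> t" "t \<le> T" for t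
  proof -
    have "N0 \<in> sets (F2 0)" using N0(1) nullF2 by blast
    then have "N0 \<in> sets (F2 t)" using fil_mono[OF T filF2, of 0 t] t T0 by (auto simp: tset_iff)
    then show ?thesis unfolding \<Omega>1_def sp[OF t, symmetric] by auto
  qed
  have yw: "(\<lambda>n. y n (?r k) \<omega>) \<longlonglongrightarrow> w k \<omega>" if "\<omega> \<in> \<Omega>1" for \<omega> k using N0(2) that unfolding \<Omega>1_def by blast
  have \<Omega>1_sp: "\<omega> \<in> space M" if "\<omega> \<in> \<Omega>1" for \<omega> using that by (simp add: \<Omega>1_def)
  \<comment> \<open>\<open>w\<close> carries no measurability, but on \<open>\<Omega>1\<close> it
    agrees with a pointwise limit of adapted values.\<close>
  define W where "W k \<omega> = lim (\<lambda>n. y n (?r k) \<omega>)" for k \<omega>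
  have W: "W k \<omega> = w k \<omega>" if "\<omega> \<in> \<Omega>1" for k \<omega> unfolding W_def by (rule limI[OF yw[OF that]])
  have Wm: "W k \<in> borel_measurable (F2 s)" if "?r k \<le> s" "s \<le> T" for k s
  proof -
    have "y n (?r k) \<in> borel_measurable (F2 s)" for n
    proof -
      have m: "y n (?r k) \<in> borel_measurable (F2 (?r k))" using y[of n] rb by (auto simp: Acirc_def adapted_def tset_iff)
      have "0 \<le> s" using rb(1)[of k] that by (meson order_trans)
      then have "subalgebra (F2 s) (F2 (?r k))"
        using filF2 rb that unfolding is_filtration_def subalgebra_def by (simp add: tset_iff)
      from measurable_from_subalg[OF this m] show ?thesis .
    qed
    then show ?thesis unfolding W_def[abs_def] by (rule borel_measurable_lim_metric)
  qed
  have w0: "0 \<le> w k \<omega>" "w k \<omega> \<le> 1" if "\<omega> \<in> \<Omega>1" for k \<omega>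
    using LIMSEQ_le_const[OF yw[OF that]] LIMSEQ_le_const2[OF yw[OF that]]
      dpath_nonneg[OF Acirc_dpath[OF y \<Omega>1_sp[OF that]] rb] dpath_le_1[OF Acirc_dpath[OF y \<Omega>1_sp[OF that]] rb] by auto
  have wmono: "w j \<omega> \<le> w k \<omega>" if "\<omega> \<in> \<Omega>1" "?r j \<le> ?r k" for j k \<omega>
    using LIMSEQ_le[OF yw[OF that(1)] yw[OF that(1)]]
      dpath_mono[OF Acirc_dpath[OF y \<Omega>1_sp[OF that(1)]] rb(1) that(2) rb(2)] by blast
  \<comment> \<open>Off \<open>\<Omega>1\<close> the constant 1 is taken, which is an admissible
    path; the exceptional set is null and so lies in every \<open>F2 t\<close>.\<close>
  define \<zeta> where "\<zeta> t \<omega> = (if T \<le> t then 1 else if \<omega> \<in> \<Omega>1 then INF k\<in>{k. t < ?r k}. W k \<omega> else 1)" for t \<omega>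
  have bb: "bdd_below ((\<lambda>k. W k \<omega>) ` A)" if "\<omega> \<in> \<Omega>1" for A \<omega>
    using w0[OF that] W[OF that] by (intro bdd_belowI[of _ 0]) auto
  have \<zeta>_le: "\<zeta> t \<omega> \<le> w k \<omega>" if "\<omega> \<in> \<Omega>1" "t < ?r k" for t k \<omega>
  proof -
    have "\<not> T \<le> t" using that(2) rb(2)[of k] by auto
    then have "\<zeta> t \<omega> \<le> W k \<omega>" using that by (auto simp: \<zeta>_def intro!: cINF_lower bb)
    then show ?thesis using W[OF that(1)] by simp
  qed
  have ne: "{k. t < ?r k} \<noteq> {}" if "0 \<le> t" "t < T" for t
    using ratime_dense[OF that order_refl] by blast
  have \<zeta>_less: "\<exists>k. t < ?r k \<and> w k \<omega> < b" if "\<omega> \<in> \<Omega>1" "0 \<le> t" "t < T" "\<zeta> t \<omega> < b" for t \<omega> b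
  proof -
    have "(INF k\<in>{k. t < ?r k}. W k \<omega>) < b"
      using that not_le[THEN iffD2, OF that(3)] by (simp add: \<zeta>_def)
    then show ?thesis using W[OF that(1)] by (subst (asm) cINF_less_iff[OF ne[OF that(2,3)] bb[OF that(1)]]) auto
  qed
  have \<zeta>_0: "0 \<le> \<zeta> t \<omega>" if t: "0 \<le> t" for t \<omega>
    using w0 W ne[OF t] unfolding \<zeta>_def by (auto simp: not_le intro!: cINF_greatest)
  have \<zeta>_1: "\<zeta> t \<omega> \<le> 1" if t: "0 \<le> t" for t \<omega>
  proof (cases "t < T \<and> \<omega> \<in> \<Omega>1")
    case True
    then obtain k where "t < ?r k" using ne[OF t] by auto
    then show ?thesis using \<zeta>_le[of \<omega> t k] w0(2)[of \<omega> k] True by auto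
  qed (auto simp: \<zeta>_def not_less)
  have \<zeta>_mono: "\<zeta> s \<omega> \<le> \<zeta> t \<omega>" if st: "0 \<le> s" "s \<le> t" for s t \<omega>
  proof (cases "t < T \<and> \<omega> \<in> \<Omega>1")
    case True
    then have "s < T" using st by auto
    have "\<zeta> s \<omega> = (INF k\<in>{k. s < ?r k}. W k \<omega>)" using True \<open>s < T\<close> by (simp add: \<zeta>_def not_le)
    also have "\<dots> \<le> (INF k\<in>{k. t < ?r k}. W k \<omega>)"
      using ne[of t] st True bb by (intro cINF_superset_mono) auto
    also have "\<dots> = \<zeta> t \<omega>" using True by (auto simp: \<zeta>_def)
    finally show ?thesis .
  next
    case False
    then have "\<zeta> t \<omega> = 1" by (auto simp: \<zeta>_def not_less)
    then show ?thesis using \<zeta>_1[OF st(1)] by simp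
  qed
  have \<zeta>K: "\<zeta> \<in> K2"
  proof -
    have "adapted T F2 \<zeta>" unfolding adapted_def
    proof
      fix t assume "t \<in> tset T"
      then have t: "0 \<le> t" "t \<le> T" by (auto simp: tset_iff)
      show "\<zeta> t \<in> borel_measurable (F2 t)"
      proof (cases "t < T")
        case False
        then show ?thesis by (simp add: \<zeta>_def[abs_def] not_less)
      next
        case True
        \<comment> \<open>The infimum is decided by the listed times in \<open>(t, s]\<close>, as
          \<open>w\<close> increases with time; so \<open>\<zeta> t\<close> is known at every
          \<open>s > t\<close>, and right continuity of the filtration brings this back to
          \<open>t\<close>.\<close>
        have ms: "\<zeta> t \<in> borel_measurable (F2 s)" if s: "t < s" "s \<le> T" for s
        proof -
          let ?A = "{k. t < ?r k \<and> ?r k \<le> s}"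
          obtain j where j: "t < ?r j" "?r j < s" using ratime_dense[OF t(1) s] .
          have eq: "\<zeta> t \<omega> = (if \<omega> \<in> \<Omega>1 then INF k\<in>?A. W k \<omega> else 1)" for \<omega>
          proof (cases "\<omega> \<in> \<Omega>1")
            case \<omega>: True
            have "(INF k\<in>{k. t < ?r k}. W k \<omega>) = (INF k\<in>?A. W k \<omega>)"
            proof (rule antisym)
              show "(INF k\<in>{k. t < ?r k}. W k \<omega>) \<le> (INF k\<in>?A. W k \<omega>)"
                using j bb[OF \<omega>] by (intro cINF_superset_mono) (auto intro: less_imp_le)
              show "(INF k\<in>?A. W k \<omega>) \<le> (INF k\<in>{k. t < ?r k}. W k \<omega>)"
              proof (rule cINF_greatest[OF ne[OF t(1) True]])
                fix k assume k: "k \<in> {k. t < ?r k}"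
                show "(INF k\<in>?A. W k \<omega>) \<le> W k \<omega>"
                proof (cases "?r k \<le> s")
                  case True then show ?thesis using k by (intro cINF_lower bb[OF \<omega>]) auto
                next
                  case False
                  then have "W j \<omega> \<le> W k \<omega>" using wmono[OF \<omega>, of j k] W[OF \<omega>] j by auto
                  moreover have "(INF k\<in>?A. W k \<omega>) \<le> W j \<omega>" using j by (intro cINF_lower bb[OF \<omega>]) auto
                  ultimately show ?thesis by linarith
                qed
              qed
            qed
            then show ?thesis using \<omega> True by (simp add: \<zeta>_def not_le)
          qed (use True in \<open>simp add: \<zeta>_def not_le\<close>)
          have "0 \<le> s" using t s by auto
          have "(\<lambda>\<omega>. INF k\<in>?A. W k \<omega>) \<in> borel_measurable (F2 s)"
            using Wm s(2) by (intro borel_measurable_cINF_real) auto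
          moreover have "{\<omega> \<in> space (F2 s). \<omega> \<in> \<Omega>1} \<in> sets (F2 s)"
          proof -
            have "{\<omega> \<in> space (F2 s). \<omega> \<in> \<Omega>1} = \<Omega>1" using sp[OF \<open>0 \<le> s\<close> s(2)] by (auto simp: \<Omega>1_def)
            then show ?thesis using \<Omega>1_F[OF \<open>0 \<le> s\<close> s(2)] by simp
          qed
          ultimately show ?thesis unfolding eq[abs_def] by (intro measurable_If borel_measurable_const)
        qed
        show ?thesis
        proof (rule measurableI)
          fix B :: "real set" assume B: "B \<in> sets borel"
          have "\<zeta> t -` B \<inter> space (F2 t) \<in> (\<Inter>s\<in>{t<..T}. sets (F2 s))"
          proof
            fix s assume "s \<in> {t<..T}"
            then have s: "t < s" "s \<le> T" "0 \<le> s" using t by auto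
            show "\<zeta> t -` B \<inter> space (F2 t) \<in> sets (F2 s)"
              using measurable_sets[OF ms[OF s(1,2)] B] sp[OF t] sp[OF s(3,2)] by simp
          qed
          moreover have "sets (F2 t) = (\<Inter>s\<in>{t<..T}. sets (F2 s))"
            using rcF2 t True by (simp only: right_continuous_filtration_def tset_iff)
          ultimately show "\<zeta> t -` B \<inter> space (F2 t) \<in> sets (F2 t)" by (simp only:)
        qed simp
      qed
    qed
    moreover have "cadlag_path T (\<lambda>t. \<zeta> t \<omega>)" for \<omega>
      unfolding cadlag_path_def
    proof (intro conjI ballI impI)
      fix t assume "t \<in> tset T" "0 < t"
      then show "\<exists>l. ((\<lambda>t. \<zeta> t \<omega>) \<longlongrightarrow> l) (at_left t)"
        by (intro mono_path_left_limit[where T=T]) (auto simp: tset_iff \<zeta>_mono)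
    next
      fix t assume "t \<in> tset T" and tT: "t < T"
      then have t: "0 \<le> t" by (simp add: tset_iff)
      show "((\<lambda>t. \<zeta> t \<omega>) \<longlongrightarrow> \<zeta> t \<omega>) (at_right t)"
      proof (rule decreasing_tendsto)
        show "\<forall>\<^sub>F s in at_right t. \<zeta> t \<omega> \<le> \<zeta> s \<omega>"
          unfolding eventually_at_right[OF tT] using tT t by (intro exI[of _ T]) (auto intro!: \<zeta>_mono)
        fix b assume b: "\<zeta> t \<omega> < b"
        show "\<forall>\<^sub>F s in at_right t. \<zeta> s \<omega> < b"
        proof (cases "\<omega> \<in> \<Omega>1")
          case True
          obtain k where k: "t < ?r k" "w k \<omega> < b" using \<zeta>_less[OF True t tT b] by auto
          show ?thesis unfolding eventually_at_right[OF tT]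
            using k \<zeta>_le[OF True, of _ k] by (intro exI[of _ "?r k"]) (auto intro: le_less_trans)
        next
          case False
          then show ?thesis using b by (intro always_eventually) (auto simp: \<zeta>_def split: if_splits)
        qed
      qed
    qed
    moreover have "\<zeta> T \<omega> = 1" for \<omega> by (simp add: \<zeta>_def)
    ultimately show ?thesis
      using \<zeta>_0 \<zeta>_mono by (auto simp: Acirc_def tset_iff intro!: mono_onI)
  qed
  show ?thesis
  proof (intro bexI[OF _ \<zeta>K] allI impI)
    fix y' assume yK: "\<forall>n. y' n \<in> K2" and ae: "AE \<omega> in M. \<forall>k. (\<lambda>n. y' n (?r k) \<omega>) \<longlonglongrightarrow> w k \<omega>"
    then have y': "y' n \<in> K2" for n by blast
    from ae \<Omega>1_AE
    show "AE \<omega> in M. \<forall>t. 0 \<le> t \<longrightarrow> t < T \<longrightarrow> lft (\<lambda>s. \<zeta> s \<omega>) t = \<zeta> t \<omega> \<longrightarrow> (\<lambda>n. y' n t \<omega>) \<longlonglongrightarrow> \<zeta> t \<omega>"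
    proof eventually_elim
      case (elim \<omega>)
      note dy = Acirc_dpath[OF y' \<Omega>1_sp[OF elim(2)]]
      note d\<zeta> = Acirc_dpath[OF \<zeta>K \<Omega>1_sp[OF elim(2)]]
      show ?case
      proof (intro allI impI order_tendstoI)
        \<comment> \<open>The upper estimate holds at every \<open>t < T\<close>: a listed time
          after \<open>t\<close> with small limit bounds the values at \<open>t\<close>.\<close>
        fix t b assume t: "0 \<le> t" "t < T" and b: "\<zeta> t \<omega> < b"
        obtain k where k: "t < ?r k" "w k \<omega> < b" using \<zeta>_less[OF elim(2) t b] by auto
        from order_tendstoD(2)[OF elim(1)[rule_format] k(2)]
        show "\<forall>\<^sub>F n in sequentially. y' n t \<omega> < b"
        proof eventually_elim
          case (elim n)
          then show ?case using dpath_mono[OF dy[of n] t(1) less_imp_le[OF k(1)] rb(2)] by linarith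
        qed
      next
        \<comment> \<open>The lower estimate uses left continuity of \<zeta> at \<open>t\<close>:
          some earlier time already has a value above \<open>a\<close>, and a listed time lies
          between the two.\<close>
        fix t a assume t: "0 \<le> t" "t < T" and l: "lft (\<lambda>s. \<zeta> s \<omega>) t = \<zeta> t \<omega>" and a: "a < \<zeta> t \<omega>"
        have tT: "t \<le> T" using t by simp
        show "\<forall>\<^sub>F n in sequentially. a < y' n t \<omega>"
        proof (cases "a < 0")
          case True
          then show ?thesis using dpath_nonneg[OF dy t(1) tT] by (intro always_eventually) (auto intro: less_le_trans)
        next
          case False
          then obtain s where s: "0 \<le> s" "s < t" "a < \<zeta> s \<omega>"
            using less_lft_iff[OF d\<zeta> t(1) tT, of a] a l by auto
          obtain k where k: "s < ?r k" "?r k < t" using ratime_dense[OF s(1,2) tT] .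
          have "a < w k \<omega>" using \<zeta>_le[OF elim(2) k(1)] s by linarith
          from order_tendstoD(1)[OF elim(1)[rule_format] this]
          show ?thesis
          proof eventually_elim
            case (elim n)
            then show ?case using dpath_mono[OF dy[of n] rb(1) less_imp_le[OF k(2)] tT] by linarith
          qed
        qed
      qed
    qed
  qed
qed

text \<open>The superlevel sets of the payoff at heights below \<open>V\<close>, over finite sets of
  controls, form one directed family. Its limit \<open>w\<close> fixes \<zeta> before any particular
  \<xi> is considered; afterwards each \<xi> and each \<open>c < V\<close> contributes its own
  sequence with the same limit.\<close>

lemma optimal_control_K1: "\<exists>\<zeta>\<in>K2. \<forall>\<xi>\<in>K1. V \<le> J \<xi> \<zeta>"
proof -
  \<comment> \<open>The geometric law is a finite measure charging every index, so almost sure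
    convergence on the product means convergence at all listed times.\<close>
  let ?p = "geometric_pmf (1/2)"
  let ?N = "measure_pmf ?p \<Otimes>\<^sub>M M"
  let ?S = "\<lambda>A c. {\<zeta> \<in> K2. \<forall>\<xi>\<in>A. c < J \<xi> \<zeta>}"
  define CC where "CC = {?S A c | A c. finite A \<and> A \<noteq> {} \<and> A \<subseteq> K1 \<and> c < V}"
  define u where "u z p = z (ratime T (fst p)) (snd p)" for z :: "ereal \<Rightarrow> 'a \<Rightarrow> real" and p
  interpret N: prob_space "measure_pmf ?p" by (rule measure_pmf.prob_space_axioms)
  interpret PN: pair_sigma_finite "measure_pmf ?p" M ..
  have rb: "0 \<le> ratime T k" "ratime T k \<le> T" for k using ratime_bounds[OF T0] by auto
  have CCsub: "C \<subseteq> K2" if "C \<in> CC" for C using that by (auto simp: CC_def)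
  obtain w where w: "\<And>B. (\<And>n::nat. B n \<in> CC) \<Longrightarrow> \<exists>z. (\<forall>n. z n \<in> B n) \<and> (AE p in ?N. (\<lambda>n. u (z n) p) \<longlonglongrightarrow> w p)"
  proof (rule directed_convex_AE_limit[of ?N CC u "mixp (1/2)"])
    show "finite_measure ?N"
      by (intro finite_measureI) (simp add: space_pair_measure emeasure_pair_measure_Times emeasure_space_1)
    { fix D a assume "D \<in> CC" "a \<in> D"
      then have a: "a \<in> K2" using CCsub by blast
      show "u a \<in> borel_measurable ?N"
      proof -
        have "u a \<in> borel_measurable (count_space UNIV \<Otimes>\<^sub>M M)"
          using Acirc_measurable[OF filF2 a rb]
          by (intro measurable_pair_measure_countable1) (auto simp: u_def)
        then show ?thesis by (subst measurable_cong_sets[OF sets_pair_measure_cong refl]) auto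
      qed
      show "\<bar>u a p\<bar> \<le> 1" if "p \<in> space ?N" for p
        unfolding u_def using that dpath_nonneg[OF Acirc_dpath[OF a] rb] dpath_le_1[OF Acirc_dpath[OF a] rb]
        by (auto simp: space_pair_measure) }
    { fix D a b assume D: "D \<in> CC" and ab: "a \<in> D" "b \<in> D"
      then obtain A c where A: "D = ?S A c" "A \<subseteq> K1" by (auto simp: CC_def)
      have abK: "a \<in> K2" "b \<in> K2" using ab A by auto
      have "mixp (1/2) a b \<in> K2" by (rule Acirc_mix[OF T abK]) auto
      moreover have "c < J \<xi> (mixp (1/2) a b)" if "\<xi> \<in> A" for \<xi>
      proof -
        have "c < J \<xi> a" "c < J \<xi> b" using ab A that by auto
        then show ?thesis using J_mix2[OF K1_Acirc abK, of \<xi> "1/2"] that A(2) by auto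
      qed
      ultimately show "mixp (1/2) a b \<in> D" using A(1) by auto
      show "u (mixp (1/2) a b) p = (u a p + u b p) / 2" for p
        by (simp add: u_def mixp_def field_simps) }
    show "D \<noteq> {}" if "D \<in> CC" for D using that finite_intersection by (auto simp only: CC_def mem_Collect_eq)
    show "CC \<noteq> {}"
    proof -
      obtain \<xi> where "\<xi> \<in> K1" using K1_nonempty by auto
      then have "?S {\<xi>} (V - 1) \<in> CC" unfolding CC_def by (intro CollectI exI[of _ "{\<xi>}"] exI[of _ "V - 1"]) auto
      then show ?thesis by auto
    qed
    fix A B assume "A \<in> CC" "B \<in> CC"
    then obtain A' c B' d where AB: "A = ?S A' c" "finite A'" "A' \<noteq> {}" "A' \<subseteq> K1" "c < V"
       "B = ?S B' d" "finite B'" "B' \<noteq> {}" "B' \<subseteq> K1" "d < V" unfolding CC_def by blast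
    have "?S (A' \<union> B') (max c d) \<in> CC" unfolding CC_def using AB by (intro CollectI exI[of _ "A' \<union> B'"] exI[of _ "max c d"]) auto
    moreover have "?S (A' \<union> B') (max c d) \<subseteq> A \<inter> B" using AB by auto
    ultimately show "\<exists>C\<in>CC. C \<subseteq> A \<inter> B" by blast
  qed (use that in blast)
  have AEk: "AE \<omega> in M. \<forall>k. (\<lambda>n. z n (ratime T k) \<omega>) \<longlonglongrightarrow> w (k, \<omega>)" if "AE p in ?N. (\<lambda>n. u (z n) p) \<longlonglongrightarrow> w p" for z
  proof -
    have "AE k in measure_pmf ?p. AE \<omega> in M. (\<lambda>n. u (z n) (k, \<omega>)) \<longlonglongrightarrow> w (k, \<omega>)" by (rule PN.AE_pair[OF that])
    then have "\<forall>k. AE \<omega> in M. (\<lambda>n. u (z n) (k, \<omega>)) \<longlonglongrightarrow> w (k, \<omega>)" by (simp add: AE_measure_pmf_iff set_pmf_geometric)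
    then show ?thesis by (simp add: AE_all_countable u_def)
  qed
  have S1: "?S {\<xi>} c \<in> CC" if "\<xi> \<in> K1" "c < V" for \<xi> c
    unfolding CC_def using that by (intro CollectI exI[of _ "{\<xi>}"] exI[of _ c]) auto
  \<comment> \<open>Any member of the family gives a first sequence, from which \<zeta> is
    built.\<close>
  obtain \<xi>0 where \<xi>0: "\<xi>0 \<in> K1" using K1_nonempty by auto
  obtain y0 where y0: "\<forall>n. y0 n \<in> ?S {\<xi>0} (V - 1)" "AE p in ?N. (\<lambda>n. u (y0 n) p) \<longlonglongrightarrow> w p"
    using w[of "\<lambda>_. ?S {\<xi>0} (V - 1)"] S1[OF \<xi>0] by auto
  have y0K: "y0 n \<in> K2" for n using y0(1) by auto
  obtain \<zeta> where \<zeta>: "\<zeta> \<in> K2" and lim: "\<forall>y'. (\<forall>n. y' n \<in> K2) \<longrightarrow>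
      (AE \<omega> in M. \<forall>k. (\<lambda>n. y' n (ratime T k) \<omega>) \<longlonglongrightarrow> w (k, \<omega>)) \<longrightarrow>
      (AE \<omega> in M. \<forall>t. 0 \<le> t \<longrightarrow> t < T \<longrightarrow> lft (\<lambda>s. \<zeta> s \<omega>) t = \<zeta> t \<omega> \<longrightarrow> (\<lambda>n. y' n t \<omega>) \<longlonglongrightarrow> \<zeta> t \<omega>)"
    using limit_control[of y0 "\<lambda>k \<omega>. w (k, \<omega>)", OF y0K AEk[OF y0(2)]] by (elim bexE) (rule that)
  have "V \<le> J \<xi> \<zeta>" if \<xi>: "\<xi> \<in> K1" for \<xi>
  proof (rule dense_le)
    fix c assume c: "c < V"
    obtain y where y: "\<forall>n. y n \<in> ?S {\<xi>} c" "AE p in ?N. (\<lambda>n. u (y n) p) \<longlonglongrightarrow> w p"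
      using w[of "\<lambda>_. ?S {\<xi>} c"] S1[OF \<xi> c] by auto
    show "c \<le> J \<xi> \<zeta>"
    proof (rule J_usc[OF K1_Kc[OF \<xi>] _ _ \<zeta>])
      show "\<forall>\<omega>\<in>space M. \<xi> 0 \<omega> = 0" using \<xi> by (simp add: K1_def)
      show "y n \<in> K2" "c \<le> J \<xi> (y n)" for n using y(1) by (auto intro: less_imp_le)
      then show "AE \<omega> in M. \<forall>t. 0 \<le> t \<longrightarrow> t < T \<longrightarrow> lft (\<lambda>s. \<zeta> s \<omega>) t = \<zeta> t \<omega> \<longrightarrow> (\<lambda>n. y n t \<omega>) \<longlonglongrightarrow> \<zeta> t \<omega>"
        using AEk[OF y(2)] by (intro lim[rule_format])
    qed
  qed
  with \<zeta> show ?thesis by auto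
qed

text \<open>An initial jump of \<xi> can be spread at a cost below any positive \<open>e\<close>, so
  the bound for \<open>K1\<close> carries over.\<close>

lemma optimal_control: "\<exists>\<zeta>\<in>K2. \<forall>\<xi>\<in>Acirc_ac M T F1. V \<le> J \<xi> \<zeta>"
proof -
  obtain \<zeta> where \<zeta>: "\<zeta> \<in> K2" "\<And>\<xi>. \<xi> \<in> K1 \<Longrightarrow> V \<le> J \<xi> \<zeta>" using optimal_control_K1 by auto
  have "V \<le> J \<xi> \<zeta>" if \<xi>: "\<xi> \<in> Acirc_ac M T F1" for \<xi>
  proof (rule field_le_epsilon)
    fix e :: real assume "0 < e"
    then obtain \<xi>' where "\<xi>' \<in> Acirc_ac M T F1" "\<forall>\<omega>\<in>space M. \<xi>' 0 \<omega> = 0" "J \<xi>' \<zeta> < J \<xi> \<zeta> + e"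
      using J_spread_le[OF \<xi> \<zeta>(1)] by blast
    then show "V \<le> J \<xi> \<zeta> + e" using \<zeta>(2)[of \<xi>'] by (simp add: K1_def)
  qed
  with \<zeta> show ?thesis by auto
qed

text \<open>For the optimal \<zeta> the chain
  \<open>V \<le> INF N(\<xi>,\<zeta>) \<le> ?L \<le> ?R \<le> V\<close> closes; \<open>V\<close> is
  a genuine real infimum because the payoff is bounded uniformly in both controls.\<close>

lemma minimax:
  shows "(SUP \<zeta>\<in>Acls M T F2. INF \<xi>\<in>Acls_ac M T F1. ereal (Npay M T F1 F2 f g h \<xi> \<zeta>))
           = (INF \<xi>\<in>Acls_ac M T F1. SUP \<zeta>\<in>Acls M T F2. ereal (Npay M T F1 F2 f g h \<xi> \<zeta>))
       \<and> (\<exists>\<zeta>\<in>Acls M T F2.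
            (INF \<xi>\<in>Acls_ac M T F1. ereal (Npay M T F1 F2 f g h \<xi> \<zeta>))
             = (SUP \<zeta>\<in>Acls M T F2. INF \<xi>\<in>Acls_ac M T F1. ereal (Npay M T F1 F2 f g h \<xi> \<zeta>)))"
    (is "?L = ?R \<and> _")
proof -
  let ?N = "Npay M T F1 F2 f g h"
  obtain \<zeta> where \<zeta>: "\<zeta> \<in> K2" "\<And>\<xi>. \<xi> \<in> Acirc_ac M T F1 \<Longrightarrow> V \<le> J \<xi> \<zeta>" using optimal_control by auto
  have refl: "ae_equal M T \<rho> \<rho>" for \<rho> by (simp add: ae_equal_def)
  have \<zeta>A: "\<zeta> \<in> Acls M T F2" using \<zeta>(1) refl Acirc_prog_meas[OF T filF2] by (auto simp: Acls_def)
  have VI: "ereal V \<le> (INF \<xi>\<in>Acls_ac M T F1. ereal (?N \<xi> \<zeta>))"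
  proof (rule INF_greatest)
    fix x assume "x \<in> Acls_ac M T F1"
    then obtain \<xi> where \<xi>: "\<xi> \<in> Acirc_ac M T F1" "ae_equal M T x \<xi>" by (auto simp: Acls_ac_def)
    then show "ereal V \<le> ereal (?N x \<zeta>)" using Npay_eq_J[OF Acirc_ac_Kc[OF \<xi>(1)] \<xi>(2) \<zeta>(1) refl] \<zeta>(2) by simp
  qed
  have IL: "(INF \<xi>\<in>Acls_ac M T F1. ereal (?N \<xi> \<zeta>)) \<le> ?L" using \<zeta>A by (rule SUP_upper)
  have LR: "?L \<le> ?R"
  proof (intro SUP_least INF_greatest)
    fix z x assume "z \<in> Acls M T F2" "x \<in> Acls_ac M T F1"
    then show "(INF \<xi>\<in>Acls_ac M T F1. ereal (?N \<xi> z)) \<le> (SUP \<zeta>\<in>Acls M T F2. ereal (?N x \<zeta>))"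
      by (intro order_trans[OF INF_lower SUP_upper])
  qed
  \<comment> \<open>Nearly optimal controls in \<open>K1\<close> are admissible in the upper
    value.\<close>
  have RV: "?R \<le> ereal V"
  proof (rule ereal_le_epsilon2)
    fix e :: real assume "0 < e"
    then have "(INF \<xi>\<in>K1. SUP \<zeta>\<in>K2. J \<xi> \<zeta>) < V + e" by (simp add: V_def)
    then obtain \<xi> where \<xi>: "\<xi> \<in> K1" "(SUP \<zeta>\<in>K2. J \<xi> \<zeta>) < V + e"
      using cINF_less_iff[OF K1_nonempty SUP_bdd] by auto
    have \<xi>A: "\<xi> \<in> Acls_ac M T F1"
      using \<xi>(1) refl Acirc_prog_meas[OF T filF1 K1_Acirc[OF \<xi>(1)]] by (auto simp: Acls_ac_def K1_def)
    have "?R \<le> (SUP \<zeta>\<in>Acls M T F2. ereal (?N \<xi> \<zeta>))" by (rule INF_lower[OF \<xi>A])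
    also have "\<dots> \<le> ereal (V + e)"
    proof (rule SUP_least)
      fix z assume "z \<in> Acls M T F2"
      then obtain \<zeta>' where \<zeta>': "\<zeta>' \<in> K2" "ae_equal M T z \<zeta>'" by (auto simp: Acls_def)
      have "?N \<xi> z = J \<xi> \<zeta>'" by (rule Npay_eq_J[OF K1_Kc[OF \<xi>(1)] refl \<zeta>'])
      also have "\<dots> \<le> (SUP \<zeta>\<in>K2. J \<xi> \<zeta>)" by (rule cSUP_upper[OF \<zeta>'(1) J_bdd[OF K1_Acirc[OF \<xi>(1)]]])
      finally show "ereal (?N \<xi> z) \<le> ereal (V + e)" using \<xi>(2) by simp
    qed
    finally show "?R \<le> ereal V + ereal e" by simp
  qed
  have "?L = ?R" by (rule antisym[OF LR order_trans[OF RV order_trans[OF VI IL]]])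
  moreover have "(INF \<xi>\<in>Acls_ac M T F1. ereal (?N \<xi> \<zeta>)) = ?L"
    by (rule antisym[OF IL order_trans[OF LR order_trans[OF RV VI]]])
  ultimately show ?thesis using \<zeta>A by blast
qed

end

theorem mainTheorem8:
  fixes M :: "'a measure" and T :: ereal
    and F F1 F2 :: "ereal \<Rightarrow> 'a measure"
    and f g h :: "ereal \<Rightarrow> 'a \<Rightarrow> real"
  assumes "prob_space M" and "complete_measure M"
    and "0 < T"
    and "is_filtration M T F" and "is_filtration M T F1" and "is_filtration M T F2"
    and "sub_filtration T F1 F" and "sub_filtration T F2 F"
    \<comment> \<open>(A1)\<close>
    and "f \<in> Lb M T" and "g \<in> Lb M T"
    \<comment> \<open>(A2)\<close>
    and "adapted T F f" and "adapted T F g"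
    and "regular M T F f" and "regular M T F g"
    \<comment> \<open>(A3)\<close>
    and "AE \<omega> in M. \<forall>t\<in>tset T. f t \<omega> \<ge> h t \<omega> \<and> h t \<omega> \<ge> g t \<omega>"
    \<comment> \<open>(A4)\<close>
    and "adapted T F h" and "prog_meas M T h"
    \<comment> \<open>(A5)\<close>
    and "right_continuous_filtration T F"
    and "right_continuous_filtration T F1" and "right_continuous_filtration T F2"
    and "null_sets M \<subseteq> sets (F1 0)" and "null_sets M \<subseteq> sets (F2 0)"
  shows "(SUP \<zeta>\<in>Acls M T F2. INF \<xi>\<in>Acls_ac M T F1. ereal (Npay M T F1 F2 f g h \<xi> \<zeta>))
           = (INF \<xi>\<in>Acls_ac M T F1. SUP \<zeta>\<in>Acls M T F2. ereal (Npay M T F1 F2 f g h \<xi> \<zeta>))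
       \<and> (\<exists>\<zeta>\<in>Acls M T F2.
            (INF \<xi>\<in>Acls_ac M T F1. ereal (Npay M T F1 F2 f g h \<xi> \<zeta>))
             = (SUP \<zeta>\<in>Acls M T F2. INF \<xi>\<in>Acls_ac M T F1. ereal (Npay M T F1 F2 f g h \<xi> \<zeta>)))"
proof -
  interpret dynkin_game M T F F1 F2 f g h 
    by (intro dynkin_game.intro dynkin_game_axioms.intro assms)
  show ?thesis by (rule minimax)
qed

end
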